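(* Let $d\ge1$ be an integer. For each of the four settings (I), (II), (I* ), (II* ) under (A1), with associated constant $q\in\{1,2,4\}$, there exists an objective function $F$ (on some $d$-dimensional $\Theta$) such that, for any step-size $s>0$, the iterates $(f_k)_{k\ge0}$ of the Accelerated Proximal Gradient Method (APGM) with distance-generating function $\eta_2(u)=u^2/2$, initialized with $f_0=1$, satisfy $$F(f_k)-\inf F\gtrsim k^{-\frac{2q}{d+q}},$$ i.e. there exists $c>0$ independent of $k$ such that $F(f_k)-\inf F\ge c\,k^{-2q/(d+q)}$ for all $k\ge1$.
   Context: $\Theta$ is a compact $d$-dimensional Riemannian manifold without boundary, with geodesic distance $\mathrm{dist}$, and $\tau$ is the probability measure on $\Theta$ proportional to the volume measure. $\mathcal{M}(\Theta)$ (resp. $\mathcal{M}_+(\Theta)$, $\mathcal{P}(\Theta)$) is the set of finite signed (resp. finite nonnegative, probability) Borel measures on $\Theta$, and $\|\mu\|$ is the total variation norm. $\iota_C$ is the convex indicator of $C$. Objective: $\bar F=\bar G+\bar H:\mathcal{M}(\Theta)\to\mathbb{R}\cup\{+\infty\}$ with $\bar G(\mu)=R\big(\int\Phi\,\mathrm{d}\mu\big)$, under (A1): $\Phi\in\mathcal{C}^0(\Theta;\mathcal{F})$ where $\mathcal{F}$ is a Hilbert space; $R:\mathcal{F}\to\mathbb{R}$ is convex and differentiable with Lipschitz gradient $\nabla R$; $\bar H$ is a sum of functions from the list $\iota_{\mathcal{P}(\Theta)}$, $\iota_{\mathcal{M}_+(\Theta)}$, $\mu\mapsto\lambda\|\mu\|$,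 $\iota_{\{\mu:\lambda\|\mu\|\le1\}}$ (with $\lambda\ge0$). For $f\in L^1(\tau)$: $F(f)=\bar F(f\tau)$, $G(f)=\bar G(f\tau)$, $H(f)=\bar H(f\tau)$, and $\inf F=\inf_{L^1(\tau)}F$. The differential of $\bar G$ at $\mu$ is represented by the function $\bar G'[\mu](\theta)=\langle\nabla R(\int\Phi\,\mathrm{d}\mu),\Phi(\theta)\rangle_{\mathcal{F}}$, and $G'[f]=\bar G'[f\tau]$. Settings: in each of them there is $\mu^*\in\mathcal{M}(\Theta)$ with $\bar F(\mu^* )=\inf F$, and (I): $\Phi$ Lipschitz, $\bar G'[\mu^*]$ arbitrary; $q=1$. (I* ): $\Phi$ Lipschitz and $\bar G'[\mu^*]=0$; $q=2$. (II): $\nabla_\theta\Phi$ Lipschitz (i.e. $\Phi$ is $\mathcal{C}^1$ with Lipschitz derivative), $\bar G'[\mu^*]$ arbitrary; $q=2$. (II* ): $\nabla_\theta\Phi$ Lipschitz and $\bar G'[\mu^*]=0$; $q=4$. APGM with distance-generating function $\eta$ and step-size $s>0$: given $f_0=h_0\in\operatorname{dom}H$ and $\gamma_0=1$, for $k=0,1,\dots$ $$g_k=(1-\gamma_k)f_k+\gamma_kh_k,$$ $$h_{k+1}=\arg\min_{f\in L^1(\tau)}\Big\{G(g_k)+\int G'[g_k](f-g_k)\,\mathrm{d}\tau+H(f)+\tfrac{\gamma_k}{s}D_{\bar\eta}(f,h_k)\Big\},$$ $$f_{k+1}=(1-\gamma_k)f_k+\gamma_kh_{k+1},\qquad \gamma_{k+1}=\tfrac12\Big(\sqrt{\gamma_k^4+4\gamma_k^2}-\gamma_k^2\Big),$$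 where $D_{\bar\eta}(f,g)=\int_\Theta\big(\eta(f)-\eta(g)-\eta'(g)(f-g)\big)\mathrm{d}\tau$; for $\eta=\eta_2$, $D_{\bar\eta_2}(f,g)=\frac12\int|f-g|^2\,\mathrm{d}\tau$. *)

theory Defs
  imports "HOL-Analysis.Analysis"
begin

section \<open>The separable Hilbert space of square-summable sequences\<close>

text \<open>Statements that assert the existence of a Hilbert space \<open>F\<close> take \<open>ell2\<close>, because types cannot
  be quantified. This loses nothing: a continuous \<open>\<Phi>\<close> on a compact space has its values in a
  separable closed subspace of \<open>F\<close>, which embeds isometrically into \<open>ell2\<close>, and \<open>R\<close> extends to
  \<open>ell2\<close> by composition with the orthogonal projection.\<close>

typedef ell2 = "{x :: nat \<Rightarrow> real. summable (\<lambda>n. (x n)\<^sup>2)}"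
  morphisms seq Abs_ell2
  by (rule exI[of _ "\<lambda>_. 0"]) simp

setup_lifting type_definition_ell2

lemma summable_seq_square: "summable (\<lambda>n. (seq x n)\<^sup>2)"
  using seq[of x] by simp

lemma summable_square_mult:
  fixes a b :: "nat \<Rightarrow> real"
  assumes "summable (\<lambda>n. (a n)\<^sup>2)" "summable (\<lambda>n. (b n)\<^sup>2)"
  shows "summable (\<lambda>n. a n * b n)"
proof (rule summable_comparison_test'[where N = 0])
  show "summable (\<lambda>n. (a n)\<^sup>2 + (b n)\<^sup>2)" using assms by (rule summable_add)
  show "norm (a n * b n) \<le> (a n)\<^sup>2 + (b n)\<^sup>2" for n
  proof -
    have "2 * (\<bar>a n\<bar> * \<bar>b n\<bar>) \<le> (a n)\<^sup>2 + (b n)\<^sup>2"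
      using sum_squares_bound[of "\<bar>a n\<bar>" "\<bar>b n\<bar>"] by simp
    moreover have "0 \<le> \<bar>a n\<bar> * \<bar>b n\<bar>" by simp
    ultimately have "\<bar>a n\<bar> * \<bar>b n\<bar> \<le> (a n)\<^sup>2 + (b n)\<^sup>2" by linarith
    then show ?thesis by (simp add: abs_mult)
  qed
qed

lemma summable_square_add:
  fixes a b :: "nat \<Rightarrow> real"
  assumes "summable (\<lambda>n. (a n)\<^sup>2)" "summable (\<lambda>n. (b n)\<^sup>2)"
  shows "summable (\<lambda>n. (a n + b n)\<^sup>2)"
proof -
  have "summable (\<lambda>n. (a n)\<^sup>2 + (b n)\<^sup>2 + 2 * (a n * b n))"
    by (intro summable_add summable_mult summable_square_mult assms)
  then show ?thesis by (simp add: power2_sum mult.assoc)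
qed

lemma summable_square_scale:
  fixes a :: "nat \<Rightarrow> real"
  assumes "summable (\<lambda>n. (a n)\<^sup>2)"
  shows "summable (\<lambda>n. (r * a n)\<^sup>2)"
  using summable_mult[OF assms, of "r\<^sup>2"] by (simp add: power_mult_distrib)

lemma summable_square_diff:
  fixes a b :: "nat \<Rightarrow> real"
  assumes "summable (\<lambda>n. (a n)\<^sup>2)" "summable (\<lambda>n. (b n)\<^sup>2)"
  shows "summable (\<lambda>n. (a n - b n)\<^sup>2)"
  using summable_square_add[OF assms(1) summable_square_scale[OF assms(2), of "-1"]] by simp

instantiation ell2 :: real_inner
begin

lift_definition zero_ell2 :: ell2 is "\<lambda>_. 0" by simp
lift_definition plus_ell2 :: "ell2 \<Rightarrow> ell2 \<Rightarrow> ell2" is "\<lambda>x y n. x n + y n"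
  by (rule summable_square_add)
lift_definition minus_ell2 :: "ell2 \<Rightarrow> ell2 \<Rightarrow> ell2" is "\<lambda>x y n. x n - y n"
  by (rule summable_square_diff)
lift_definition uminus_ell2 :: "ell2 \<Rightarrow> ell2" is "\<lambda>x n. - x n" by simp
lift_definition scaleR_ell2 :: "real \<Rightarrow> ell2 \<Rightarrow> ell2" is "\<lambda>r x n. r * x n"
  by (rule summable_square_scale)
definition inner_ell2 :: "ell2 \<Rightarrow> ell2 \<Rightarrow> real"
  where "inner_ell2 x y = (\<Sum>n. seq x n * seq y n)"
definition norm_ell2 :: "ell2 \<Rightarrow> real" where "norm_ell2 x = sqrt (inner x x)"
definition dist_ell2 :: "ell2 \<Rightarrow> ell2 \<Rightarrow> real" where "dist_ell2 x y = norm (x - y)"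
definition sgn_ell2 :: "ell2 \<Rightarrow> ell2" where "sgn_ell2 x = scaleR (inverse (norm x)) x"
definition uniformity_ell2 :: "(ell2 \<times> ell2) filter"
  where "uniformity_ell2 = (INF e\<in>{0 <..}. principal {(x, y). dist x y < e})"
definition open_ell2 :: "ell2 set \<Rightarrow> bool"
  where "open_ell2 U \<longleftrightarrow> (\<forall>x\<in>U. eventually (\<lambda>(x', y). x' = x \<longrightarrow> y \<in> U) uniformity)"

instance
proof
  fix x y z :: ell2 and a b r :: real
  show "x + y + z = x + (y + z)" by transfer (simp add: add.assoc)
  show "x + y = y + x" by transfer (simp add: add.commute)
  show "0 + x = x" by transfer simp
  show "- x + x = 0" by transfer simp
  show "x - y = x + - y" by transfer simp
  show "a *\<^sub>R (x + y) = a *\<^sub>R x + a *\<^sub>R y" by transfer (simp add: algebra_simps)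
  show "(a + b) *\<^sub>R x = a *\<^sub>R x + b *\<^sub>R x" by transfer (simp add: algebra_simps)
  show "a *\<^sub>R b *\<^sub>R x = (a * b) *\<^sub>R x" by transfer (simp add: algebra_simps)
  show "1 *\<^sub>R x = x" by transfer simp
  show "dist x y = norm (x - y)" by (rule dist_ell2_def)
  show "sgn x = scaleR (inverse (norm x)) x" by (rule sgn_ell2_def)
  show "norm x = sqrt (inner x x)" by (rule norm_ell2_def)
  show "inner x y = inner y x" by (simp add: inner_ell2_def mult.commute)
  have s: "summable (\<lambda>n. seq u n * seq v n)" for u v
    by (intro summable_square_mult summable_seq_square)
  show "inner (x + y) z = inner x z + inner y z"
    by (simp add: inner_ell2_def plus_ell2.rep_eq distrib_right suminf_add[OF s s])
  show "inner (r *\<^sub>R x) y = r * inner x y"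
    by (simp add: inner_ell2_def scaleR_ell2.rep_eq mult.assoc suminf_mult[OF s])
  show "0 \<le> inner x x"
    by (simp add: inner_ell2_def suminf_nonneg[OF s])
  show "inner x x = 0 \<longleftrightarrow> x = 0"
  proof
    assume "inner x x = 0"
    then have "\<forall>n. seq x n * seq x n = 0"
      using suminf_eq_zero_iff[OF s[of x x]] by (simp add: inner_ell2_def)
    then have "seq x = seq 0" by (auto simp: zero_ell2.rep_eq)
    then show "x = 0" by (simp add: seq_inject)
  qed (simp add: inner_ell2_def zero_ell2.rep_eq)
qed (rule uniformity_ell2_def, rule open_ell2_def)

end

lemma norm_ell2_square: "(norm (x :: ell2))\<^sup>2 = (\<Sum>n. (seq x n)\<^sup>2)"
  unfolding power2_norm_eq_inner inner_ell2_def by (simp add: power2_eq_square)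

lemma norm_ell2_partial: "(\<Sum>i<K. (seq x i)\<^sup>2) \<le> (norm (x :: ell2))\<^sup>2"
  unfolding norm_ell2_square by (rule sum_le_suminf[OF summable_seq_square]) auto

lemma norm_ell2_coord: "\<bar>seq x i\<bar> \<le> norm (x :: ell2)"
proof -
  have "(seq x i)\<^sup>2 \<le> (\<Sum>j<Suc i. (seq x j)\<^sup>2)" by (simp add: sum_nonneg)
  also have "\<dots> \<le> (norm x)\<^sup>2" by (rule norm_ell2_partial)
  finally show ?thesis using abs_le_square_iff[of "seq x i" "norm x"] by simp
qed

instance ell2 :: complete_space
proof
  fix X :: "nat \<Rightarrow> ell2"
  assume X: "Cauchy X"
  have "Cauchy (\<lambda>n. seq (X n) i)" for i
    unfolding Cauchy_altdef2
  proof (intro allI impI)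
    fix e :: real assume "e > 0"
    then obtain M where M: "\<forall>m\<ge>M. \<forall>n\<ge>M. dist (X m) (X n) < e"
      using X unfolding Cauchy_def by blast
    have "dist (seq (X n) i) (seq (X M) i) < e" if "n \<ge> M" for n
    proof -
      have "dist (seq (X n) i) (seq (X M) i) = \<bar>seq (X n - X M) i\<bar>"
        by (simp add: dist_real_def minus_ell2.rep_eq)
      also have "\<dots> \<le> dist (X n) (X M)" unfolding dist_norm by (rule norm_ell2_coord)
      also have "\<dots> < e" using M that by blast
      finally show ?thesis .
    qed
    then show "\<exists>N. \<forall>n\<ge>N. dist (seq (X n) i) (seq (X N) i) < e" by blast
  qed
  then have "\<forall>i. \<exists>l. (\<lambda>n. seq (X n) i) \<longlonglongrightarrow> l"
    by (simp add: Cauchy_convergent_iff convergent_def)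
  then obtain y where y: "\<And>i. (\<lambda>n. seq (X n) i) \<longlonglongrightarrow> y i" by metis
  have key: "\<exists>N. \<forall>m\<ge>N. \<forall>K. (\<Sum>i<K. (seq (X m) i - y i)\<^sup>2) \<le> e\<^sup>2" if "e > 0" for e
  proof -
    obtain N where N: "\<forall>m\<ge>N. \<forall>n\<ge>N. dist (X m) (X n) < e"
      using X \<open>e > 0\<close> unfolding Cauchy_def by blast
    have "(\<Sum>i<K. (seq (X m) i - y i)\<^sup>2) \<le> e\<^sup>2" if "m \<ge> N" for m K
    proof (rule LIMSEQ_le_const2)
      show "(\<lambda>n. \<Sum>i<K. (seq (X m) i - seq (X n) i)\<^sup>2) \<longlonglongrightarrow> (\<Sum>i<K. (seq (X m) i - y i)\<^sup>2)"
        by (intro tendsto_intros y)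
      have "(\<Sum>i<K. (seq (X m) i - seq (X n) i)\<^sup>2) \<le> e\<^sup>2" if "n \<ge> N" for n
      proof -
        have "(\<Sum>i<K. (seq (X m) i - seq (X n) i)\<^sup>2) \<le> (norm (X m - X n))\<^sup>2"
          using norm_ell2_partial[of "X m - X n" K] by (simp add: minus_ell2.rep_eq)
        also have "\<dots> \<le> e\<^sup>2"
        proof (rule power_mono)
          have "dist (X m) (X n) < e" using N \<open>m \<ge> N\<close> that by blast
          then show "norm (X m - X n) \<le> e" unfolding dist_norm by (rule less_imp_le)
        qed simp
        finally show ?thesis .
      qed
      then show "\<exists>N. \<forall>n\<ge>N. (\<Sum>i<K. (seq (X m) i - seq (X n) i)\<^sup>2) \<le> e\<^sup>2" by blast
    qed
    then show ?thesis by blast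
  qed
  have sm: "summable (\<lambda>i. (seq (X m) i - y i)\<^sup>2)"
    if "\<forall>K. (\<Sum>i<K. (seq (X m) i - y i)\<^sup>2) \<le> B" for m B
  proof (rule bounded_imp_summable)
    show "(\<Sum>i\<le>n. (seq (X m) i - y i)\<^sup>2) \<le> B" for n
      using spec[OF that, of "Suc n"] by (simp only: lessThan_Suc_atMost)
  qed simp
  obtain N1 where "\<forall>m\<ge>N1. \<forall>K. (\<Sum>i<K. (seq (X m) i - y i)\<^sup>2) \<le> 1\<^sup>2"
    using key[OF zero_less_one] by blast
  then have "summable (\<lambda>i. (seq (X N1) i - y i)\<^sup>2)" using sm by blast
  from summable_square_diff[OF summable_seq_square[of "X N1"] this]
  have ys: "summable (\<lambda>i. (y i)\<^sup>2)" by simp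
  define Y where "Y = Abs_ell2 y"
  have Y: "seq Y = y" unfolding Y_def using ys by (simp add: Abs_ell2_inverse)
  have "X \<longlonglongrightarrow> Y"
  proof (rule metric_LIMSEQ_I)
    fix e :: real assume "e > 0"
    then obtain N where N: "\<forall>m\<ge>N. \<forall>K. (\<Sum>i<K. (seq (X m) i - y i)\<^sup>2) \<le> (e/2)\<^sup>2"
      using key[OF half_gt_zero[OF \<open>e > 0\<close>]] by blast
    have "dist (X m) Y < e" if "m \<ge> N" for m
    proof -
      have "(norm (X m - Y))\<^sup>2 = (\<Sum>i. (seq (X m) i - y i)\<^sup>2)"
        unfolding norm_ell2_square minus_ell2.rep_eq Y ..
      also have "\<dots> \<le> (e/2)\<^sup>2"
      proof (rule suminf_le_const)
        have "\<forall>K. (\<Sum>i<K. (seq (X m) i - y i)\<^sup>2) \<le> (e/2)\<^sup>2" using N that by blast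
        then show "summable (\<lambda>i. (seq (X m) i - y i)\<^sup>2)"
          "(\<Sum>i<K. (seq (X m) i - y i)\<^sup>2) \<le> (e/2)\<^sup>2" for K
          using sm by blast+
      qed
      finally have "norm (X m - Y) \<le> e/2"
        by (rule power2_le_imp_le) (use \<open>e > 0\<close> in simp)
      then show ?thesis using \<open>e > 0\<close> by (simp add: dist_norm)
    qed
    then show "\<exists>N. \<forall>n\<ge>N. dist (X n) Y < e" by blast
  qed
  then show "convergent X" by (auto simp: convergent_def)
qed

instance ell2 :: banach ..

lemma ell2_dense:
  fixes x :: ell2 assumes "e > 0"
  shows "\<exists>xs :: rat list.
    dist (Abs_ell2 (\<lambda>i. if i < length xs then of_rat (xs ! i) else 0)) x < e"
proof -
  define t where "t = e\<^sup>2 / 4"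
  have t: "t > 0" using assms by (simp add: t_def)
  obtain n where "norm (\<Sum>i. (seq x (i + n))\<^sup>2) < t"
    using suminf_exist_split[OF t summable_seq_square[of x]] by blast
  then have n: "(\<Sum>i. (seq x (i + n))\<^sup>2) < t" by simp
  define \<delta> where "\<delta> = sqrt (t / (real n + 1))"
  have \<delta>: "\<delta> > 0" "\<delta>\<^sup>2 = t / (real n + 1)" using t by (simp_all add: \<delta>_def)
  have "\<forall>i. \<exists>q :: rat. \<bar>of_rat q - seq x i\<bar> < \<delta>"
  proof
    fix i
    obtain q :: rat where "seq x i < of_rat q" "of_rat q < seq x i + \<delta>"
      using of_rat_dense[of "seq x i" "seq x i + \<delta>"] \<delta> by auto
    then show "\<exists>q :: rat. \<bar>of_rat q - seq x i\<bar> < \<delta>" by (intro exI[of _ q]) auto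
  qed
  then obtain q :: "nat \<Rightarrow> rat" where q: "\<And>i. \<bar>of_rat (q i) - seq x i\<bar> < \<delta>" by metis
  define xs where "xs = map q [0..<n]"
  define z where "z = (\<lambda>i. if i < length xs then of_rat (xs ! i) else (0::real))"
  have z: "z i = (if i < n then of_rat (q i) else 0)" for i by (simp add: z_def xs_def)
  have "summable (\<lambda>i. (z i)\<^sup>2)"
    by (rule summable_finite[of "{..<n}"]) (auto simp: z)
  then have Z: "seq (Abs_ell2 z) = z" by (simp add: Abs_ell2_inverse)
  have "(norm (Abs_ell2 z - x))\<^sup>2 = (\<Sum>i. (seq (Abs_ell2 z - x) i)\<^sup>2)"
    by (rule norm_ell2_square)
  also have "\<dots> = (\<Sum>i. (seq (Abs_ell2 z - x) (i + n))\<^sup>2) + (\<Sum>i<n. (seq (Abs_ell2 z - x) i)\<^sup>2)"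
    by (rule suminf_split_initial_segment[OF summable_seq_square])
  also have "(\<Sum>i. (seq (Abs_ell2 z - x) (i + n))\<^sup>2) = (\<Sum>i. (seq x (i + n))\<^sup>2)"
    by (simp add: minus_ell2.rep_eq Z z)
  also have "(\<Sum>i<n. (seq (Abs_ell2 z - x) i)\<^sup>2) \<le> (\<Sum>i<n. \<delta>\<^sup>2)"
  proof (rule sum_mono)
    fix i assume "i \<in> {..<n}"
    then have "\<bar>seq (Abs_ell2 z - x) i\<bar> \<le> \<bar>\<delta>\<bar>"
      using q[of i] \<delta> by (simp add: minus_ell2.rep_eq Z z)
    then show "(seq (Abs_ell2 z - x) i)\<^sup>2 \<le> \<delta>\<^sup>2" by (simp add: abs_le_square_iff)
  qed
  also have "(\<Sum>i<n. \<delta>\<^sup>2) \<le> t" using t by (simp add: \<delta> field_simps)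
  finally have "(norm (Abs_ell2 z - x))\<^sup>2 < t + t" using n by simp
  also have "\<dots> \<le> e\<^sup>2" by (simp add: t_def)
  finally have "norm (Abs_ell2 z - x) < e" using assms by (simp add: power_less_imp_less_base)
  then show ?thesis unfolding dist_norm z_def by blast
qed

instance ell2 :: second_countable_topology
proof
  define D where "D = range (\<lambda>xs :: rat list.
    Abs_ell2 (\<lambda>i. if i < length xs then of_rat (xs ! i) else 0))"
  define B where "B = (\<lambda>(x :: ell2, n). ball x (1 / real (Suc n))) ` (D \<times> UNIV)"
  have "countable B" unfolding B_def D_def by auto
  have "topological_basis B"
  proof (rule topological_basisI)
    fix U x assume "U \<in> B" then show "open U" by (auto simp: B_def)
  next
    fix U and x :: ell2 assume "open U" "x \<in> U"
    then obtain e where e: "e > 0" "ball x e \<subseteq> U" using openE by blast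
    obtain n where n: "1 / real (Suc n) < e / 2"
      using nat_approx_posE[of "e/2"] e(1) by (metis half_gt_zero)
    obtain y where y: "y \<in> D" "dist y x < 1 / real (Suc n)"
      unfolding D_def using ell2_dense[of "1 / real (Suc n)" x] by auto
    have "ball y (1 / real (Suc n)) \<subseteq> ball x e"
    proof
      fix w assume "w \<in> ball y (1 / real (Suc n))"
      then have "dist x w < 1 / real (Suc n) + 1 / real (Suc n)"
        using y(2) dist_triangle_lt[of x y w] dist_triangle[of x w y] by (simp add: dist_commute)
      then show "w \<in> ball x e" using n by simp
    qed
    then show "\<exists>V\<in>B. x \<in> V \<and> V \<subseteq> U"
      using y e(2) unfolding B_def by (intro bexI[of _ "ball y (1 / real (Suc n))"]) auto
  qed
  with \<open>countable B\<close> show "\<exists>B :: ell2 set set. countable B \<and> open = generate_topology B"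
    using topological_basis_imp_subbasis by blast
qed


section \<open>Compact Riemannian manifolds\<close>

text \<open>For an open set \<open>S\<close>: all partial derivatives up to order \<open>k\<close> exist and are continuous.\<close>

primrec Ck_on :: "nat \<Rightarrow> ('a::euclidean_space \<Rightarrow> 'b::real_normed_vector) \<Rightarrow> 'a set \<Rightarrow> bool" where
  "Ck_on 0 f S \<longleftrightarrow> continuous_on S f"
| "Ck_on (Suc k) f S \<longleftrightarrow>
     f differentiable_on S \<and> (\<forall>v. Ck_on k (\<lambda>x. frechet_derivative f (at x) v) S)"

definition smooth_on :: "('a::euclidean_space \<Rightarrow> 'b::real_normed_vector) \<Rightarrow> 'a set \<Rightarrow> bool" where
  "smooth_on f S \<longleftrightarrow> (\<forall>k. Ck_on k f S)"

type_synonym ('p, 'n) chart = "'p set \<times> ('p \<Rightarrow> real ^ 'n)"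

text \<open>The set of points is the topspace of \<open>mtop\<close>, the dimension is \<open>CARD('n)\<close>. A chart is a pair
  of a domain and a coordinate map; \<open>metric M (U, \<phi>) y\<close> is the Gram matrix, in the coordinates
  \<open>\<phi>\<close>, of the Riemannian metric at the point with coordinates \<open>y \<in> \<phi> ` U\<close>. The type
  \<open>'p\<close> only supplies names for the points, its own topology is not used; a compact manifold has at
  most continuum many points, so with \<open>complex ^ 'n\<close> for \<open>'p\<close> every compact Riemannian manifold of
  dimension \<open>CARD('n)\<close> is represented up to isometry.\<close>

record ('p, 'n) riemannian =
  mtop :: "'p topology"
  charts :: "('p, 'n) chart set"
  metric :: "('p, 'n) chart \<Rightarrow> real ^ 'n \<Rightarrow> real ^ 'n ^ 'n"

abbreviation points :: "('p, 'n::finite) riemannian \<Rightarrow> 'p set" where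
  "points M \<equiv> topspace (mtop M)"

definition transition :: "('p, 'n) chart \<Rightarrow> ('p, 'n) chart \<Rightarrow> real ^ 'n \<Rightarrow> real ^ 'n" where
  "transition c c' = snd c' \<circ> inv_into (fst c) (snd c)"

definition smooth_atlas :: "('p, 'n::finite) riemannian \<Rightarrow> bool" where
  "smooth_atlas M \<longleftrightarrow>
     (\<Union>(U, \<phi>)\<in>charts M. U) = points M \<and>
     (\<forall>(U, \<phi>)\<in>charts M. openin (mtop M) U \<and> open (\<phi> ` U) \<and>
        homeomorphic_map (subtopology (mtop M) U) (top_of_set (\<phi> ` U)) \<phi>) \<and>
     (\<forall>(U, \<phi>)\<in>charts M. \<forall>(V, \<psi>)\<in>charts M.
        smooth_on (transition (U, \<phi>) (V, \<psi>)) (\<phi> ` (U \<inter> V)))"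

definition smooth_metric :: "('p, 'n::finite) riemannian \<Rightarrow> bool" where
  "smooth_metric M \<longleftrightarrow>
     (\<forall>(U, \<phi>)\<in>charts M. smooth_on (metric M (U, \<phi>)) (\<phi> ` U) \<and>
        (\<forall>y\<in>\<phi> ` U. transpose (metric M (U, \<phi>) y) = metric M (U, \<phi>) y \<and>
           (\<forall>v. v \<noteq> 0 \<longrightarrow> v \<bullet> (metric M (U, \<phi>) y *v v) > 0))) \<and>
     (\<forall>(U, \<phi>)\<in>charts M. \<forall>(V, \<psi>)\<in>charts M. \<forall>y\<in>\<phi> ` (U \<inter> V). \<forall>v w.
        v \<bullet> (metric M (U, \<phi>) y *v w) =
          frechet_derivative (transition (U, \<phi>) (V, \<psi>)) (at y) v \<bullet>
          (metric M (V, \<psi>) (transition (U, \<phi>) (V, \<psi>) y) *v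
            frechet_derivative (transition (U, \<phi>) (V, \<psi>)) (at y) w))"

text \<open>Without boundary, since chart images are open in the full space. Connectedness makes the
  geodesic distance finite.\<close>

definition compact_riemannian_manifold :: "('p, 'n::finite) riemannian \<Rightarrow> bool" where
  "compact_riemannian_manifold M \<longleftrightarrow>
     points M \<noteq> {} \<and> compact_space (mtop M) \<and> Hausdorff_space (mtop M) \<and>
     connected_space (mtop M) \<and> smooth_atlas M \<and> smooth_metric M"

text \<open>\<open>curve_length M x y l\<close>: some piecewise continuously differentiable curve from \<open>x\<close> to \<open>y\<close>, cut
  into pieces each lying in the domain of one chart, has Riemannian length \<open>l\<close>. In rule \<open>piece\<close>,
  \<open>c\<close> is the coordinate expression of the piece.\<close>

inductive curve_length :: "('p, 'n::finite) riemannian \<Rightarrow> 'p \<Rightarrow> 'p \<Rightarrow> real \<Rightarrow> bool"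
  for M :: "('p, 'n) riemannian" where
  piece: "\<lbrakk>(U, \<phi>) \<in> charts M; a < b; c C1_differentiable_on {a..b}; c ` {a..b} \<subseteq> \<phi> ` U\<rbrakk> \<Longrightarrow>
     curve_length M (inv_into U \<phi> (c a)) (inv_into U \<phi> (c b))
       (integral {a..b} (\<lambda>t. sqrt (vector_derivative c (at t) \<bullet>
          (metric M (U, \<phi>) (c t) *v vector_derivative c (at t)))))"
| join: "\<lbrakk>curve_length M x y l; curve_length M y z l'\<rbrakk> \<Longrightarrow> curve_length M x z (l + l')"

definition geodesic_dist :: "('p, 'n::finite) riemannian \<Rightarrow> 'p \<Rightarrow> 'p \<Rightarrow> real" where
  "geodesic_dist M x y = Inf {l. curve_length M x y l}"

definition borel_of :: "'p topology \<Rightarrow> 'p measure" where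
  "borel_of X = sigma (topspace X) {U. openin X U}"

text \<open>This determines \<open>\<nu>\<close> uniquely, because countably many chart domains cover the manifold.\<close>

definition volume_measure :: "('p, 'n::finite) riemannian \<Rightarrow> 'p measure \<Rightarrow> bool" where
  "volume_measure M \<nu> \<longleftrightarrow> sets \<nu> = sets (borel_of (mtop M)) \<and>
     (\<forall>(U, \<phi>)\<in>charts M. \<forall>A\<in>sets \<nu>. A \<subseteq> U \<longrightarrow>
        emeasure \<nu> A = (\<integral>\<^sup>+y\<in>\<phi> ` A. ennreal (sqrt (det (metric M (U, \<phi>) y))) \<partial>lborel))"

definition lipschitz_manifold :: "('p, 'n::finite) riemannian \<Rightarrow> ('p \<Rightarrow> 'f::real_normed_vector) \<Rightarrow> bool" where
  "lipschitz_manifold M \<Phi> \<longleftrightarrow>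
     (\<exists>L. \<forall>x\<in>points M. \<forall>y\<in>points M. norm (\<Phi> x - \<Phi> y) \<le> L * geodesic_dist M x y)"

text \<open>Continuously differentiable with Lipschitz derivative. Derivatives at different points live on
  different tangent spaces, so the Lipschitz condition is read locally in charts; on a compact
  manifold this does not depend on the atlas and is equivalent to a global Lipschitz bound with
  respect to parallel transport.\<close>

definition lipschitz_derivative_manifold ::
    "('p, 'n::finite) riemannian \<Rightarrow> ('p \<Rightarrow> 'f::real_normed_vector) \<Rightarrow> bool" where
  "lipschitz_derivative_manifold M \<Phi> \<longleftrightarrow>
     (\<forall>(U, \<phi>)\<in>charts M. \<exists>D :: real ^ 'n \<Rightarrow> (real ^ 'n) \<Rightarrow>\<^sub>L 'f.
        (\<forall>y\<in>\<phi> ` U. ((\<Phi> \<circ> inv_into U \<phi>) has_derivative blinfun_apply (D y)) (at y)) \<and>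
        (\<forall>y\<in>\<phi> ` U. \<exists>e>0. \<exists>L. L-lipschitz_on (ball y e \<inter> \<phi> ` U) D))"


section \<open>Finite signed measures\<close>

text \<open>Finite signed measures on the measurable space underlying \<open>B\<close> are real-valued set functions;
  only their values on \<open>sets B\<close> matter.\<close>

definition signed_measure :: "'p measure \<Rightarrow> ('p set \<Rightarrow> real) \<Rightarrow> bool" where
  "signed_measure B \<mu> \<longleftrightarrow> \<mu> {} = 0 \<and>
     (\<forall>A :: nat \<Rightarrow> 'p set. range A \<subseteq> sets B \<longrightarrow> disjoint_family A \<longrightarrow>
        (\<lambda>i. \<mu> (A i)) sums \<mu> (\<Union>i. A i))"

definition total_variation :: "'p measure \<Rightarrow> ('p set \<Rightarrow> real) \<Rightarrow> real" where
  "total_variation B \<mu> =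
     (SUP P\<in>{P. finite P \<and> P \<subseteq> sets B \<and> partition_on (space B) P}. \<Sum>A\<in>P. \<bar>\<mu> A\<bar>)"

text \<open>The positive part in the Jordan decomposition; the negative part is that of \<open>- \<mu>\<close>.\<close>

definition positive_part :: "'p measure \<Rightarrow> ('p set \<Rightarrow> real) \<Rightarrow> 'p measure" where
  "positive_part B \<mu> =
     measure_of (space B) (sets B) (\<lambda>A. ennreal (SUP C\<in>{C \<in> sets B. C \<subseteq> A}. \<mu> C))"

definition signed_integral ::
    "'p measure \<Rightarrow> ('p set \<Rightarrow> real) \<Rightarrow> ('p \<Rightarrow> 'f::{banach, second_countable_topology}) \<Rightarrow> 'f" where
  "signed_integral B \<mu> \<Phi> =
     (\<integral>x. \<Phi> x \<partial>positive_part B \<mu>) - (\<integral>x. \<Phi> x \<partial>positive_part B (\<lambda>A. - \<mu> A))"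

definition density_measure :: "'p measure \<Rightarrow> ('p \<Rightarrow> real) \<Rightarrow> 'p set \<Rightarrow> real" where
  "density_measure \<tau> f A = (\<integral>x\<in>A. f x \<partial>\<tau>)"


section \<open>Objective functions\<close>

text \<open>\<open>Ind\<close> stands for a convex indicator, with values 0 and \<open>\<infinity>\<close>.\<close>

datatype regularizer = Ind_probability | Ind_nonnegative | TV_penalty real | Ind_TV_ball real

primrec regularizer_value :: "'p measure \<Rightarrow> regularizer \<Rightarrow> ('p set \<Rightarrow> real) \<Rightarrow> ereal" where
  "regularizer_value B Ind_probability \<mu> =
     (if (\<forall>A\<in>sets B. \<mu> A \<ge> 0) \<and> \<mu> (space B) = 1 then 0 else \<infinity>)"
| "regularizer_value B Ind_nonnegative \<mu> = (if \<forall>A\<in>sets B. \<mu> A \<ge> 0 then 0 else \<infinity>)"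
| "regularizer_value B (TV_penalty l) \<mu> = ereal (l * total_variation B \<mu>)"
| "regularizer_value B (Ind_TV_ball l) \<mu> = (if l * total_variation B \<mu> \<le> 1 then 0 else \<infinity>)"

primrec regularizer_ok :: "regularizer \<Rightarrow> bool" where
  "regularizer_ok Ind_probability \<longleftrightarrow> True"
| "regularizer_ok Ind_nonnegative \<longleftrightarrow> True"
| "regularizer_ok (TV_penalty l) \<longleftrightarrow> l \<ge> 0"
| "regularizer_ok (Ind_TV_ball l) \<longleftrightarrow> l \<ge> 0"

record ('p, 'f) objective =
  feature :: "'p \<Rightarrow> 'f"
  loss :: "'f \<Rightarrow> real"
  regs :: "regularizer list"

definition grad :: "('f::real_inner \<Rightarrow> real) \<Rightarrow> 'f \<Rightarrow> 'f" where
  "grad R x = (THE D. GDERIV R x :> D)"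

definition assumption_A1 ::
    "'p topology \<Rightarrow> ('p, 'f::{real_inner, banach, second_countable_topology}) objective \<Rightarrow> bool" where
  "assumption_A1 X P \<longleftrightarrow>
     continuous_map X euclidean (feature P) \<and>
     convex_on UNIV (loss P) \<and> (\<forall>x. GDERIV (loss P) x :> grad (loss P) x) \<and>
     (\<exists>L. L-lipschitz_on UNIV (grad (loss P))) \<and>
     (\<forall>r\<in>set (regs P). regularizer_ok r)"

definition G_bar ::
    "'p measure \<Rightarrow> ('p, 'f::{real_inner, banach, second_countable_topology}) objective \<Rightarrow> ('p set \<Rightarrow> real) \<Rightarrow> real" where
  "G_bar B P \<mu> = loss P (signed_integral B \<mu> (feature P))"

definition dG_bar ::
    "'p measure \<Rightarrow> ('p, 'f::{real_inner, banach, second_countable_topology}) objective \<Rightarrow> ('p set \<Rightarrow> real) \<Rightarrow> 'p \<Rightarrow> real" where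
  "dG_bar B P \<mu> \<theta> = grad (loss P) (signed_integral B \<mu> (feature P)) \<bullet> feature P \<theta>"

definition H_bar :: "'p measure \<Rightarrow> ('p, 'f) objective \<Rightarrow> ('p set \<Rightarrow> real) \<Rightarrow> ereal" where
  "H_bar B P \<mu> = (\<Sum>r\<leftarrow>regs P. regularizer_value B r \<mu>)"

definition F_bar ::
    "'p measure \<Rightarrow> ('p, 'f::{real_inner, banach, second_countable_topology}) objective \<Rightarrow> ('p set \<Rightarrow> real) \<Rightarrow> ereal" where
  "F_bar B P \<mu> = ereal (G_bar B P \<mu>) + H_bar B P \<mu>"

text \<open>Restrictions to densities with respect to \<open>\<tau>\<close>. Elements of \<open>L1\<close> are given by
  representatives.\<close>

abbreviation L1 :: "'p measure \<Rightarrow> ('p \<Rightarrow> real) set" where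
  "L1 \<tau> \<equiv> {f. integrable \<tau> f}"

abbreviation "G_fun \<tau> P f \<equiv> G_bar \<tau> P (density_measure \<tau> f)"
abbreviation "dG_fun \<tau> P f \<equiv> dG_bar \<tau> P (density_measure \<tau> f)"
abbreviation "H_fun \<tau> P f \<equiv> H_bar \<tau> P (density_measure \<tau> f)"
abbreviation "F_fun \<tau> P f \<equiv> F_bar \<tau> P (density_measure \<tau> f)"

definition inf_F ::
    "'p measure \<Rightarrow> ('p, 'f::{real_inner, banach, second_countable_topology}) objective \<Rightarrow> ereal" where
  "inf_F \<tau> P = (INF f\<in>L1 \<tau>. F_fun \<tau> P f)"

datatype setting = S_I | S_I_star | S_II | S_II_star

primrec exponent_q :: "setting \<Rightarrow> nat" where
  "exponent_q S_I = 1"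
| "exponent_q S_I_star = 2"
| "exponent_q S_II = 2"
| "exponent_q S_II_star = 4"

definition in_setting ::
    "setting \<Rightarrow> ('p, 'n::finite) riemannian \<Rightarrow> 'p measure \<Rightarrow>
     ('p, 'f::{real_inner, banach, second_countable_topology}) objective \<Rightarrow> bool" where
  "in_setting S M \<tau> P \<longleftrightarrow>
     (if S \<in> {S_I, S_I_star} then lipschitz_manifold M (feature P)
      else lipschitz_derivative_manifold M (feature P)) \<and>
     (\<exists>\<mu>. signed_measure \<tau> \<mu> \<and> F_bar \<tau> P \<mu> = inf_F \<tau> P \<and>
        (S \<in> {S_I_star, S_II_star} \<longrightarrow> (\<forall>\<theta>\<in>points M. dG_bar \<tau> P \<mu> \<theta> = 0)))"


section \<open>The accelerated proximal gradient method\<close>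

primrec apgm_gamma :: "nat \<Rightarrow> real" where
  "apgm_gamma 0 = 1"
| "apgm_gamma (Suc k) = (sqrt (apgm_gamma k ^ 4 + 4 * apgm_gamma k ^ 2) - apgm_gamma k ^ 2) / 2"

text \<open>For convex \<open>\<eta>\<close> the integrand is nonnegative, and the divergence may be infinite.\<close>

definition bregman :: "'p measure \<Rightarrow> (real \<Rightarrow> real) \<Rightarrow> ('p \<Rightarrow> real) \<Rightarrow> ('p \<Rightarrow> real) \<Rightarrow> ereal" where
  "bregman \<tau> \<eta> f g =
     enn2ereal (\<integral>\<^sup>+x. ennreal (\<eta> (f x) - \<eta> (g x) - deriv \<eta> (g x) * (f x - g x)) \<partial>\<tau>)"

definition eta2 :: "real \<Rightarrow> real" where "eta2 u = u\<^sup>2 / 2"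

definition apgm_model ::
    "'p measure \<Rightarrow> ('p, 'f::{real_inner, banach, second_countable_topology}) objective \<Rightarrow>
     (real \<Rightarrow> real) \<Rightarrow> real \<Rightarrow> ('p \<Rightarrow> real) \<Rightarrow> ('p \<Rightarrow> real) \<Rightarrow> ('p \<Rightarrow> real) \<Rightarrow> ereal" where
  "apgm_model \<tau> P \<eta> t g h f =
     ereal (G_fun \<tau> P g + (\<integral>x. dG_fun \<tau> P g x * (f x - g x) \<partial>\<tau>)) + H_fun \<tau> P f +
     ereal t * bregman \<tau> \<eta> f h"

text \<open>The sequences \<open>f\<close>, \<open>g\<close>, \<open>h\<close> are iterates of the method started at \<open>f0\<close>. They are elements of
  \<open>L1\<close>, so all equations hold almost everywhere.\<close>

definition apgm ::
    "'p measure \<Rightarrow> ('p, 'f::{real_inner, banach, second_countable_topology}) objective \<Rightarrow>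
     (real \<Rightarrow> real) \<Rightarrow> real \<Rightarrow> ('p \<Rightarrow> real) \<Rightarrow>
     (nat \<Rightarrow> 'p \<Rightarrow> real) \<Rightarrow> (nat \<Rightarrow> 'p \<Rightarrow> real) \<Rightarrow> (nat \<Rightarrow> 'p \<Rightarrow> real) \<Rightarrow> bool" where
  "apgm \<tau> P \<eta> s f0 f g h \<longleftrightarrow>
     (\<forall>k. f k \<in> L1 \<tau> \<and> g k \<in> L1 \<tau> \<and> h k \<in> L1 \<tau>) \<and>
     H_fun \<tau> P (f 0) < \<infinity> \<and>
     (AE x in \<tau>. f 0 x = f0 x) \<and> (AE x in \<tau>. h 0 x = f0 x) \<and>
     (\<forall>k. (AE x in \<tau>. g k x = (1 - apgm_gamma k) * f k x + apgm_gamma k * h k x) \<and>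
          is_arg_min (apgm_model \<tau> P \<eta> (apgm_gamma k / s) (g k) (h k)) (\<lambda>u. u \<in> L1 \<tau>) (h (Suc k)) \<and>
          (AE x in \<tau>. f (Suc k) x = (1 - apgm_gamma k) * f k x + apgm_gamma k * h (Suc k) x))"

end

theory Submission
  imports Defs "HOL-Probability.Giry_Monad"
begin

text \<open>On the flat torus take \<open>\<Phi> = \<phi> \<cdot> e\<^sub>0\<close> with \<open>\<phi>\<close> comparable to \<open>dist(\<cdot>, \<theta>\<^sub>0)\<^sup>p\<close> (\<open>p = 1\<close> in (I) and (I*),
  \<open>p = 2\<close> in (II) and (II*)), the indicator of probability measures as \<open>H\<close>, and the loss \<open>R\<close> linear without star and
  quadratic with star; the minimizer is the Dirac mass at \<open>\<theta>\<^sub>0\<close>. All gradients are nonnegative multiples of \<open>\<phi>\<close>,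
  so \<open>h\<^sub>k\<close> is the truncated profile \<open>max 0 (c - T\<^sub>k \<phi>)\<close> of mass 1, where \<open>T\<^sub>k\<close> accumulates the step-sizes
  \<open>s / \<gamma>\<^sub>i \<cdot> R'(\<integral>\<phi> g\<^sub>i)\<close>. Balancing height \<open>T r\<^sup>p\<close> against volume \<open>r\<^sup>d\<close> shows that the profile has radius
  \<open>r \<sim> T powr (-1/(d + p))\<close> and moment \<open>\<integral>\<phi> h \<sim> r\<^sup>p\<close>. For linear \<open>R\<close>, \<open>T\<^sub>k \<sim> s k\<^sup>2\<close>. For quadratic \<open>R\<close> the
  increments of \<open>T\<close> are themselves averages of earlier moments, which slows \<open>T\<^sub>k\<close> down to
  \<open>k powr (2 (d + p)/(d + 2 p))\<close>.\<close>


section \<open>Densities and objectives with values on a ray\<close>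

text \<open>A density can only approach the Dirac mass. Moreover \<open>f k\<close> averages past
  and present profiles, and the past ones are more spread out, so its moment is at least that of the
  current profile. Lower bounds on the gap therefore come from upper bounds on the accumulated slope
  T. For the quadratic loss the obstacle is the feedback. Bounding all gradients by the first one
  gives T at most of order k^2 and hence only a gap of order k^(-4p/(d+p)), weaker than the claimed
  k^(-4p/(d+2p)). The decay of the gradients along the run has to be exploited, but a gradient is an
  average over the whole past and might lag far behind the current moment. Concavity of T in the
  time t_k^2 shows that this lag costs only a constant factor. Existence and uniqueness of each
  proximal step come from one quadratic inequality, so no compactness argument in L1 enters.\<close>

lemma positive_part_of_measure:
  assumes N: "finite_measure N" "sets N = sets B" and \<mu>: "\<And>A. A \<in> sets B \<Longrightarrow> \<mu> A = measure N A"
  shows "positive_part B \<mu> = N"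
proof -
  interpret N: finite_measure N by fact
  have sp: "space N = space B" by (rule sets_eq_imp_space_eq[OF N(2)])
  have "ennreal (SUP C\<in>{C \<in> sets B. C \<subseteq> A}. \<mu> C) = emeasure N A" if A: "A \<in> sets B" for A
  proof -
    have "(SUP C\<in>{C \<in> sets B. C \<subseteq> A}. \<mu> C) = measure N A"
    proof (rule cSup_eq_maximum)
      show "measure N A \<in> \<mu> ` {C \<in> sets B. C \<subseteq> A}" using A \<mu>[OF A] by force
      show "x \<le> measure N A" if "x \<in> \<mu> ` {C \<in> sets B. C \<subseteq> A}" for x
        using that A \<mu> N(2) N.finite_measure_mono by auto
    qed
    then show ?thesis by (simp add: N.emeasure_eq_measure)
  qed
  then have "positive_part B \<mu> = measure_of (space B) (sets B) (emeasure N)"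
    unfolding positive_part_def by (intro measure_of_eq) (auto simp: sets.space_closed sets.sigma_sets_eq)
  also have "\<dots> = N" unfolding sp[symmetric] N(2)[symmetric] by (rule measure_of_of_measure)
  finally show ?thesis .
qed

lemma positive_part_of_minus_measure:
  assumes \<mu>: "\<And>A. A \<in> sets B \<Longrightarrow> \<mu> A = measure N A"
  shows "positive_part B (\<lambda>A. - \<mu> A) = null_measure B"
proof -
  have "ennreal (SUP C\<in>{C \<in> sets B. C \<subseteq> A}. - \<mu> C) = 0" if A: "A \<in> sets B" for A
  proof -
    have "(SUP C\<in>{C \<in> sets B. C \<subseteq> A}. - \<mu> C) = 0"
    proof (rule cSup_eq_maximum)
      show "0 \<in> (\<lambda>C. - \<mu> C) ` {C \<in> sets B. C \<subseteq> A}"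
        by (rule image_eqI[of _ _ "{}"]) (use \<mu>[of "{}"] in auto)
      show "x \<le> 0" if "x \<in> (\<lambda>C. - \<mu> C) ` {C \<in> sets B. C \<subseteq> A}" for x
        using that \<mu> by auto
    qed
    then show ?thesis by simp
  qed
  then have "positive_part B (\<lambda>A. - \<mu> A) = measure_of (space B) (sets B) (\<lambda>_. 0)"
    unfolding positive_part_def by (intro measure_of_eq) (auto simp: sets.space_closed sets.sigma_sets_eq)
  also have "\<dots> = null_measure B" unfolding null_measure_def ..
  finally show ?thesis .
qed

text \<open>The supremum defining the positive part is attained at the set itself, that of the
  negative part at the empty set, so the Jordan decomposition is trivial. This covers densities as
  well as the Dirac mass.\<close>

lemma signed_integral_of_measure:
  assumes "finite_measure N" "sets N = sets B" "\<And>A. A \<in> sets B \<Longrightarrow> \<mu> A = measure N A"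
  shows "signed_integral B \<mu> \<Phi> = (\<integral>x. \<Phi> x \<partial>N)"
proof -
  have "AE x in null_measure B. \<Phi> x = 0" by (auto simp: eventually_ae_filter null_sets_def intro!: exI[of _ "space B"])
  then have "(\<integral>x. \<Phi> x \<partial>null_measure B) = 0" by (rule integral_eq_zero_AE)
  then show ?thesis
    unfolding signed_integral_def using positive_part_of_measure[OF assms] positive_part_of_minus_measure[OF assms(3)] by simp
qed

section \<open>Probability densities and the constraint they encode\<close>

definition prob_density :: "'p measure \<Rightarrow> ('p \<Rightarrow> real) \<Rightarrow> bool" where
  "prob_density \<tau> f \<longleftrightarrow> integrable \<tau> f \<and> (AE x in \<tau>. 0 \<le> f x) \<and> (\<integral>x. f x \<partial>\<tau>) = 1"

lemma prob_density_cong: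
  assumes "prob_density \<tau> f" "g \<in> borel_measurable \<tau>" "AE x in \<tau>. g x = f x"
  shows "prob_density \<tau> g"
proof -
  have f: "f \<in> borel_measurable \<tau>" using assms(1) by (auto simp: prob_density_def)
  have "integrable \<tau> g \<longleftrightarrow> integrable \<tau> f" "(\<integral>x. g x \<partial>\<tau>) = (\<integral>x. f x \<partial>\<tau>)"
    by (rule integrable_cong_AE integral_cong_AE; use f assms in simp)+
  moreover have "AE x in \<tau>. 0 \<le> g x"
    using assms(3) assms(1)[unfolded prob_density_def] by (auto elim: eventually_elim2)
  ultimately show ?thesis using assms(1) by (simp add: prob_density_def)
qed

lemma prob_density_convex:
  assumes "prob_density \<tau> f" "prob_density \<tau> g" "0 \<le> t" "t \<le> 1"
  shows "prob_density \<tau> (\<lambda>x. (1 - t) * f x + t * g x)"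
proof -
  have "AE x in \<tau>. 0 \<le> f x" "AE x in \<tau>. 0 \<le> g x" using assms by (auto simp: prob_density_def)
  then have "AE x in \<tau>. 0 \<le> (1 - t) * f x + t * g x" by eventually_elim (use assms in simp)
  then show ?thesis using assms by (simp add: prob_density_def)
qed

lemma signed_integral_density_measure:
  fixes \<Phi> :: "'p \<Rightarrow> 'f::{real_inner, banach, second_countable_topology}"
  assumes f: "integrable \<tau> f" "AE x in \<tau>. 0 \<le> f x" and \<Phi>: "\<Phi> \<in> borel_measurable \<tau>"
  shows "signed_integral \<tau> (density_measure \<tau> f) \<Phi> = (\<integral>x. f x *\<^sub>R \<Phi> x \<partial>\<tau>)"
proof -
  define N where "N = density \<tau> (\<lambda>x. ennreal (f x))"
  have fm: "f \<in> borel_measurable \<tau>" using f by auto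
  have em: "emeasure N A = ennreal (density_measure \<tau> f A)" if A: "A \<in> sets \<tau>" for A
  proof -
    have i: "integrable \<tau> (\<lambda>x. indicator A x * f x)" using f(1) A by (rule integrable_real_mult_indicator[of A \<tau> f, unfolded mult.commute[of "f _"], rotated])
    have "emeasure N A = (\<integral>\<^sup>+x. ennreal (f x) * indicator A x \<partial>\<tau>)"
      unfolding N_def using fm A by (intro emeasure_density) auto
    also have "\<dots> = (\<integral>\<^sup>+x. ennreal (indicator A x * f x) \<partial>\<tau>)"
      by (rule nn_integral_cong) (auto split: split_indicator)
    also have "\<dots> = ennreal (\<integral>x. indicator A x * f x \<partial>\<tau>)"
    proof (rule nn_integral_eq_integral[OF i])
      show "AE x in \<tau>. 0 \<le> indicator A x * f x" using f(2) by eventually_elim simp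
    qed
    finally show ?thesis by (simp add: density_measure_def set_lebesgue_integral_def)
  qed
  have sets: "sets N = sets \<tau>" by (simp add: N_def)
  have fin: "finite_measure N"
    by (rule finite_measureI) (simp add: N_def em[unfolded N_def])
  have "signed_integral \<tau> (density_measure \<tau> f) \<Phi> = (\<integral>x. \<Phi> x \<partial>N)"
  proof (rule signed_integral_of_measure[OF fin sets])
    fix A assume A: "A \<in> sets \<tau>"
    have "0 \<le> density_measure \<tau> f A"
      unfolding density_measure_def set_lebesgue_integral_def
      by (rule integral_nonneg_AE) (use f(2) in \<open>eventually_elim, simp\<close>)
    then show "density_measure \<tau> f A = measure N A" using em[OF A] by (simp add: measure_def)
  qed
  also have "\<dots> = (\<integral>x. f x *\<^sub>R \<Phi> x \<partial>\<tau>)"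
    unfolding N_def by (rule integral_density) (use fm f \<Phi> in auto)
  finally show ?thesis .
qed

text \<open>\<open>density_nonneg\<close> recovers a.e. nonnegativity from the set function, and the
  value on the whole space is the integral. The value \<infinity> is what later excludes competitors
  in the proximal step.\<close>

lemma regularizer_value_probability_density:
  assumes "finite_measure \<tau>" "integrable \<tau> f"
  shows "regularizer_value \<tau> Ind_probability (density_measure \<tau> f) = (if prob_density \<tau> f then 0 else \<infinity>)"
proof -
  interpret finite_measure \<tau> by fact
  have "(\<forall>A\<in>sets \<tau>. density_measure \<tau> f A \<ge> 0) \<longleftrightarrow> (AE x in \<tau>. 0 \<le> f x)"
  proof
    assume "\<forall>A\<in>sets \<tau>. density_measure \<tau> f A \<ge> 0"
    then show "AE x in \<tau>. 0 \<le> f x"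
      by (intro density_nonneg[OF assms(2)]) (auto simp: density_measure_def)
  next
    assume f: "AE x in \<tau>. 0 \<le> f x"
    show "\<forall>A\<in>sets \<tau>. density_measure \<tau> f A \<ge> 0"
      unfolding density_measure_def set_lebesgue_integral_def
      by (auto intro!: integral_nonneg_AE) (use f in \<open>eventually_elim, simp\<close>)
  qed
  moreover have "density_measure \<tau> f (space \<tau>) = (\<integral>x. f x \<partial>\<tau>)"
    by (simp add: density_measure_def set_integral_space[OF assms(2)])
  ultimately show ?thesis using assms(2) by (auto simp: prob_density_def)
qed

section \<open>A scalar problem along one direction of the Hilbert space\<close>

definition e0 :: ell2 where "e0 = Abs_ell2 (\<lambda>n. if n = 0 then 1 else 0)"

lemma inner_e0 [simp]: "e0 \<bullet> e0 = 1"
proof -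
  have "seq e0 = (\<lambda>n. if n = 0 then 1 else 0)"
    unfolding e0_def by (rule Abs_ell2_inverse) (auto intro!: summable_finite[of "{0}"] split: if_splits)
  then have "e0 \<bullet> e0 = (\<Sum>n. if n = 0 then 1 else 0)" unfolding inner_ell2_def by (intro suminf_cong) auto
  then show ?thesis using suminf_finite[of "{0::nat}" "\<lambda>n. if n = 0 then 1 else (0::real)"] by simp
qed

lemma norm_e0 [simp]: "norm e0 = 1" by (simp add: norm_eq_sqrt_inner)

text \<open>Features on a line make every gradient a scalar multiple of \<phi>, so an iterate
  influences the next step through a single real number.\<close>

definition ray_objective :: "('p \<Rightarrow> real) \<Rightarrow> (real \<Rightarrow> real) \<Rightarrow> ('p, ell2) objective" where
  "ray_objective \<phi> R = \<lparr>feature = (\<lambda>x. \<phi> x *\<^sub>R e0), loss = (\<lambda>v. R (v \<bullet> e0)), regs = [Ind_probability]\<rparr>"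

lemma grad_eqI:
  assumes "GDERIV R x :> D"
  shows "grad R x = D"
  unfolding grad_def
proof (rule the_equality)
  show "GDERIV R x :> D" by fact
  fix D' assume "GDERIV R x :> D'"
  with assms have "(\<lambda>h. h \<bullet> D') = (\<lambda>h. h \<bullet> D)"
    unfolding gderiv_def by (intro has_derivative_unique)
  then have "h \<bullet> D' = h \<bullet> D" for h by (rule fun_cong)
  then have "(D' - D) \<bullet> (D' - D) = 0" by (simp add: inner_diff_right)
  then show "D' = D" by simp
qed

lemma GDERIV_ray:
  assumes "(R has_real_derivative d) (at (v \<bullet> e0))"
  shows "GDERIV (\<lambda>v. R (v \<bullet> e0)) v :> d *\<^sub>R e0"
proof -
  have "((\<lambda>v. R (v \<bullet> e0)) has_derivative (\<lambda>h. d * (h \<bullet> e0))) (at v)"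
    by (rule has_derivative_compose[of "\<lambda>v. v \<bullet> e0" "\<lambda>h. h \<bullet> e0" v UNIV R "(*) d"])
      (use assms in \<open>auto simp: has_field_derivative_def intro!: derivative_eq_intros\<close>)
  then show ?thesis by (simp add: gderiv_def inner_scaleR_right)
qed

text \<open>The coordinate along a unit vector is linear and 1-Lipschitz, so convexity and the
  Lipschitz constant of the scalar loss carry over unchanged.\<close>

lemma assumption_A1_ray:
  assumes "continuous_map X euclidean \<phi>" "convex_on UNIV R"
    and R': "\<And>x. (R has_real_derivative R' x) (at x)" "L-lipschitz_on UNIV R'"
  shows "assumption_A1 X (ray_objective \<phi> R)"
proof -
  have gr: "grad (\<lambda>v. R (v \<bullet> e0)) v = R' (v \<bullet> e0) *\<^sub>R e0" for v
    by (rule grad_eqI[OF GDERIV_ray[OF R'(1)]])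
  have "convex_on UNIV (\<lambda>v. R (v \<bullet> e0))"
  proof (rule convex_onI)
    fix t :: real and x y :: ell2 assume "0 < t" "t < 1"
    then show "R (((1 - t) *\<^sub>R x + t *\<^sub>R y) \<bullet> e0) \<le> (1 - t) * R (x \<bullet> e0) + t * R (y \<bullet> e0)"
      using convex_onD[OF assms(2), of t "x \<bullet> e0" "y \<bullet> e0"] by (simp add: inner_add_left)
  qed simp
  moreover have "L-lipschitz_on UNIV (grad (\<lambda>v. R (v \<bullet> e0)))"
  proof (rule lipschitz_onI)
    show "0 \<le> L" using R'(2) by (rule lipschitz_on_nonneg)
    fix x y :: ell2
    have "dist (grad (\<lambda>v. R (v \<bullet> e0)) x) (grad (\<lambda>v. R (v \<bullet> e0)) y) = dist (R' (x \<bullet> e0)) (R' (y \<bullet> e0))"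
      unfolding gr by (simp add: dist_norm flip: scaleR_left_diff_distrib)
    also have "\<dots> \<le> L * dist (x \<bullet> e0) (y \<bullet> e0)" by (rule lipschitz_onD[OF R'(2)]) auto
    also have "\<dots> \<le> L * dist x y"
      using Cauchy_Schwarz_ineq2[of "x - y" e0] \<open>0 \<le> L\<close>
      by (intro mult_left_mono) (auto simp: dist_norm inner_diff_left)
    finally show "dist (grad (\<lambda>v. R (v \<bullet> e0)) x) (grad (\<lambda>v. R (v \<bullet> e0)) y) \<le> L * dist x y" .
  qed
  moreover have "continuous_map X euclidean (\<lambda>x. \<phi> x *\<^sub>R e0)"
  proof -
    have "continuous_map euclidean euclidean (\<lambda>r::real. r *\<^sub>R e0)"
      by (auto intro!: continuous_intros)
    from continuous_map_compose[OF assms(1) this] show ?thesis by (simp add: o_def)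
  qed
  ultimately show ?thesis
    using GDERIV_ray[OF R'(1)] by (auto simp: assumption_A1_def ray_objective_def gr)
qed

lemma H_bar_ray: "H_bar \<tau> (ray_objective \<phi> R) \<mu> = regularizer_value \<tau> Ind_probability \<mu>"
  by (simp add: H_bar_def ray_objective_def)

lemma signed_integral_ray:
  assumes "prob_density \<tau> f" "\<phi> \<in> borel_measurable \<tau>" "integrable \<tau> (\<lambda>x. \<phi> x * f x)"
  shows "signed_integral \<tau> (density_measure \<tau> f) (feature (ray_objective \<phi> R)) = (\<integral>x. \<phi> x * f x \<partial>\<tau>) *\<^sub>R e0"
proof -
  have "signed_integral \<tau> (density_measure \<tau> f) (\<lambda>x. \<phi> x *\<^sub>R e0) = (\<integral>x. f x *\<^sub>R (\<phi> x *\<^sub>R e0) \<partial>\<tau>)"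
    by (rule signed_integral_density_measure) (use assms in \<open>auto simp: prob_density_def\<close>)
  also have "\<dots> = (\<integral>x. (\<phi> x * f x) *\<^sub>R e0 \<partial>\<tau>)" by (simp add: mult.commute)
  also have "\<dots> = (\<integral>x. \<phi> x * f x \<partial>\<tau>) *\<^sub>R e0" by (rule integral_scaleR_left) (use assms in auto)
  finally show ?thesis by (simp add: ray_objective_def)
qed

lemma G_fun_ray:
  assumes "prob_density \<tau> f" "\<phi> \<in> borel_measurable \<tau>" "integrable \<tau> (\<lambda>x. \<phi> x * f x)"
  shows "G_fun \<tau> (ray_objective \<phi> R) f = R (\<integral>x. \<phi> x * f x \<partial>\<tau>)"
  unfolding G_bar_def signed_integral_ray[OF assms] by (simp add: ray_objective_def)

lemma F_fun_ray:
  assumes "finite_measure \<tau>" "prob_density \<tau> f" "\<phi> \<in> borel_measurable \<tau>" "integrable \<tau> (\<lambda>x. \<phi> x * f x)"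
  shows "F_fun \<tau> (ray_objective \<phi> R) f = ereal (R (\<integral>x. \<phi> x * f x \<partial>\<tau>))"
proof -
  have "integrable \<tau> f" using assms(2) by (simp add: prob_density_def)
  then have "H_fun \<tau> (ray_objective \<phi> R) f = 0"
    unfolding H_bar_ray regularizer_value_probability_density[OF assms(1) \<open>integrable \<tau> f\<close>]
    using assms(2) by simp
  then show ?thesis by (simp add: F_bar_def G_fun_ray[OF assms(2-)])
qed

lemma dG_fun_ray:
  assumes "prob_density \<tau> f" "\<phi> \<in> borel_measurable \<tau>" "integrable \<tau> (\<lambda>x. \<phi> x * f x)"
    and R': "\<And>x. (R has_real_derivative R' x) (at x)"
  shows "dG_fun \<tau> (ray_objective \<phi> R) f = (\<lambda>x. R' (\<integral>x. \<phi> x * f x \<partial>\<tau>) * \<phi> x)"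
proof
  fix x
  have "grad (loss (ray_objective \<phi> R)) (r *\<^sub>R e0) = R' r *\<^sub>R e0" for r
    using grad_eqI[OF GDERIV_ray[OF R', of "r *\<^sub>R e0"]] by (simp add: ray_objective_def)
  then show "dG_fun \<tau> (ray_objective \<phi> R) f x = R' (\<integral>x. \<phi> x * f x \<partial>\<tau>) * \<phi> x"
    unfolding dG_bar_def signed_integral_ray[OF assms(1-3)] by (simp add: ray_objective_def)
qed


section \<open>Truncated profiles of a potential well\<close>

text \<open>The geometric input of the rate: sublevel sets have volume of order r powr \<beta>, with
  \<beta> = d / p for a potential comparable to the p-th power of a distance. The lower bound stops
  at \<open>M\<close> because probabilities are at most 1.\<close>

locale potential_well = prob_space \<tau> for \<tau> :: "'p measure" +
  fixes \<phi> :: "'p \<Rightarrow> real" and M \<beta> c\<^sub>1 c\<^sub>2 :: real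
  assumes \<phi>_meas [measurable]: "\<phi> \<in> borel_measurable \<tau>"
    and \<phi>_nonneg: "\<And>x. x \<in> space \<tau> \<Longrightarrow> 0 \<le> \<phi> x"
    and \<phi>_le: "\<And>x. x \<in> space \<tau> \<Longrightarrow> \<phi> x \<le> M"
    and pos: "0 < M" "0 < \<beta>" "0 < c\<^sub>1" "0 < c\<^sub>2"
    and sublevel_ge: "\<And>r. \<lbrakk>0 < r; r \<le> M\<rbrakk> \<Longrightarrow> c\<^sub>1 * r powr \<beta> \<le> prob {x \<in> space \<tau>. \<phi> x \<le> r}"
    and sublevel_le: "\<And>r. 0 < r \<Longrightarrow> prob {x \<in> space \<tau>. \<phi> x \<le> r} \<le> c\<^sub>2 * r powr \<beta>"
begin

lemma integrable_bounded_mult_\<phi>: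
  assumes "integrable \<tau> f"
  shows "integrable \<tau> (\<lambda>x. \<phi> x * f x)"
proof (rule Bochner_Integration.integrable_bound)
  show "integrable \<tau> (\<lambda>x. M * f x)" using assms by simp
  show "AE x in \<tau>. norm (\<phi> x * f x) \<le> norm (M * f x)"
    using \<phi>_nonneg \<phi>_le by (intro AE_I2) (simp add: abs_mult mult_right_mono order.trans[OF _ abs_ge_self])
qed (use assms in measurable)

section \<open>Profiles of unit mass and their dependence on the slope\<close>

definition profile :: "real \<Rightarrow> real \<Rightarrow> 'p \<Rightarrow> real" where
  "profile c T x = max 0 (c - T * \<phi> x)"

lemma profile_meas [measurable]: "profile c T \<in> borel_measurable \<tau>"
  unfolding profile_def by measurable

lemma profile_bounds:
  assumes "0 \<le> T" "x \<in> space \<tau>"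
  shows "0 \<le> profile c T x" "profile c T x \<le> \<bar>c\<bar>"
proof -
  have "0 \<le> T * \<phi> x" using \<phi>_nonneg[OF assms(2)] assms(1) by simp
  then show "0 \<le> profile c T x" "profile c T x \<le> \<bar>c\<bar>" unfolding profile_def by linarith+
qed

lemma integrable_profile:
  assumes "0 \<le> T"
  shows "integrable \<tau> (profile c T)"
  by (rule integrable_const_bound[where B = "\<bar>c\<bar>"]) (use profile_bounds[OF assms] in auto)

text \<open>The mass is 1-Lipschitz in \<open>c\<close>, vanishes for c \<le> 0 and is at least 1 at
  c = 1 + T * M, where the profile is at least 1 everywhere. The level found by the intermediate
  value theorem acts as Lagrange multiplier of the mass constraint.\<close>

lemma ex_level:
  assumes "0 \<le> T"
  shows "\<exists>c>0. (\<integral>x. profile c T x \<partial>\<tau>) = 1"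
proof -
  define mass where "mass c = (\<integral>x. profile c T x \<partial>\<tau>)" for c
  note int = integrable_profile[OF assms]
  have "\<bar>mass c - mass c'\<bar> \<le> \<bar>c - c'\<bar>" for c c'
  proof -
    have "\<bar>mass c - mass c'\<bar> = \<bar>\<integral>x. profile c T x - profile c' T x \<partial>\<tau>\<bar>"
      unfolding mass_def by (simp add: int)
    also have "\<dots> \<le> (\<integral>x. \<bar>profile c T x - profile c' T x\<bar> \<partial>\<tau>)" by (rule integral_abs_bound)
    also have "\<dots> \<le> (\<integral>x. \<bar>c - c'\<bar> \<partial>\<tau>)"
    proof (rule integral_mono)
      show "\<bar>profile c T x - profile c' T x\<bar> \<le> \<bar>c - c'\<bar>" for x
        unfolding profile_def by linarith
    qed (use int in auto)
    finally show ?thesis by (simp add: prob_space)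
  qed
  then have "1-lipschitz_on UNIV mass" by (intro lipschitz_onI) (auto simp: dist_real_def)
  then have "continuous_on UNIV mass" by (rule lipschitz_on_continuous_on)
  then have cont: "continuous_on {0..1 + T * M} mass" by (rule continuous_on_subset) simp
  have 0: "mass c \<le> 0" if "c \<le> 0" for c
  proof -
    have "mass c = (\<integral>x. 0 \<partial>\<tau>)" unfolding mass_def
    proof (rule Bochner_Integration.integral_cong)
      fix x assume "x \<in> space \<tau>"
      then have "0 \<le> T * \<phi> x" using \<phi>_nonneg assms by simp
      then show "profile c T x = 0" using that unfolding profile_def by linarith
    qed simp
    then show ?thesis by simp
  qed
  have "mass (1 + T * M) \<ge> (\<integral>x. 1 \<partial>\<tau>)" unfolding mass_def
  proof (rule integral_mono)
    fix x assume "x \<in> space \<tau>"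
    then have "T * \<phi> x \<le> T * M" using \<phi>_le assms by (intro mult_left_mono) auto
    then show "1 \<le> profile (1 + T * M) T x" by (simp add: profile_def)
  qed (use int in auto)
  then have 1: "1 \<le> mass (1 + T * M)" by (simp add: prob_space)
  have "0 \<le> 1 + T * M" using assms pos by simp
  then obtain c where "mass c = 1"
    using IVT'[of mass 0 1 "1 + T * M"] 0[of 0] 1 cont by auto
  moreover have "c > 0" using 0[of c] \<open>mass c = 1\<close> by linarith
  ultimately show ?thesis by (auto simp: mass_def)
qed

definition level :: "real \<Rightarrow> real" where
  "level T = (SOME c. c > 0 \<and> (\<integral>x. profile c T x \<partial>\<tau>) = 1)"

definition dens :: "real \<Rightarrow> 'p \<Rightarrow> real" where "dens T = profile (level T) T"

definition moment :: "real \<Rightarrow> real" where "moment T = (\<integral>x. \<phi> x * dens T x \<partial>\<tau>)"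

lemma
  assumes "0 \<le> T"
  shows level_pos: "0 < level T" and integral_dens: "(\<integral>x. dens T x \<partial>\<tau>) = 1"
  using someI_ex[OF ex_level[OF assms]] by (auto simp: level_def dens_def)

lemma dens_meas [measurable]: "dens T \<in> borel_measurable \<tau>"
  by (simp add: dens_def)

lemma dens_bounds:
  assumes "0 \<le> T" "x \<in> space \<tau>"
  shows "0 \<le> dens T x" "dens T x \<le> level T"
  using profile_bounds[OF assms, of "level T"] level_pos[OF assms(1)] by (auto simp: dens_def)

lemma integrable_dens [simp]: "0 \<le> T \<Longrightarrow> integrable \<tau> (dens T)"
  by (simp add: dens_def integrable_profile)

lemma prob_density_dens: "0 \<le> T \<Longrightarrow> prob_density \<tau> (dens T)"
  using dens_bounds by (simp add: prob_density_def integral_dens)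

lemma dens_0: "x \<in> space \<tau> \<Longrightarrow> dens 0 x = 1"
  using integral_dens[of 0] level_pos[of 0] by (simp add: dens_def profile_def prob_space)

text \<open>In terms of the radius \<open>level T / T\<close> of the support, this says that the supports shrink.\<close>
lemma level_ratio_mono:
  assumes "0 \<le> T" "T \<le> T'"
  shows "level T' * T \<le> level T * T'"
proof (rule ccontr)
  assume "\<not> level T' * T \<le> level T * T'"
  then have neg: "level T * T' < level T' * T" by simp
  have "0 \<le> level T * T'" using level_pos[OF assms(1)] assms by simp
  then have "T \<noteq> 0" using neg by auto
  then have T: "T > 0" "T' > 0" using assms by auto
  \<comment> \<open>If the radius grew together with the slope, \<open>dens T'\<close> would
    dominate \<open>dens T\<close> pointwise, strictly wherever \<open>dens T\<close> is positive.
    Equal masses then force \<open>dens T\<close> to vanish a.e.\<close>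
  define r r' where "r = level T / T" and "r' = level T' / T'"
  have r: "r < r'" using neg T by (simp add: r_def r'_def field_simps)
  have dens: "dens T x = T * max 0 (r - \<phi> x)" "dens T' x = T' * max 0 (r' - \<phi> x)" for x
    using T by (auto simp: dens_def profile_def r_def r'_def max_def field_simps)
  have le: "dens T x \<le> dens T' x" for x
    unfolding dens using T assms r by (intro mult_mono) auto
  have "AE x in \<tau>. dens T' x - dens T x = 0"
    using integral_nonneg_eq_0_iff_AE[of \<tau> "\<lambda>x. dens T' x - dens T x"] le assms by (simp add: integral_dens)
  then have "AE x in \<tau>. dens T x = 0"
  proof eventually_elim
    case (elim x)
    show ?case
    proof (rule ccontr)
      assume "dens T x \<noteq> 0"
      then have *: "r - \<phi> x > 0" using T by (auto simp: dens max_def split: if_splits)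
      then have "T * (r - \<phi> x) < T' * (r' - \<phi> x)"
        using T assms r by (intro mult_le_less_imp_less) auto
      then show False using elim * r T by (simp add: dens max_def)
    qed
  qed
  then have "(\<integral>x. dens T x \<partial>\<tau>) = 0" by (rule integral_eq_zero_AE)
  then show False using integral_dens assms by simp
qed

lemma moment_nonneg: "0 \<le> T \<Longrightarrow> 0 \<le> moment T"
  unfolding moment_def by (rule integral_nonneg_AE) (use \<phi>_nonneg dens_bounds in auto)

text \<open>Before truncation the two profiles differ by l - a * \<phi>, and truncation preserves
  the sign. So the difference of the densities is negatively correlated with a * \<phi> - l, and l
  drops out on integration because both masses are 1.\<close>

lemma moment_antimono:
  assumes "0 \<le> T" "T \<le> T'"
  shows "moment T' \<le> moment T"
proof (cases "T = T'")
  case False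
  define a l where "a = T' - T" and "l = level T' - level T"
  have a: "a > 0" using False assms by (simp add: a_def)
  have "(dens T' x - dens T x) * (a * \<phi> x - l) \<le> 0" for x
  proof -
    have "level T' - T' * \<phi> x - (level T - T * \<phi> x) = - (a * \<phi> x - l)"
      by (simp add: a_def l_def algebra_simps)
    then show ?thesis
      by (cases "a * \<phi> x \<le> l") (auto simp: mult_le_0_iff dens_def profile_def)
  qed
  then have "(\<integral>x. (dens T' x - dens T x) * (a * \<phi> x - l) \<partial>\<tau>) \<le> (\<integral>x. 0 \<partial>\<tau>)"
    by (intro integral_mono_AE' AE_I2) auto
  also have "(\<integral>x. (dens T' x - dens T x) * (a * \<phi> x - l) \<partial>\<tau>) =
      (\<integral>x. a * (\<phi> x * dens T' x) - a * (\<phi> x * dens T x) - (l * dens T' x - l * dens T x) \<partial>\<tau>)"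
    by (simp add: algebra_simps)
  also have "\<dots> = a * moment T' - a * moment T"
    using assms by (simp add: moment_def integrable_bounded_mult_\<phi> integral_dens)
  finally show ?thesis using a by simp
qed simp

section \<open>Scaling laws for the level and the moment\<close>

definition \<kappa> :: real where "\<kappa> = 1 / (1 + \<beta>)"

text \<open>Unit mass for a height T r over a volume r powr \<beta> means that r powr (1 + \<beta>)
  is of order 1 / T. So r is of order T powr - \<kappa> and the height of order T powr (1 -
  \<kappa>); the identities serve to convert these exponents.\<close>

lemma \<kappa>: "0 < \<kappa>" "\<kappa> < 1" "\<beta> * \<kappa> = 1 - \<kappa>" "\<kappa> * (1 + \<beta>) = 1"
  using pos by (auto simp: \<kappa>_def field_simps)

lemma mass_ge:
  assumes "0 \<le> T" "\<And>x. x \<in> space \<tau> \<Longrightarrow> \<phi> x \<le> r \<Longrightarrow> b \<le> dens T x"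
  shows "b * prob {x \<in> space \<tau>. \<phi> x \<le> r} \<le> 1"
proof -
  have "(\<integral>x. b * indicator {x \<in> space \<tau>. \<phi> x \<le> r} x \<partial>\<tau>) \<le> (\<integral>x. dens T x \<partial>\<tau>)"
  proof (rule integral_mono)
    show "b * indicator {x \<in> space \<tau>. \<phi> x \<le> r} x \<le> dens T x" if "x \<in> space \<tau>" for x
      using that assms dens_bounds[OF assms(1) that] by (auto split: split_indicator)
  qed (use assms in \<open>auto simp: less_top[symmetric]\<close>)
  then show ?thesis using assms by (simp add: integral_dens)
qed

text \<open>The support lies in \<phi> \<le> r, which bounds the moment by r. On \<phi> \<le> r / 2
  the density is at least T * r / 2, and unit mass then bounds r from above.\<close>

lemma moment_le:
  assumes "0 < T"
  shows "moment T \<le> 2 * c\<^sub>1 powr - \<kappa> * T powr - \<kappa>"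
proof -
  \<comment> \<open>Capping at \<open>M\<close> keeps r within the range of
    \<open>sublevel_ge\<close>; the support is still contained in \<phi> \<le> r because \<phi>
    \<le> M.\<close>
  define r where "r = min (level T / T) M"
  have T: "0 \<le> T" using assms by simp
  have r: "0 < r" "r \<le> M" "r \<le> level T / T" using pos level_pos[OF T] assms by (auto simp: r_def)
  have Tr: "T * r \<le> level T" using r(3) assms by (simp add: field_simps)
  have "moment T \<le> (\<integral>x. r * dens T x \<partial>\<tau>)"
    unfolding moment_def
  proof (rule integral_mono)
    fix x assume x: "x \<in> space \<tau>"
    show "\<phi> x * dens T x \<le> r * dens T x"
    proof (cases "dens T x = 0")
      case False
      then have "T * \<phi> x \<le> level T" by (auto simp: dens_def profile_def)
      then have "\<phi> x \<le> r" using \<phi>_le[OF x] assms by (simp add: r_def field_simps)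
      then show ?thesis using dens_bounds[OF T x] by (simp add: mult_right_mono)
    qed simp
  qed (use T integrable_bounded_mult_\<phi> in auto)
  then have m: "moment T \<le> r" using T by (simp add: integral_dens)
  have "T * (r / 2) * prob {x \<in> space \<tau>. \<phi> x \<le> r / 2} \<le> 1"
  proof (rule mass_ge[OF T])
    fix x assume "\<phi> x \<le> r / 2"
    then have "T * \<phi> x \<le> T * (r / 2)" using T by (rule mult_left_mono)
    then show "T * (r / 2) \<le> dens T x" using Tr unfolding dens_def profile_def by (intro max.coboundedI2) simp
  qed
  moreover have "T * (r / 2) * (c\<^sub>1 * (r / 2) powr \<beta>) \<le> T * (r / 2) * prob {x \<in> space \<tau>. \<phi> x \<le> r / 2}"
    using sublevel_ge[of "r/2"] r T pos by (intro mult_left_mono) auto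
  ultimately have "c\<^sub>1 * T * ((r / 2) * (r / 2) powr \<beta>) \<le> 1" by (simp add: mult_ac)
  also have "(r / 2) * (r / 2) powr \<beta> = (r / 2) powr (1 + \<beta>)" using r by (simp add: powr_add)
  finally have "(c\<^sub>1 * T * (r / 2) powr (1 + \<beta>)) powr \<kappa> \<le> 1"
    using \<kappa> pos T by (auto intro: powr_mono_both[where b = 1 and y = 1, simplified] powr_le1)
  moreover have "((r / 2) powr (1 + \<beta>)) powr \<kappa> = r / 2"
    using \<kappa> r by (simp add: powr_powr mult.commute)
  ultimately have "c\<^sub>1 powr \<kappa> * T powr \<kappa> * (r / 2) \<le> 1"
    using pos assms by (simp add: powr_mult)
  then have "r \<le> 2 * c\<^sub>1 powr - \<kappa> * T powr - \<kappa>"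
    using pos assms by (simp add: powr_minus field_simps)
  with m show ?thesis by simp
qed

text \<open>Near the bottom of the well the density is at least half the level, so unit mass bounds
  the level. Writing 1 + T instead of T includes small slopes, whose support may be the whole
  space.\<close>

lemma level_le:
  "\<exists>C>0. \<forall>T\<ge>0. level T \<le> C * (1 + T) powr (1 - \<kappa>)"
proof -
  \<comment> \<open>The first entry serves the case r = M, where the level is bounded outright; the
    second serves the scaling regime r < M.\<close>
  define C where "C = max (2 / (c\<^sub>1 * M powr \<beta>)) ((2 powr (1 + \<beta>) / c\<^sub>1) powr \<kappa>)"
  have C: "C > 0" using pos by (auto simp: C_def less_max_iff_disj)
  have "level T \<le> C * (1 + T) powr (1 - \<kappa>)" if T: "0 \<le> T" for T
  proof -
    define c where "c = level T"
    have c: "c > 0" using level_pos[OF T] by (simp add: c_def)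
    \<comment> \<open>At this radius T * r \<le> c / 2, so the density is at least c / 2 on the
      sublevel set.\<close>
    define r where "r = min (c / (2 * (1 + T))) M"
    have r: "0 < r" "r \<le> M" using pos c T by (auto simp: r_def)
    have "(1 + T) * r \<le> (1 + T) * (c / (2 * (1 + T)))" using T by (intro mult_left_mono) (auto simp: r_def)
    also have "\<dots> = c / 2" using T by (simp add: field_simps)
    finally have r2: "T * r \<le> c / 2" using r by (simp add: algebra_simps)
    have "c / 2 * prob {x \<in> space \<tau>. \<phi> x \<le> r} \<le> 1"
    proof (rule mass_ge[OF T])
      fix x assume "\<phi> x \<le> r"
      then have "T * \<phi> x \<le> T * r" using T by (rule mult_left_mono)
      then show "c / 2 \<le> dens T x" using r2 unfolding dens_def profile_def c_def by (intro max.coboundedI2) simp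
    qed
    moreover have "c / 2 * (c\<^sub>1 * r powr \<beta>) \<le> c / 2 * prob {x \<in> space \<tau>. \<phi> x \<le> r}"
      using sublevel_ge[OF r] c by (intro mult_left_mono) auto
    ultimately have *: "c * c\<^sub>1 * r powr \<beta> \<le> 2" by simp
    show ?thesis
    proof (cases "r = M")
      case True
      have "c \<le> 2 / (c\<^sub>1 * M powr \<beta>)" using * True pos by (simp add: field_simps)
      also have "\<dots> \<le> C * 1" by (simp add: C_def)
      also have "\<dots> \<le> C * (1 + T) powr (1 - \<kappa>)"
        using C T \<kappa> by (intro mult_left_mono ge_one_powr_ge_zero) auto
      finally show ?thesis by (simp add: c_def)
    next
      case False
      then have "r = c / (2 * (1 + T))" by (simp add: r_def min_def split: if_splits)
      then have "r powr \<beta> = c powr \<beta> / (2 powr \<beta> * (1 + T) powr \<beta>)"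
        using c T powr_mult[of 2 "1 + T" \<beta>] by (simp only: powr_divide)
      with * have "c * c powr \<beta> * c\<^sub>1 \<le> 2 * (2 powr \<beta> * (1 + T) powr \<beta>)"
        using T by (simp add: field_simps)
      then have "c powr (1 + \<beta>) \<le> 2 powr (1 + \<beta>) / c\<^sub>1 * (1 + T) powr \<beta>"
        using c pos by (simp add: powr_add field_simps)
      then have "(c powr (1 + \<beta>)) powr \<kappa> \<le> (2 powr (1 + \<beta>) / c\<^sub>1 * (1 + T) powr \<beta>) powr \<kappa>"
        using \<kappa> by (intro powr_mono2) auto
      also have "(c powr (1 + \<beta>)) powr \<kappa> = c" using c \<kappa> by (simp add: powr_powr mult.commute)
      also have "(2 powr (1 + \<beta>) / c\<^sub>1 * (1 + T) powr \<beta>) powr \<kappa> = (2 powr (1 + \<beta>) / c\<^sub>1) powr \<kappa> * (1 + T) powr (1 - \<kappa>)"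
        by (subst powr_mult) (use pos T \<kappa> in \<open>auto simp: powr_powr\<close>)
      also have "\<dots> \<le> C * (1 + T) powr (1 - \<kappa>)" by (intro mult_right_mono) (auto simp: C_def)
      finally show ?thesis by (simp add: c_def)
    qed
  qed
  with C show ?thesis by blast
qed

text \<open>The upper bound on the level limits how much mass fits into a small sublevel set. At
  radius r = \<epsilon> * (1 + T) powr - \<kappa> it is at most one half, so the other half sits at
  \<phi> > r and contributes at least r / 2.\<close>

lemma moment_ge:
  "\<exists>C>0. \<forall>T\<ge>0. C * (1 + T) powr - \<kappa> \<le> moment T"
proof -
  obtain C where C: "C > 0" "\<And>T. 0 \<le> T \<Longrightarrow> level T \<le> C * (1 + T) powr (1 - \<kappa>)" using level_le by auto
  \<comment> \<open>Solves \<open>C * c\<^sub>2 * \<epsilon> powr \<beta> = 1 / 2\<close>, which is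
    exactly what makes the mass of \<open>S\<close> at most one half.\<close>
  define \<epsilon> where "\<epsilon> = (1 / (2 * C * c\<^sub>2)) powr (1 / \<beta>)"
  have \<epsilon>: "\<epsilon> > 0" using C pos by (simp add: \<epsilon>_def)
  have \<epsilon>\<beta>: "\<epsilon> powr \<beta> = 1 / (2 * C * c\<^sub>2)" using C pos by (simp add: \<epsilon>_def powr_powr)
  have "\<epsilon> / 2 * (1 + T) powr - \<kappa> \<le> moment T" if T: "0 \<le> T" for T
  proof -
    define r where "r = \<epsilon> * (1 + T) powr - \<kappa>"
    define S where "S = {x \<in> space \<tau>. \<phi> x \<le> r}"
    have [measurable]: "S \<in> sets \<tau>" unfolding S_def by measurable
    have r: "r > 0" using \<epsilon> T by (simp add: r_def)
    have "level T * prob S \<le> (C * (1 + T) powr (1 - \<kappa>)) * (c\<^sub>2 * r powr \<beta>)"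
      using C(2)[OF T] sublevel_le[OF r] level_pos[OF T] C(1) by (intro mult_mono) (auto simp: S_def)
    also have "r powr \<beta> = \<epsilon> powr \<beta> * (1 + T) powr - (1 - \<kappa>)"
    proof -
      have "- \<kappa> * \<beta> = - (1 - \<kappa>)" using \<kappa>(3) by (simp add: mult.commute)
      then show ?thesis using \<epsilon> T by (simp add: r_def powr_mult powr_powr)
    qed
    also have "(C * (1 + T) powr (1 - \<kappa>)) * (c\<^sub>2 * (\<epsilon> powr \<beta> * (1 + T) powr - (1 - \<kappa>))) = 1 / 2"
      using T C pos unfolding \<epsilon>\<beta> powr_minus by (simp add: field_simps)
    finally have half: "level T * prob S \<le> 1 / 2" .
    have intS: "integrable \<tau> (\<lambda>x. indicator S x :: real)" by (simp add: integrable_indicator_iff less_top[symmetric])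
    \<comment> \<open>Outside \<open>S\<close> this is \<phi> > r; inside \<open>S\<close> the left
      integrand is at most 0, since the density does not exceed the level.\<close>
    have "(\<integral>x. r * dens T x - r * level T * indicator S x \<partial>\<tau>) \<le> moment T"
      unfolding moment_def
    proof (rule integral_mono)
      fix x assume x: "x \<in> space \<tau>"
      show "r * dens T x - r * level T * indicator S x \<le> \<phi> x * dens T x"
      proof (cases "\<phi> x \<le> r")
        case True
        have "r * dens T x \<le> r * level T" using dens_bounds[OF T x] r by (intro mult_left_mono) auto
        moreover have "0 \<le> \<phi> x * dens T x" using dens_bounds[OF T x] \<phi>_nonneg[OF x] by simp
        ultimately show ?thesis using True x by (simp add: S_def)
      next
        case False
        then show ?thesis using x dens_bounds[OF T x] by (auto simp: S_def intro: mult_right_mono)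
      qed
    qed (use T integrable_bounded_mult_\<phi> intS in auto)
    also have "(\<integral>x. r * dens T x - r * level T * indicator S x \<partial>\<tau>) = r - r * (level T * prob S)"
      using T intS by (simp add: integral_dens)
    finally have "r - r * (level T * prob S) \<le> moment T" .
    moreover have "r * (level T * prob S) \<le> r * (1 / 2)" using half r by (intro mult_left_mono) auto
    ultimately show ?thesis by (simp add: r_def)
  qed
  then show ?thesis using \<epsilon> by (intro exI[of _ "\<epsilon> / 2"]) auto
qed

end


section \<open>The proximal step and the iterates\<close>

text \<open>The update formula gives the positive root x of the quadratic equation x^2 = (1 - x)
  y^2, where y is the previous parameter. Since the left side is a square, x \<le> 1.\<close>

lemma apgm_gamma_bounds: "0 < apgm_gamma k" "apgm_gamma k \<le> 1"
  and apgm_gamma_Suc_sq: "(apgm_gamma (Suc k))\<^sup>2 = (1 - apgm_gamma (Suc k)) * (apgm_gamma k)\<^sup>2"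
proof -
  have sq: "(apgm_gamma (Suc k))\<^sup>2 = (1 - apgm_gamma (Suc k)) * (apgm_gamma k)\<^sup>2" for k
  proof -
    have "(sqrt (apgm_gamma k ^ 4 + 4 * apgm_gamma k ^ 2))\<^sup>2 = apgm_gamma k ^ 4 + 4 * apgm_gamma k ^ 2"
      by simp
    then show ?thesis by (simp add: field_simps power2_eq_square power4_eq_xxxx)
  qed
  show "(apgm_gamma (Suc k))\<^sup>2 = (1 - apgm_gamma (Suc k)) * (apgm_gamma k)\<^sup>2" by (rule sq)
  have "0 < apgm_gamma k \<and> apgm_gamma k \<le> 1" for k
  proof (induction k)
    case (Suc k)
    have "sqrt ((apgm_gamma k ^ 2)\<^sup>2) < sqrt (apgm_gamma k ^ 4 + 4 * apgm_gamma k ^ 2)"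
      using Suc by (intro real_sqrt_less_mono) (simp add: power2_eq_square power4_eq_xxxx)
    then have 1: "0 < apgm_gamma (Suc k)" by (simp only: real_sqrt_abs) simp
    have "0 \<le> (1 - apgm_gamma (Suc k)) * (apgm_gamma k)\<^sup>2" using sq[of k] by (metis zero_le_power2)
    then have "apgm_gamma (Suc k) \<le> 1" using Suc by (simp add: zero_le_mult_iff)
    with 1 show ?case by blast
  qed simp
  then show "0 < apgm_gamma k" "apgm_gamma k \<le> 1" by auto
qed

text \<open>The divergence is infinite exactly when the square is not integrable. The Bochner
  integral would then take its default value 0, hence the case distinction.\<close>

lemma bregman_eta2:
  assumes [measurable]: "f \<in> borel_measurable \<tau>" "h \<in> borel_measurable \<tau>"
  shows "bregman \<tau> eta2 f h =
    (if integrable \<tau> (\<lambda>x. (f x - h x)\<^sup>2) then ereal ((\<integral>x. (f x - h x)\<^sup>2 \<partial>\<tau>) / 2) else \<infinity>)"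
proof -
  have "deriv eta2 u = u" for u
    unfolding eta2_def by (rule DERIV_imp_deriv) (auto intro!: derivative_eq_intros)
  then have "eta2 (f x) - eta2 (h x) - deriv eta2 (h x) * (f x - h x) = (f x - h x)\<^sup>2 / 2" for x
    by (simp add: eta2_def power2_eq_square field_simps)
  then have *: "bregman \<tau> eta2 f h = enn2ereal (\<integral>\<^sup>+x. ennreal ((f x - h x)\<^sup>2 / 2) \<partial>\<tau>)"
    unfolding bregman_def by (simp only:)
  show ?thesis
  proof (cases "integrable \<tau> (\<lambda>x. (f x - h x)\<^sup>2)")
    case True
    then have "(\<integral>\<^sup>+x. ennreal ((f x - h x)\<^sup>2 / 2) \<partial>\<tau>) = ennreal (\<integral>x. (f x - h x)\<^sup>2 / 2 \<partial>\<tau>)"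
      by (intro nn_integral_eq_integral) auto
    then show ?thesis using True by (simp add: * enn2ereal_ennreal)
  next
    case False
    have "\<not> (\<integral>\<^sup>+x. ennreal ((f x - h x)\<^sup>2 / 2) \<partial>\<tau>) < \<infinity>"
    proof
      assume "(\<integral>\<^sup>+x. ennreal ((f x - h x)\<^sup>2 / 2) \<partial>\<tau>) < \<infinity>"
      then have "integrable \<tau> (\<lambda>x. (f x - h x)\<^sup>2 / 2)" by (intro integrableI_nonneg) auto
      from integrable_mult_right[OF this, of 2] False show False by simp
    qed
    then show ?thesis using False by (simp add: * less_top[symmetric])
  qed
qed

section \<open>Optimality of the truncated profile in the proximal step\<close>

context potential_well
begin

text \<open>These are the pointwise optimality conditions of the proximal problem, with multiplier
  level (T + a) - level T: equality where the new density is positive, an inequality tested against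
  y \<ge> 0 where it vanishes.\<close>

lemma dens_prox_pointwise:
  assumes T: "0 \<le> T" "0 \<le> a" and x: "x \<in> space \<tau>" and y: "0 \<le> y"
  shows "(y - dens (T + a) x) * (level (T + a) - level T) \<le> (y - dens (T + a) x) * (a * \<phi> x + dens (T + a) x - dens T x)"
proof -
  define c c' where "c = level T" and "c' = level (T + a)"
  have c: "c > 0" "c' > 0" unfolding c_def c'_def using level_pos T by auto
  have \<phi>: "0 \<le> \<phi> x" by (rule \<phi>_nonneg[OF x])
  have ratio: "c' * T \<le> c * (T + a)" unfolding c_def c'_def using level_ratio_mono[of T "T + a"] T by simp
  have d: "dens T x = max 0 (c - T * \<phi> x)" "dens (T + a) x = max 0 (c' - (T + a) * \<phi> x)"
    by (auto simp: dens_def profile_def c_def c'_def)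
  have "(y - dens (T + a) x) * (c' - c) \<le> (y - dens (T + a) x) * (a * \<phi> x + dens (T + a) x - dens T x)"
  proof (cases "(T + a) * \<phi> x < c'")
    case True
    \<comment> \<open>Supports shrink, so a point of the new support lies in the old one; there both
      profiles are affine in \<phi> and stationarity is exact.\<close>
    have "T * \<phi> x \<le> c"
    proof (cases "T = 0")
      case False
      then have "T > 0" using T by simp
      have "T * ((T + a) * \<phi> x) \<le> T * c'" using True T by (intro mult_left_mono) auto
      then have "(T * \<phi> x) * (T + a) \<le> c * (T + a)" using ratio by (simp add: mult_ac)
      then show ?thesis using \<open>T > 0\<close> T by simp
    qed (use c in simp)
    then have "a * \<phi> x + dens (T + a) x - dens T x = c' - c"
      unfolding d using True by (simp add: max_def algebra_simps)
    then show ?thesis by simp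
  next
    case False
    then have u: "dens (T + a) x = 0" by (simp add: d)
    have "c' - c \<le> a * \<phi> x - dens T x"
    proof (cases "T * \<phi> x \<le> c")
      case True
      then show ?thesis using False by (simp add: d max_def algebra_simps)
    next
      case F: False
      then have "T > 0" using T c by (cases "T = 0") auto
      \<comment> \<open>Outside the old support as well, the increase of the level is controlled by
        the monotone ratio: T c' \<le> T c + a c and c < T \<phi>.\<close>
      have "c * a \<le> (T * \<phi> x) * a" using F T by (intro mult_right_mono) auto
      then have "c' * T \<le> (c + a * \<phi> x) * T" using ratio by (simp add: algebra_simps)
      then have "c' \<le> c + a * \<phi> x" using \<open>T > 0\<close> by simp
      then show ?thesis using F by (simp add: d)
    qed
    then show ?thesis unfolding u using y by (simp add: mult_left_mono)
  qed
  then show ?thesis by (simp only: c_def c'_def)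
qed

text \<open>All densities \<open>dens T\<close> are bounded, so finiteness of the quadratic term
  does not depend on the centre.\<close>

lemma integrable_sq_diff_dens:
  assumes f: "integrable \<tau> f" "integrable \<tau> (\<lambda>x. (f x - dens T x)\<^sup>2)" and T: "0 \<le> T" "0 \<le> T'"
  shows "integrable \<tau> (\<lambda>x. (f x - dens T' x)\<^sup>2)"
proof (rule Bochner_Integration.integrable_bound)
  show "integrable \<tau> (\<lambda>x. 2 * (f x - dens T x)\<^sup>2 + 2 * (level T + level T')\<^sup>2)" using f by simp
  have "(f x - dens T' x)\<^sup>2 \<le> 2 * (f x - dens T x)\<^sup>2 + 2 * (level T + level T')\<^sup>2" if x: "x \<in> space \<tau>" for x
  proof -
    have "(f x - dens T' x)\<^sup>2 \<le> 2 * (f x - dens T x)\<^sup>2 + 2 * (dens T x - dens T' x)\<^sup>2"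
      using zero_le_power2[of "(f x - dens T x) - (dens T x - dens T' x)"] by (simp add: power2_eq_square algebra_simps)
    moreover have "(dens T x - dens T' x)\<^sup>2 \<le> (level T + level T')\<^sup>2"
      using dens_bounds[OF T(1) x] dens_bounds[OF T(2) x] by (intro power2_le_iff_abs_le[THEN iffD2]) auto
    ultimately show ?thesis by linarith
  qed
  then show "AE x in \<tau>. norm ((f x - dens T' x)\<^sup>2) \<le> norm (2 * (f x - dens T x)\<^sup>2 + 2 * (level T + level T')\<^sup>2)"
    by (intro AE_I2) (simp add: abs_of_nonneg)
qed (use f in measurable)

text \<open>Integrating the pointwise condition removes the multiplier, since both densities have
  mass 1. The term in (f - dens (T + a))^2 on the left expresses strong convexity: it yields
  minimality and uniqueness at once.\<close>

lemma dens_prox_ineq: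
  assumes T: "0 \<le> T" "0 \<le> a" and f: "prob_density \<tau> f" "integrable \<tau> (\<lambda>x. (f x - dens T x)\<^sup>2)"
  shows "a * moment (T + a) + (\<integral>x. (dens (T + a) x - dens T x)\<^sup>2 \<partial>\<tau>) / 2 + (\<integral>x. (f x - dens (T + a) x)\<^sup>2 \<partial>\<tau>) / 2
    \<le> a * (\<integral>x. \<phi> x * f x \<partial>\<tau>) + (\<integral>x. (f x - dens T x)\<^sup>2 \<partial>\<tau>) / 2"
proof -
  define u d where "u = dens (T + a)" and "d = dens T"
  define l where "l = level (T + a) - level T"
  have Ta: "0 \<le> T + a" using T by simp
  have fi: "integrable \<tau> f" "(\<integral>x. f x \<partial>\<tau>) = 1" "AE x in \<tau>. 0 \<le> f x" using f(1) by (auto simp: prob_density_def)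
  have ui: "integrable \<tau> u" "(\<integral>x. u x \<partial>\<tau>) = 1" using Ta by (auto simp: u_def integral_dens)
  have i0: "integrable \<tau> (\<lambda>x. (f x - d x)\<^sup>2)" using f(2) by (simp add: d_def)
  have i1: "integrable \<tau> (\<lambda>x. (f x - u x)\<^sup>2)" unfolding u_def
    by (rule integrable_sq_diff_dens[OF fi(1) f(2) T(1) Ta])
  have i2: "integrable \<tau> (\<lambda>x. (u x - d x)\<^sup>2)" unfolding u_def d_def
    using integrable_sq_diff_dens[of "dens T" T "T + a"] T by (simp add: power2_commute)
  have i3: "integrable \<tau> (\<lambda>x. \<phi> x * f x)" "integrable \<tau> (\<lambda>x. \<phi> x * u x)"
    using fi ui by (auto intro: integrable_bounded_mult_\<phi>)
  have "(\<integral>x. l * f x - l * u x \<partial>\<tau>) \<le>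
    (\<integral>x. a * (\<phi> x * f x) - a * (\<phi> x * u x) + ((f x - d x)\<^sup>2 / 2 - (u x - d x)\<^sup>2 / 2 - (f x - u x)\<^sup>2 / 2) \<partial>\<tau>)"
  proof (rule integral_mono_AE)
    show "AE x in \<tau>. l * f x - l * u x \<le> a * (\<phi> x * f x) - a * (\<phi> x * u x) + ((f x - d x)\<^sup>2 / 2 - (u x - d x)\<^sup>2 / 2 - (f x - u x)\<^sup>2 / 2)"
      using fi(3) AE_space
    proof eventually_elim
      case (elim x)
      have "(f x - u x) * l \<le> (f x - u x) * (a * \<phi> x + u x - d x)"
        using dens_prox_pointwise[OF T elim(2,1)] by (simp add: u_def d_def l_def)
      \<comment> \<open>The three-point identity 2 (f - u) (u - d) = (f - d)^2 - (u - d)^2 - (f -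
        u)^2.\<close>
      moreover have "(f x - u x) * (a * \<phi> x + u x - d x) =
        a * (\<phi> x * f x) - a * (\<phi> x * u x) + ((f x - d x)\<^sup>2 / 2 - (u x - d x)\<^sup>2 / 2 - (f x - u x)\<^sup>2 / 2)"
        by (simp add: power2_eq_square field_simps)
      ultimately show ?case by (simp add: algebra_simps)
    qed
  qed (use fi ui i0 i1 i2 i3 in auto)
  then have "0 \<le> a * (\<integral>x. \<phi> x * f x \<partial>\<tau>) - a * (\<integral>x. \<phi> x * u x \<partial>\<tau>)
    + ((\<integral>x. (f x - d x)\<^sup>2 \<partial>\<tau>) / 2 - (\<integral>x. (u x - d x)\<^sup>2 \<partial>\<tau>) / 2 - (\<integral>x. (f x - u x)\<^sup>2 \<partial>\<tau>) / 2)"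
    using fi ui i0 i1 i2 i3 by simp
  then show ?thesis by (simp add: u_def d_def moment_def)
qed

end

text \<open>Nonnegative derivatives on the half line make every gradient push towards the zeros of
  \<phi>, so slopes only increase, and they make R 0 = 0 the least value of the loss on
  moments.\<close>

locale ray_problem = potential_well +
  fixes R R' :: "real \<Rightarrow> real"
  assumes R_deriv: "\<And>x. (R has_real_derivative R' x) (at x)"
    and R'_nonneg: "\<And>x. 0 \<le> x \<Longrightarrow> 0 \<le> R' x"
    and R_0: "R 0 = 0"
begin

abbreviation "obj \<equiv> ray_objective \<phi> R"

lemma R_mono: "0 \<le> x \<Longrightarrow> x \<le> y \<Longrightarrow> R x \<le> R y"
  by (rule DERIV_nonneg_imp_nondecreasing[where f = R]) (auto intro!: exI R_deriv R'_nonneg intro: order.trans)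

lemma integral_\<phi>_nonneg: "prob_density \<tau> f \<Longrightarrow> 0 \<le> (\<integral>x. \<phi> x * f x \<partial>\<tau>)"
  unfolding prob_density_def using \<phi>_nonneg AE_space[of \<tau>]
  by (intro integral_nonneg_AE) (auto elim!: eventually_elim2)

lemma F_fun_obj: "prob_density \<tau> f \<Longrightarrow> F_fun \<tau> obj f = ereal (R (\<integral>x. \<phi> x * f x \<partial>\<tau>))"
  by (rule F_fun_ray) (auto simp: prob_density_def integrable_bounded_mult_\<phi> finite_measure_axioms)

lemma H_fun_obj: "integrable \<tau> f \<Longrightarrow> H_fun \<tau> obj f = (if prob_density \<tau> f then 0 else \<infinity>)"
  unfolding H_bar_ray by (rule regularizer_value_probability_density) (auto simp: finite_measure_axioms)

lemma apgm_model_obj: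
  assumes g: "prob_density \<tau> g" and f: "integrable \<tau> f" and h: "integrable \<tau> h" and t: "0 < t"
  defines "b \<equiv> R' (\<integral>x. \<phi> x * g x \<partial>\<tau>)"
  shows "apgm_model \<tau> obj eta2 t g h f =
    (if prob_density \<tau> f \<and> integrable \<tau> (\<lambda>x. (f x - h x)\<^sup>2)
     then ereal (R (\<integral>x. \<phi> x * g x \<partial>\<tau>) - b * (\<integral>x. \<phi> x * g x \<partial>\<tau>) + (b * (\<integral>x. \<phi> x * f x \<partial>\<tau>) + t * ((\<integral>x. (f x - h x)\<^sup>2 \<partial>\<tau>) / 2)))
     else \<infinity>)"
proof -
  have gi: "integrable \<tau> g" using g by (simp add: prob_density_def)
  note i = integrable_bounded_mult_\<phi>[OF gi] integrable_bounded_mult_\<phi>[OF f]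
  have 1: "G_fun \<tau> obj g = R (\<integral>x. \<phi> x * g x \<partial>\<tau>)" by (rule G_fun_ray[OF g \<phi>_meas i(1)])
  have "(\<integral>x. dG_fun \<tau> obj g x * (f x - g x) \<partial>\<tau>) = (\<integral>x. b * (\<phi> x * f x) - b * (\<phi> x * g x) \<partial>\<tau>)"
    unfolding dG_fun_ray[OF g \<phi>_meas i(1) R_deriv] b_def by (simp add: algebra_simps)
  also have "\<dots> = b * (\<integral>x. \<phi> x * f x \<partial>\<tau>) - b * (\<integral>x. \<phi> x * g x \<partial>\<tau>)" using i by simp
  finally have 2: "(\<integral>x. dG_fun \<tau> obj g x * (f x - g x) \<partial>\<tau>) = b * (\<integral>x. \<phi> x * f x \<partial>\<tau>) - b * (\<integral>x. \<phi> x * g x \<partial>\<tau>)" .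
  have 3: "bregman \<tau> eta2 f h = (if integrable \<tau> (\<lambda>x. (f x - h x)\<^sup>2) then ereal ((\<integral>x. (f x - h x)\<^sup>2 \<partial>\<tau>) / 2) else \<infinity>)"
    using f h by (intro bregman_eta2) auto
  show ?thesis
    unfolding apgm_model_def 1 2 3 H_fun_obj[OF f] using t by auto
qed

text \<open>Minimizers are identified up to null sets: one direction determines every possible run,
  the other one provides a run.\<close>

lemma is_arg_min_apgm_model:
  assumes g: "prob_density \<tau> g" and h: "integrable \<tau> h" "AE x in \<tau>. h x = dens T x" and t: "0 < t" and T: "0 \<le> T"
  defines "a \<equiv> R' (\<integral>x. \<phi> x * g x \<partial>\<tau>) / t"
  shows "is_arg_min (apgm_model \<tau> obj eta2 t g h) (\<lambda>u. u \<in> L1 \<tau>) u \<longleftrightarrow>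
    integrable \<tau> u \<and> (AE x in \<tau>. u x = dens (T + a) x)"
proof -
  \<comment> \<open>On its domain the model equals D + t * J f; only \<open>J\<close>, the
    functional of \<open>dens_prox_ineq\<close>, depends on the competitor.\<close>
  define D where "D = R (\<integral>x. \<phi> x * g x \<partial>\<tau>) - R' (\<integral>x. \<phi> x * g x \<partial>\<tau>) * (\<integral>x. \<phi> x * g x \<partial>\<tau>)"
  define J where "J f = a * (\<integral>x. \<phi> x * f x \<partial>\<tau>) + (\<integral>x. (f x - dens T x)\<^sup>2 \<partial>\<tau>) / 2" for f
  have a: "0 \<le> a" using R'_nonneg[OF integral_\<phi>_nonneg[OF g]] t by (simp add: a_def)
  then have Ta: "0 \<le> T + a" using T by simp
  have hm [measurable]: "h \<in> borel_measurable \<tau>" using h by auto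
  have model: "apgm_model \<tau> obj eta2 t g h f =
    (if prob_density \<tau> f \<and> integrable \<tau> (\<lambda>x. (f x - dens T x)\<^sup>2) then ereal (D + t * J f) else \<infinity>)"
    if f: "integrable \<tau> f" for f
  proof -
    have [measurable]: "f \<in> borel_measurable \<tau>" using f by auto
    have *: "AE x in \<tau>. (f x - h x)\<^sup>2 = (f x - dens T x)\<^sup>2" using h(2) by eventually_elim simp
    have "integrable \<tau> (\<lambda>x. (f x - h x)\<^sup>2) \<longleftrightarrow> integrable \<tau> (\<lambda>x. (f x - dens T x)\<^sup>2)"
      by (rule integrable_cong_AE[OF _ _ *]) measurable
    moreover have "(\<integral>x. (f x - h x)\<^sup>2 \<partial>\<tau>) = (\<integral>x. (f x - dens T x)\<^sup>2 \<partial>\<tau>)"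
      by (rule integral_cong_AE[OF _ _ *]) measurable
    ultimately show ?thesis
      unfolding apgm_model_obj[OF g f h(1) t] using t by (simp add: D_def J_def a_def field_simps)
  qed
  define v where "v = dens (T + a)"
  have v: "integrable \<tau> v" "prob_density \<tau> v" using Ta by (auto simp: v_def prob_density_dens)
  have v2: "integrable \<tau> (\<lambda>x. (v x - dens T x)\<^sup>2)"
    using integrable_sq_diff_dens[of "dens T" T "T + a"] T Ta by (simp add: power2_commute v_def)
  have ineq: "J v + (\<integral>x. (f x - v x)\<^sup>2 \<partial>\<tau>) / 2 \<le> J f"
    if "prob_density \<tau> f" "integrable \<tau> (\<lambda>x. (f x - dens T x)\<^sup>2)" for f
    using dens_prox_ineq[OF T a that] by (simp add: J_def v_def moment_def)
  have min: "apgm_model \<tau> obj eta2 t g h v \<le> apgm_model \<tau> obj eta2 t g h f" if "integrable \<tau> f" for f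
  proof (cases "prob_density \<tau> f \<and> integrable \<tau> (\<lambda>x. (f x - dens T x)\<^sup>2)")
    case True
    have "0 \<le> (\<integral>x. (f x - v x)\<^sup>2 \<partial>\<tau>)" by simp
    then have "J v \<le> J f" using ineq[of f] True by linarith
    then show ?thesis using True v v2 t that by (simp add: model)
  next
    case False
    then have "apgm_model \<tau> obj eta2 t g h f = \<infinity>" by (simp only: model[OF that] if_False)
    then show ?thesis by simp
  qed
  have ext: "apgm_model \<tau> obj eta2 t g h u = apgm_model \<tau> obj eta2 t g h v"
    if u: "integrable \<tau> u" "AE x in \<tau>. u x = v x"
  proof -
    have [measurable]: "u \<in> borel_measurable \<tau>" "v \<in> borel_measurable \<tau>" using u v by auto
    have *: "AE x in \<tau>. (u x - dens T x)\<^sup>2 = (v x - dens T x)\<^sup>2" "AE x in \<tau>. \<phi> x * u x = \<phi> x * v x"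
      using u(2) by (eventually_elim; simp)+
    have pu: "prob_density \<tau> u" by (rule prob_density_cong[OF v(2) _ u(2)]) measurable
    have i: "integrable \<tau> (\<lambda>x. (u x - dens T x)\<^sup>2)"
      by (rule integrable_cong_AE_imp[OF v2]) (use *(1) in auto)
    have "(\<integral>x. (u x - dens T x)\<^sup>2 \<partial>\<tau>) = (\<integral>x. (v x - dens T x)\<^sup>2 \<partial>\<tau>)"
      by (rule integral_cong_AE[OF _ _ *(1)]) measurable
    moreover have "(\<integral>x. \<phi> x * u x \<partial>\<tau>) = (\<integral>x. \<phi> x * v x \<partial>\<tau>)"
      by (rule integral_cong_AE[OF _ _ *(2)]) measurable
    ultimately have "J u = J v" by (simp add: J_def)
    then show ?thesis using pu i u v v2 by (simp add: model)
  qed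
  show ?thesis
  proof
    assume "is_arg_min (apgm_model \<tau> obj eta2 t g h) (\<lambda>u. u \<in> L1 \<tau>) u"
    then have u: "integrable \<tau> u" "\<not> apgm_model \<tau> obj eta2 t g h v < apgm_model \<tau> obj eta2 t g h u"
      using v(1) by (auto simp: is_arg_min_def)
    then have le: "apgm_model \<tau> obj eta2 t g h u \<le> ereal (D + t * J v)"
      using v v2 by (simp add: model)
    then have pu: "prob_density \<tau> u" "integrable \<tau> (\<lambda>x. (u x - dens T x)\<^sup>2)" and "J u \<le> J v"
      using t by (auto simp: model[OF u(1)] split: if_splits)
    \<comment> \<open>The quadratic surplus in \<open>ineq\<close> leaves no room for a second
      minimizer.\<close>
    then have "(\<integral>x. (u x - v x)\<^sup>2 \<partial>\<tau>) \<le> 0" using ineq[OF pu] by linarith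
    then have "(\<integral>x. (u x - v x)\<^sup>2 \<partial>\<tau>) = 0" by (intro antisym) auto
    moreover have "integrable \<tau> (\<lambda>x. (u x - v x)\<^sup>2)" unfolding v_def
      by (rule integrable_sq_diff_dens[OF u(1) pu(2) T Ta])
    ultimately have "AE x in \<tau>. (u x - v x)\<^sup>2 = 0" by (subst (asm) integral_nonneg_eq_0_iff_AE) auto
    then show "integrable \<tau> u \<and> (AE x in \<tau>. u x = dens (T + a) x)" using u(1) by (simp add: v_def)
  next
    assume "integrable \<tau> u \<and> (AE x in \<tau>. u x = dens (T + a) x)"
    then show "is_arg_min (apgm_model \<tau> obj eta2 t g h) (\<lambda>u. u \<in> L1 \<tau>) u"
      using ext min by (auto simp: is_arg_min_def v_def not_less)
  qed
qed

text \<open>The run reduced to two reals: the slope of \<open>h k\<close> and the moment of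
  \<open>f k\<close>. The start (0, moment 0) encodes the constant density 1, which is the profile
  of slope 0. The gradient is evaluated at the extrapolated moment, the new average at the updated
  slope, mirroring g and f in the method.\<close>

primrec dual_state :: "real \<Rightarrow> nat \<Rightarrow> real \<times> real" where
  "dual_state s 0 = (0, moment 0)"
| "dual_state s (Suc k) =
    (let (T, m) = dual_state s k; \<gamma> = apgm_gamma k;
         T' = T + R' ((1 - \<gamma>) * m + \<gamma> * moment T) / (\<gamma> / s)
     in (T', (1 - \<gamma>) * m + \<gamma> * moment T'))"

abbreviation "slope s k \<equiv> fst (dual_state s k)"
abbreviation "avg s k \<equiv> snd (dual_state s k)"
definition "lookahead s k = (1 - apgm_gamma k) * avg s k + apgm_gamma k * moment (slope s k)"

lemma slope_0: "slope s 0 = 0" and avg_0: "avg s 0 = moment 0"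
  and slope_Suc: "slope s (Suc k) = slope s k + R' (lookahead s k) / (apgm_gamma k / s)"
  and avg_Suc: "avg s (Suc k) = (1 - apgm_gamma k) * avg s k + apgm_gamma k * moment (slope s (Suc k))"
  by (simp_all add: lookahead_def Let_def split: prod.splits)

declare dual_state.simps(2) [simp del]

lemma slope_avg_nonneg: "0 < s \<Longrightarrow> 0 \<le> slope s k \<and> 0 \<le> avg s k \<and> 0 \<le> lookahead s k"
proof (induction k)
  case 0
  then show ?case using moment_nonneg[of 0] by (simp add: slope_0 avg_0 lookahead_def)
next
  case (Suc k)
  note \<gamma> = apgm_gamma_bounds[of k] apgm_gamma_bounds[of "Suc k"]
  have 1: "0 \<le> slope s (Suc k)"
    unfolding slope_Suc using Suc R'_nonneg \<gamma> by (intro add_nonneg_nonneg divide_nonneg_nonneg) auto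
  moreover have 2: "0 \<le> avg s (Suc k)"
    unfolding avg_Suc using Suc moment_nonneg[OF 1] \<gamma> by auto
  moreover have "0 \<le> lookahead s (Suc k)"
    unfolding lookahead_def using 2 moment_nonneg[OF 1] \<gamma> by (intro add_nonneg_nonneg mult_nonneg_nonneg) auto
  ultimately show ?case by blast
qed

lemma integral_\<phi>_convex_cong:
  assumes "AE x in \<tau>. g x = (1 - t) * f x + t * h x" "AE x in \<tau>. h x = dens T x" "0 \<le> T" "0 \<le> t" "t \<le> 1"
    and g: "integrable \<tau> g" and f: "prob_density \<tau> f"
  shows "prob_density \<tau> g \<and> (\<integral>x. \<phi> x * g x \<partial>\<tau>) = (1 - t) * (\<integral>x. \<phi> x * f x \<partial>\<tau>) + t * moment T"
proof
  have fi: "integrable \<tau> f" using f by (simp add: prob_density_def)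
  have [measurable]: "f \<in> borel_measurable \<tau>" "g \<in> borel_measurable \<tau>" using fi g by auto
  have *: "AE x in \<tau>. g x = (1 - t) * f x + t * dens T x" using assms(1,2) by eventually_elim simp
  show "prob_density \<tau> g"
    by (rule prob_density_cong[OF prob_density_convex[OF f prob_density_dens] _ *]) (use assms in auto)
  have "(\<integral>x. \<phi> x * g x \<partial>\<tau>) = (\<integral>x. (1 - t) * (\<phi> x * f x) + t * (\<phi> x * dens T x) \<partial>\<tau>)"
  proof (rule integral_cong_AE)
    show "AE x in \<tau>. \<phi> x * g x = (1 - t) * (\<phi> x * f x) + t * (\<phi> x * dens T x)"
      using *
    proof eventually_elim
      case (elim x)
      show ?case unfolding elim by (simp add: algebra_simps)
    qed
  qed measurable
  also have "\<dots> = (1 - t) * (\<integral>x. \<phi> x * f x \<partial>\<tau>) + t * moment T"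
    using fi assms(3) by (simp add: moment_def integrable_bounded_mult_\<phi>)
  finally show "(\<integral>x. \<phi> x * g x \<partial>\<tau>) = (1 - t) * (\<integral>x. \<phi> x * f x \<partial>\<tau>) + t * moment T" .
qed

text \<open>By uniqueness of the proximal step, every run has the same scalar trace, whatever
  representatives are chosen. Bounds on the recursion thereby become bounds on all runs.\<close>

lemma apgm_iterates:
  assumes s: "0 < s" and A: "apgm \<tau> obj eta2 s (\<lambda>_. 1) f g h"
  shows "prob_density \<tau> (f k) \<and> (\<integral>x. \<phi> x * f k x \<partial>\<tau>) = avg s k \<and> (AE x in \<tau>. h k x = dens (slope s k) x)"
proof (induction k)
  case 0
  have i: "integrable \<tau> (f 0)" and f0: "AE x in \<tau>. f 0 x = 1" and h0: "AE x in \<tau>. h 0 x = 1"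
    using A by (auto simp: apgm_def)
  have fd: "AE x in \<tau>. f 0 x = dens 0 x" and hd: "AE x in \<tau>. h 0 x = dens 0 x"
    using f0 h0 AE_space by (eventually_elim; simp add: dens_0)+
  have "AE x in \<tau>. f 0 x = (1 - 0) * f 0 x + 0 * dens 0 x" by simp
  moreover have "prob_density \<tau> (f 0)"
    by (rule prob_density_cong[OF prob_density_dens[of 0] _ fd]) (use i in auto)
  moreover have "(\<integral>x. \<phi> x * f 0 x \<partial>\<tau>) = moment 0"
    unfolding moment_def by (rule integral_cong_AE) (use i fd in auto)
  ultimately show ?case using hd by (simp add: slope_0 avg_0)
next
  case (Suc k)
  let ?\<gamma> = "apgm_gamma k"
  note \<gamma> = apgm_gamma_bounds[of k]
  have i: "integrable \<tau> (f (Suc k))" "integrable \<tau> (g k)" "integrable \<tau> (h k)"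
    and g: "AE x in \<tau>. g k x = (1 - ?\<gamma>) * f k x + ?\<gamma> * h k x"
    and am: "is_arg_min (apgm_model \<tau> obj eta2 (?\<gamma> / s) (g k) (h k)) (\<lambda>u. u \<in> L1 \<tau>) (h (Suc k))"
    and f: "AE x in \<tau>. f (Suc k) x = (1 - ?\<gamma>) * f k x + ?\<gamma> * h (Suc k) x"
    using A by (auto simp: apgm_def)
  have T: "0 \<le> slope s k" "0 \<le> slope s (Suc k)" using slope_avg_nonneg[OF s] by auto
  have gp: "prob_density \<tau> (g k)" "(\<integral>x. \<phi> x * g k x \<partial>\<tau>) = lookahead s k"
    using integral_\<phi>_convex_cong[OF g _ T(1) _ _ i(2)] Suc \<gamma> by (auto simp: lookahead_def)
  have h: "AE x in \<tau>. h (Suc k) x = dens (slope s (Suc k)) x"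
    using am is_arg_min_apgm_model[OF gp(1) i(3) _ _ T(1), of "?\<gamma> / s"] Suc \<gamma> s
    by (auto simp: gp(2) slope_Suc)
  then show ?case
    using integral_\<phi>_convex_cong[OF f h T(2) _ _ i(1)] Suc \<gamma> by (auto simp: avg_Suc)
qed

text \<open>Ensures that the lower bound, which is quantified over all runs, is not vacuous.\<close>

lemma apgm_exists:
  assumes s: "0 < s"
  shows "\<exists>f g h. apgm \<tau> obj eta2 s (\<lambda>_. 1) f g h"
proof -
  let ?\<gamma> = apgm_gamma
  define h where "h k = dens (slope s k)" for k
  define f where "f = rec_nat (dens 0) (\<lambda>k u x. (1 - ?\<gamma> k) * u x + ?\<gamma> k * h (Suc k) x)"
  define g where "g k x = (1 - ?\<gamma> k) * f k x + ?\<gamma> k * h k x" for k x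
  have T: "0 \<le> slope s k" for k using slope_avg_nonneg[OF s] by auto
  have f_Suc: "f (Suc k) = (\<lambda>x. (1 - ?\<gamma> k) * f k x + ?\<gamma> k * h (Suc k) x)" and f_0: "f 0 = dens 0" for k
    by (simp_all add: f_def)
  have hi: "integrable \<tau> (h k)" for k by (simp add: h_def T)
  have fi: "integrable \<tau> (f k)" for k by (induction k) (simp_all add: f_0 f_Suc hi)
  have gi: "integrable \<tau> (g k)" for k unfolding g_def using fi hi by simp
  have fp: "prob_density \<tau> (f k) \<and> (\<integral>x. \<phi> x * f k x \<partial>\<tau>) = avg s k" for k
  proof (induction k)
    case 0
    show ?case by (simp add: f_0 avg_0 moment_def prob_density_dens)
  next
    case (Suc k)
    have "AE x in \<tau>. f (Suc k) x = (1 - ?\<gamma> k) * f k x + ?\<gamma> k * h (Suc k) x" by (simp add: f_Suc)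
    from integral_\<phi>_convex_cong[OF this _ T _ _ fi, of "Suc k"] Suc apgm_gamma_bounds[of k]
    show ?case by (simp add: h_def avg_Suc)
  qed
  have "is_arg_min (apgm_model \<tau> obj eta2 (?\<gamma> k / s) (g k) (h k)) (\<lambda>u. u \<in> L1 \<tau>) (h (Suc k))" for k
  proof -
    have "AE x in \<tau>. g k x = (1 - ?\<gamma> k) * f k x + ?\<gamma> k * h k x" by (simp add: g_def)
    from integral_\<phi>_convex_cong[OF this _ T _ _ gi, of k] fp[of k] apgm_gamma_bounds[of k]
    have gp: "prob_density \<tau> (g k)" "(\<integral>x. \<phi> x * g k x \<partial>\<tau>) = lookahead s k"
      by (auto simp: h_def lookahead_def)
    show ?thesis
      using is_arg_min_apgm_model[OF gp(1) hi[of k] _ _ T[of k], of "?\<gamma> k / s"] hi[of "Suc k"] s apgm_gamma_bounds[of k]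
      by (simp add: gp(2) h_def slope_Suc)
  qed
  moreover have "H_fun \<tau> obj (f 0) < \<infinity>" using fp[of 0] fi[of 0] by (simp add: H_fun_obj)
  moreover have "AE x in \<tau>. f 0 x = 1" "AE x in \<tau>. h 0 x = 1"
    using AE_space by (eventually_elim; simp add: f_0 h_def slope_0 dens_0)+
  ultimately have "apgm \<tau> obj eta2 s (\<lambda>_. 1) f g h"
    unfolding apgm_def using fi gi hi by (auto simp: g_def f_Suc)
  then show ?thesis by blast
qed

section \<open>The infimum and a minimizing measure\<close>

lemma moment_tendsto_0: "(\<lambda>n. moment (real (Suc n))) \<longlonglongrightarrow> 0"
proof (rule tendsto_sandwich)
  show "\<forall>\<^sub>F n in sequentially. 0 \<le> moment (real (Suc n))" by (simp add: moment_nonneg)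
  show "\<forall>\<^sub>F n in sequentially. moment (real (Suc n)) \<le> 2 * c\<^sub>1 powr - \<kappa> * real (Suc n) powr - \<kappa>"
    by (intro always_eventually allI moment_le) simp
  have "(\<lambda>n. real (Suc n) powr - \<kappa>) \<longlonglongrightarrow> 0"
    using \<kappa>(1) by (intro tendsto_neg_powr filterlim_compose[OF filterlim_real_sequentially filterlim_Suc]) simp
  from tendsto_mult_right_zero[OF this] show "(\<lambda>n. 2 * c\<^sub>1 powr - \<kappa> * real (Suc n) powr - \<kappa>) \<longlonglongrightarrow> 0" .
qed simp

text \<open>Moments of densities are nonnegative and R increases from R 0 = 0, so F \<ge> 0. The
  densities \<open>dens T\<close> concentrate as T grows, their moments tend to 0, and continuity of
  R closes the gap.\<close>

lemma inf_F_obj: "inf_F \<tau> obj = 0"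
proof (rule antisym)
  show "0 \<le> inf_F \<tau> obj"
    unfolding inf_F_def
  proof (rule INF_greatest)
    fix f assume f: "f \<in> L1 \<tau>"
    show "0 \<le> F_fun \<tau> obj f"
    proof (cases "prob_density \<tau> f")
      case True
      then show ?thesis using R_mono[of 0] integral_\<phi>_nonneg[OF True] by (simp add: F_fun_obj R_0)
    next
      case False
      then show ?thesis using f by (simp add: F_bar_def H_fun_obj)
    qed
  qed
  have "isCont R 0" by (rule DERIV_isCont[OF R_deriv])
  then have "(\<lambda>n. R (moment (real (Suc n)))) \<longlonglongrightarrow> 0"
    using isCont_tendsto_compose[OF _ moment_tendsto_0, of R] by (simp add: R_0)
  then have "(\<lambda>n. ereal (R (moment (real (Suc n))))) \<longlonglongrightarrow> 0"
    unfolding zero_ereal_def by (rule tendsto_ereal)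
  then show "inf_F \<tau> obj \<le> 0"
  proof (rule LIMSEQ_le_const, intro exI allI impI)
    fix n :: nat
    have "inf_F \<tau> obj \<le> F_fun \<tau> obj (dens (real (Suc n)))" unfolding inf_F_def by (rule INF_lower) simp
    also have "\<dots> = ereal (R (moment (real (Suc n))))"
      by (simp add: F_fun_obj prob_density_dens moment_def)
    finally show "inf_F \<tau> obj \<le> ereal (R (moment (real (Suc n))))" .
  qed
qed

text \<open>The minimizer is the Dirac mass at a zero of \<phi>, whose moment is exactly 0. Its
  differential R' 0 * \<phi> vanishes identically when R' 0 = 0, which is what the starred settings
  demand.\<close>

lemma ex_minimizer:
  assumes p: "p \<in> space \<tau>" "\<phi> p = 0"
  shows "\<exists>\<mu>. signed_measure \<tau> \<mu> \<and> F_bar \<tau> obj \<mu> = inf_F \<tau> obj \<and> (\<forall>\<theta>. dG_bar \<tau> obj \<mu> \<theta> = R' 0 * \<phi> \<theta>)"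
proof -
  interpret N: prob_space "return \<tau> p" by (rule prob_space_return[OF p(1)])
  define \<mu> where "\<mu> = measure (return \<tau> p)"
  have "signed_measure \<tau> \<mu>"
    unfolding signed_measure_def \<mu>_def using N.finite_measure_UNION by simp
  moreover have si: "signed_integral \<tau> \<mu> (feature obj) = 0"
  proof -
    have "signed_integral \<tau> \<mu> (feature obj) = (\<integral>x. feature obj x \<partial>return \<tau> p)"
      by (rule signed_integral_of_measure) (auto simp: \<mu>_def N.finite_measure_axioms)
    also have "\<dots> = feature obj p" using p by (intro integral_return) (auto simp: ray_objective_def)
    finally show ?thesis by (simp add: ray_objective_def p)
  qed
  moreover have "F_bar \<tau> obj \<mu> = 0"
    unfolding F_bar_def G_bar_def si H_bar_ray using N.prob_space by (simp add: ray_objective_def R_0 \<mu>_def)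
  moreover have "dG_bar \<tau> obj \<mu> \<theta> = R' 0 * \<phi> \<theta>" for \<theta>
    using grad_eqI[OF GDERIV_ray[OF R_deriv, of 0]] unfolding dG_bar_def si by (simp add: ray_objective_def)
  ultimately show ?thesis by (auto simp: inf_F_obj)
qed

end


section \<open>Growth of the slopes\<close>

definition apgm_t :: "nat \<Rightarrow> real" where "apgm_t k = 1 / apgm_gamma k"

lemma apgm_t_0 [simp]: "apgm_t 0 = 1" by (simp add: apgm_t_def)

lemma apgm_t_ge_1: "1 \<le> apgm_t k" using apgm_gamma_bounds[of k] by (simp add: apgm_t_def)

lemma apgm_gamma_t: "apgm_gamma k = 1 / apgm_t k" by (simp add: apgm_t_def)

text \<open>This is the recursion for the gamma parameters after taking reciprocals. It makes each
  weight the increment of the squares, so the squares act as elapsed time.\<close>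

lemma apgm_t_Suc_sq: "(apgm_t (Suc k))\<^sup>2 = (apgm_t k)\<^sup>2 + apgm_t (Suc k)"
proof -
  have *: "1 / x\<^sup>2 = 1 / y\<^sup>2 + 1 / x" if "x\<^sup>2 = (1 - x) * y\<^sup>2" "0 < x" "0 < y" for x y :: real
  proof -
    have "1 / x\<^sup>2 - 1 / x = (1 - x) / x\<^sup>2" using that by (simp add: field_simps power2_eq_square)
    also have "\<dots> = 1 / y\<^sup>2" using that by (simp add: field_simps)
    finally show ?thesis by simp
  qed
  show ?thesis
    using *[OF apgm_gamma_Suc_sq apgm_gamma_bounds(1) apgm_gamma_bounds(1), of k]
    by (simp only: apgm_t_def power_divide power_one)
qed

lemma apgm_t_Suc_le: "apgm_t (Suc k) \<le> apgm_t k + 1"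
proof (rule ccontr)
  assume "\<not> apgm_t (Suc k) \<le> apgm_t k + 1"
  then have *: "apgm_t k + 1 < apgm_t (Suc k)" by simp
  then have "(apgm_t k + 1) * apgm_t k < apgm_t (Suc k) * (apgm_t (Suc k) - 1)"
    using apgm_t_ge_1[of k] by (intro mult_strict_mono) auto
  then show False using apgm_t_Suc_sq[of k] apgm_t_ge_1[of k] by (simp add: power2_eq_square algebra_simps)
qed

lemma apgm_t_le: "apgm_t k \<le> real k + 1"
proof (induction k)
  case (Suc k)
  then show ?case using apgm_t_Suc_le[of k] by simp
qed simp

lemma sum_apgm_t: "(\<Sum>i\<le>k. apgm_t i) = (apgm_t k)\<^sup>2"
  by (induction k) (simp_all add: apgm_t_Suc_sq)

text \<open>Mean value theorem for z powr (1 - p), whose derivative decreases and is therefore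
  smallest at the right end x.\<close>

lemma powr_diff_ge:
  fixes x y p :: real
  assumes "0 < y" "y \<le> x" "0 < p" "p < 1"
  shows "(1 - p) * (x - y) * x powr - p \<le> x powr (1 - p) - y powr (1 - p)"
proof (cases "x = y")
  case False
  then have "y < x" using assms by simp
  then obtain z where z: "y < z" "z < x" "x powr (1 - p) - y powr (1 - p) = (x - y) * ((1 - p) * z powr (1 - p - 1))"
    using MVT2[of y x "\<lambda>z. z powr (1 - p)" "\<lambda>z. (1 - p) * z powr (1 - p - 1)"] assms
    by (force intro!: derivative_eq_intros)
  have "(1 - p) * (x - y) * x powr - p \<le> (1 - p) * (x - y) * z powr - p"
    using z assms by (intro mult_left_mono powr_mono2') auto
  then show ?thesis using z(3) by (simp add: mult_ac)
qed simp

text \<open>A Riemann sum for the integral of x powr - p in the variable x = t^2: the increments of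
  x are the weights, and right endpoints underestimate a decreasing integrand. At k = 0 it reads 1
  \<le> 1 / (1 - p).\<close>

lemma sum_apgm_t_powr:
  assumes "0 < p" "p < 1"
  shows "(\<Sum>i\<le>k. apgm_t i * ((apgm_t i)\<^sup>2) powr - p) \<le> ((apgm_t k)\<^sup>2) powr (1 - p) / (1 - p)"
proof (induction k)
  case (Suc k)
  let ?x = "(apgm_t (Suc k))\<^sup>2" and ?y = "(apgm_t k)\<^sup>2"
  have "0 < ?y" using apgm_t_ge_1[of k] by simp
  moreover have "?y \<le> ?x" using apgm_t_Suc_sq[of k] apgm_t_ge_1[of "Suc k"] by simp
  ultimately have "(1 - p) * (?x - ?y) * ?x powr - p \<le> ?x powr (1 - p) - ?y powr (1 - p)"
    using assms by (rule powr_diff_ge)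
  then have "(apgm_t (Suc k) * ?x powr - p) * (1 - p) \<le> ?x powr (1 - p) - ?y powr (1 - p)"
    using apgm_t_Suc_sq[of k] by (simp add: mult_ac)
  then have "apgm_t (Suc k) * ?x powr - p \<le> (?x powr (1 - p) - ?y powr (1 - p)) / (1 - p)"
    using assms by (subst pos_le_divide_eq) auto
  with Suc show ?case by (simp add: diff_divide_distrib)
qed (use assms in simp)

text \<open>The dynamics for a quadratic loss, in the time scale \<open>t\<^sub>k\<^sup>2 = \<Sum>i\<le>k. t\<^sub>i\<close>: \<open>\<alpha>\<close> is a running
  average of the decreasing sequence \<open>m\<close>, so \<open>T\<close> is concave; hence \<open>m \<lesssim> T powr - p\<close> can be averaged
  and gives the differential inequality \<open>T' \<lesssim> T powr - p\<close>.\<close>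
lemma averaged_growth:
  fixes T a \<alpha> m :: "nat \<Rightarrow> real"
  assumes T: "T 0 = 0" "\<And>k. T (Suc k) = T k + s * apgm_t k * \<alpha> k"
    and a: "\<And>k. a (Suc k) = (1 - apgm_gamma k) * a k + apgm_gamma k * m (Suc k)"
    and \<alpha>: "\<And>k. \<alpha> k = (1 - apgm_gamma k) * a k + apgm_gamma k * m k"
    and m: "\<And>k. 0 \<le> m k" "\<And>k. m (Suc k) \<le> m k" "0 < m 0"
    and m_le: "\<And>k. 0 < T k \<Longrightarrow> m k \<le> C * T k powr - p"
    and s: "0 < s" and p: "0 < p" "p < 1" and C: "0 < C"
  shows "\<exists>D>0. \<forall>k. T (Suc k) powr (1 + p) \<le> D * (apgm_t k)\<^sup>2"
proof -
  let ?t = apgm_t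
  define \<tau> where "\<tau> k = (?t k)\<^sup>2" for k
  \<comment> \<open>The shift by one pairs the time \<tau> k with the slope after step k. It also
    avoids T 0 = 0, where \<open>powr - p\<close> takes the default value 0.\<close>
  define U where "U k = T (Suc k)" for k
  note t1 = apgm_t_ge_1
  have \<tau>1: "1 \<le> \<tau> k" for k using t1[of k] by (simp add: \<tau>_def)
  have \<tau>0: "0 < \<tau> k" for k using \<tau>1[of k] by linarith
  have \<tau>Suc: "\<tau> (Suc k) = \<tau> k + ?t (Suc k)" for k by (simp add: \<tau>_def apgm_t_Suc_sq)
  have \<gamma>\<tau>: "(1 - apgm_gamma (Suc k)) * \<tau> (Suc k) = \<tau> k" "apgm_gamma k * \<tau> k = ?t k" for k
    using t1[of k] t1[of "Suc k"] \<tau>Suc[of k]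
    by (auto simp: apgm_gamma_t \<tau>_def field_simps power2_eq_square)
  \<comment> \<open>Multiplication by the elapsed time turns the convex-combination recursion into a
    telescoping sum, because (1 - \<gamma>) \<tau> at index k + 1 equals \<tau> at index k.\<close>
  have a_sum: "a (Suc k) * \<tau> k = (\<Sum>i<Suc k. ?t i * m (Suc i))" for k
  proof (induction k)
    case 0
    show ?case using a[of 0] by (simp add: \<tau>_def)
  next
    case (Suc k)
    have "a (Suc (Suc k)) * \<tau> (Suc k) =
      a (Suc k) * ((1 - apgm_gamma (Suc k)) * \<tau> (Suc k)) + (apgm_gamma (Suc k) * \<tau> (Suc k)) * m (Suc (Suc k))"
      by (simp add: a[of "Suc k"] algebra_simps)
    then show ?case unfolding \<gamma>\<tau> Suc by simp
  qed
  \<comment> \<open>The same weights as in \<open>a_sum\<close>, but the last one multiplies m k: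
    the extrapolated point uses the profile known before the step.\<close>
  have \<alpha>_sum: "\<alpha> k * \<tau> k = (\<Sum>i<k. ?t i * m (Suc i)) + ?t k * m k" for k
  proof (cases k)
    case 0
    then show ?thesis using \<alpha>[of 0] by (simp add: \<tau>_def)
  next
    case (Suc j)
    have "\<alpha> (Suc j) * \<tau> (Suc j) =
      a (Suc j) * ((1 - apgm_gamma (Suc j)) * \<tau> (Suc j)) + (apgm_gamma (Suc j) * \<tau> (Suc j)) * m (Suc j)"
      by (simp add: \<alpha>[of "Suc j"] algebra_simps)
    then show ?thesis unfolding \<gamma>\<tau> a_sum Suc by simp
  qed
  have m_anti: "m k \<le> m i" if "i \<le> k" for i k using that by (rule lift_Suc_antimono_le[of m, OF m(2)])
  have m_le_\<alpha>: "m k \<le> \<alpha> k" for k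
  proof -
    have "m k * \<tau> k = (\<Sum>i<k. ?t i * m k) + ?t k * m k"
    proof -
      have "\<tau> k = (\<Sum>i<k. ?t i) + ?t k" using sum_apgm_t[of k] by (simp add: \<tau>_def flip: lessThan_Suc_atMost)
      then show ?thesis by (simp add: distrib_left sum_distrib_left mult.commute)
    qed
    also have "\<dots> \<le> \<alpha> k * \<tau> k" unfolding \<alpha>_sum
      using t1 by (intro add_mono sum_mono mult_left_mono m_anti) (auto intro: order.trans[OF zero_le_one])
    finally show ?thesis using \<tau>0[of k] by simp
  qed
  have \<alpha>0: "0 \<le> \<alpha> k" for k using m_le_\<alpha>[of k] m(1)[of k] by linarith
  \<comment> \<open>Passing to k + 1 lowers the last term to m (k + 1) and appends a further copy of
    it, which is at most the current average.\<close>
  have \<alpha>_Suc: "\<alpha> (Suc k) \<le> \<alpha> k" for k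
  proof -
    have "\<alpha> (Suc k) * \<tau> (Suc k) = (\<Sum>i<k. ?t i * m (Suc i)) + ?t k * m (Suc k) + ?t (Suc k) * m (Suc k)"
      by (simp add: \<alpha>_sum)
    also have "\<dots> \<le> \<alpha> k * \<tau> k + ?t (Suc k) * \<alpha> k"
      unfolding \<alpha>_sum using m(2)[of k] m_le_\<alpha>[of k] t1[of k] t1[of "Suc k"]
      by (intro add_mono order_refl mult_left_mono) auto
    also have "\<dots> = \<alpha> k * \<tau> (Suc k)" by (simp add: \<tau>Suc algebra_simps)
    finally show ?thesis using \<tau>0[of "Suc k"] by simp
  qed
  have U_Suc: "U (Suc k) = U k + s * ?t (Suc k) * \<alpha> (Suc k)" for k by (simp add: U_def T(2))
  have U_0: "U 0 = s * m 0" using \<alpha>[of 0] T by (simp add: U_def)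
  have U_pos: "0 < U k" for k
  proof (induction k)
    case (Suc k)
    have "0 \<le> s * ?t (Suc k) * \<alpha> (Suc k)" using s t1[of "Suc k"] \<alpha>0[of "Suc k"] by simp
    with Suc show ?case by (simp add: U_Suc)
  qed (use s m U_0 in simp)
  have U_ge: "s * \<alpha> k * \<tau> k \<le> U k" for k
  proof (induction k)
    case 0
    show ?case using \<alpha>[of 0] by (simp add: U_0 \<tau>_def)
  next
    case (Suc k)
    have "s * \<alpha> (Suc k) * \<tau> k \<le> s * \<alpha> k * \<tau> k"
      using \<alpha>_Suc[of k] s \<tau>0[of k] by (intro mult_right_mono mult_left_mono) auto
    with Suc show ?case by (simp add: U_Suc \<tau>Suc algebra_simps)
  qed
  \<comment> \<open>Discrete concavity: U is s times the time integral of the decreasing \<alpha>,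
    so the mean growth rate U / \<tau> decreases.\<close>
  have ratio_Suc: "U (Suc k) / \<tau> (Suc k) \<le> U k / \<tau> k" for k
  proof -
    have "s * \<alpha> (Suc k) * \<tau> k \<le> s * \<alpha> k * \<tau> k"
      using \<alpha>_Suc[of k] s \<tau>0[of k] by (intro mult_right_mono mult_left_mono) auto
    then have "s * \<alpha> (Suc k) * \<tau> k \<le> U k" using U_ge[of k] by linarith
    then have "?t (Suc k) * (s * \<alpha> (Suc k) * \<tau> k) \<le> ?t (Suc k) * U k"
      using t1[of "Suc k"] by (intro mult_left_mono) auto
    then show ?thesis using \<tau>0[of k] \<tau>0[of "Suc k"] by (simp add: field_simps U_Suc \<tau>Suc)
  qed
  have ratio: "U k / \<tau> k \<le> U i / \<tau> i" if "i \<le> k" for i k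
    using that by (rule lift_Suc_antimono_le[of "\<lambda>k. U k / \<tau> k", OF ratio_Suc])
  \<comment> \<open>Concavity puts U above its chord from the origin, U i \<ge> (U k / \<tau> k) *
    \<tau> i for i \<le> k, which reduces the sum to pure powers of \<tau>.\<close>
  have sum_U: "(\<Sum>i\<le>k. ?t i * U i powr - p) \<le> U k powr - p * \<tau> k / (1 - p)" for k
  proof -
    define c where "c = U k / \<tau> k"
    have c: "c > 0" using U_pos \<tau>0 by (simp add: c_def)
    have "?t i * U i powr - p \<le> ?t i * (c powr - p * \<tau> i powr - p)" if "i \<le> k" for i
    proof (rule mult_left_mono)
      have "c * \<tau> i \<le> U i" using ratio[OF that] \<tau>0[of i] by (simp add: c_def field_simps)
      then have "U i powr - p \<le> (c * \<tau> i) powr - p"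
        using c \<tau>0[of i] p by (intro powr_mono2') auto
      then show "U i powr - p \<le> c powr - p * \<tau> i powr - p" using c \<tau>0[of i] by (simp add: powr_mult)
    qed (use t1[of i] in simp)
    then have "(\<Sum>i\<le>k. ?t i * U i powr - p) \<le> (\<Sum>i\<le>k. ?t i * (c powr - p * \<tau> i powr - p))"
      by (intro sum_mono) auto
    also have "\<dots> = c powr - p * (\<Sum>i\<le>k. ?t i * \<tau> i powr - p)" by (simp add: sum_distrib_left mult_ac)
    also have "\<dots> \<le> c powr - p * (\<tau> k powr (1 - p) / (1 - p))"
      using sum_apgm_t_powr[OF p, of k] by (intro mult_left_mono) (auto simp: \<tau>_def)
    also have "\<tau> k powr (1 - p) = \<tau> k powr - p * \<tau> k"
      using \<tau>0[of k] powr_add[of "\<tau> k" "- p" 1] by simp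
    also have "c powr - p * (\<tau> k powr - p * \<tau> k / (1 - p)) = (c * \<tau> k) powr - p * \<tau> k / (1 - p)"
      using c \<tau>0[of k] by (simp add: powr_mult)
    also have "c * \<tau> k = U k" using \<tau>0[of k] by (simp add: c_def)
    finally show ?thesis .
  qed
  \<comment> \<open>The second entry settles k = 0. In the first, 3 accounts for the extra last term
    of \<alpha>, using t (j + 1) \<le> 2 * t j, and 4 powr p for passing from U j to U (j + 1),
    since \<tau> grows at most fourfold in one step.\<close>
  define B where "B = max (3 * C / (1 - p) * 4 powr p) (m 0 * U 0 powr p)"
  have B: "B > 0" using p C by (simp add: B_def less_max_iff_disj)
  have \<alpha>_le: "\<alpha> k \<le> B * U k powr - p" for k
  proof (cases k)
    case 0
    have "\<alpha> 0 = m 0 * U 0 powr p * U 0 powr - p" using \<alpha>[of 0] U_pos[of 0] by (simp add: powr_minus)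
    also have "\<dots> \<le> B * U 0 powr - p" by (intro mult_right_mono) (auto simp: B_def)
    finally show ?thesis using 0 by simp
  next
    case (Suc j)
    have tt: "?t (Suc j) \<le> 2 * ?t j" using apgm_t_Suc_le[of j] t1[of j] by linarith
    have "?t j * m (Suc j) \<le> (\<Sum>i<Suc j. ?t i * m (Suc i))"
      using t1 m(1) by (auto intro!: sum_nonneg mult_nonneg_nonneg intro: order.trans[OF zero_le_one])
    moreover have "?t (Suc j) * m (Suc j) \<le> 2 * (?t j * m (Suc j))"
      using mult_right_mono[OF tt m(1)[of "Suc j"]] by (simp add: mult_ac)
    ultimately have "\<alpha> (Suc j) * \<tau> (Suc j) \<le> 3 * (\<Sum>i<Suc j. ?t i * m (Suc i))"
      unfolding \<alpha>_sum by linarith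
    also have "(\<Sum>i<Suc j. ?t i * m (Suc i)) \<le> (\<Sum>i<Suc j. ?t i * (C * U i powr - p))"
      using t1 m_le U_pos by (intro sum_mono mult_left_mono) (auto simp: U_def intro: order.trans[OF zero_le_one])
    also have "(\<Sum>i<Suc j. ?t i * (C * U i powr - p)) = C * (\<Sum>i\<le>j. ?t i * U i powr - p)"
      by (simp add: lessThan_Suc_atMost sum_distrib_left mult_ac del: sum.lessThan_Suc sum.atMost_Suc)
    also have "\<dots> \<le> C * (U j powr - p * \<tau> j / (1 - p))"
      using C sum_U[of j] by (intro mult_left_mono) auto
    also have "\<dots> = C / (1 - p) * (U j powr - p) * \<tau> j" by simp
    also have "\<dots> \<le> C / (1 - p) * (4 powr p * U (Suc j) powr - p) * \<tau> (Suc j)"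
    proof (intro mult_mono)
      have "\<tau> (Suc j) \<le> 4 * \<tau> j"
        using power_mono[OF tt, of 2] t1[of "Suc j"] by (simp add: \<tau>_def power_mult_distrib)
      have "U (Suc j) * \<tau> j \<le> U j * \<tau> (Suc j)" using ratio_Suc[of j] \<tau>0[of j] \<tau>0[of "Suc j"] by (simp add: field_simps)
      also have "\<dots> \<le> U j * (4 * \<tau> j)" using \<open>\<tau> (Suc j) \<le> 4 * \<tau> j\<close> U_pos[of j] by (intro mult_left_mono) auto
      finally have "U (Suc j) / 4 \<le> U j" using \<tau>0[of j] by simp
      then have "U j powr - p \<le> (U (Suc j) / 4) powr - p" using U_pos[of "Suc j"] p by (intro powr_mono2') auto
      also have "\<dots> = 4 powr p * U (Suc j) powr - p"
        using U_pos[of "Suc j"] by (simp add: powr_divide powr_minus field_simps)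
      finally show "U j powr - p \<le> 4 powr p * U (Suc j) powr - p" .
      show "\<tau> j \<le> \<tau> (Suc j)" using \<tau>Suc[of j] t1[of "Suc j"] by simp
    qed (use C p \<tau>0[of j] in auto)
    finally have "\<alpha> (Suc j) * \<tau> (Suc j) \<le> (3 * C / (1 - p) * 4 powr p) * U (Suc j) powr - p * \<tau> (Suc j)"
      by (simp add: mult_ac)
    then have "\<alpha> (Suc j) \<le> (3 * C / (1 - p) * 4 powr p) * U (Suc j) powr - p"
      by (rule mult_right_le_imp_le[OF _ \<tau>0])
    also have "\<dots> \<le> B * U (Suc j) powr - p" by (intro mult_right_mono) (auto simp: B_def)
    finally show ?thesis using Suc by simp
  qed
  have U_sum: "U k = s * (\<Sum>i\<le>k. ?t i * \<alpha> i)" for k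
    by (induction k) (simp_all add: U_Suc U_0 \<alpha>[of 0] algebra_simps)
  \<comment> \<open>Summing \<alpha> \<lesssim> U powr - p with the weights and applying
    \<open>sum_U\<close> once more gives U \<lesssim> U powr - p * \<tau>, the integrated form of
    the differential inequality.\<close>
  have "U k powr (1 + p) \<le> s * B / (1 - p) * \<tau> k" for k
  proof -
    have "U k \<le> s * (\<Sum>i\<le>k. ?t i * (B * U i powr - p))"
      unfolding U_sum[of k] using s t1 \<alpha>_le
      by (intro mult_left_mono sum_mono) (auto intro: order.trans[OF zero_le_one])
    also have "\<dots> = s * B * (\<Sum>i\<le>k. ?t i * U i powr - p)" by (simp add: sum_distrib_left mult_ac)
    also have "\<dots> \<le> s * B * (U k powr - p * \<tau> k / (1 - p))"
      using s B sum_U[of k] by (intro mult_left_mono) auto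
    finally have "U k * U k powr p \<le> s * B * (U k powr - p * \<tau> k / (1 - p)) * U k powr p"
      by (intro mult_right_mono) auto
    also have "\<dots> = s * B / (1 - p) * \<tau> k * (U k powr - p * U k powr p)" by simp
    also have "U k powr - p * U k powr p = 1" using U_pos[of k] by (simp add: powr_minus)
    finally show ?thesis using U_pos[of k] by (simp add: powr_add)
  qed
  moreover have "s * B / (1 - p) > 0" using s B p by simp
  ultimately show ?thesis unfolding U_def \<tau>_def by blast
qed

section \<open>From slopes to the objective gap\<close>

context ray_problem
begin

lemma slope_Suc_t: "slope s (Suc k) = slope s k + s * apgm_t k * R' (lookahead s k)"
  by (simp add: slope_Suc apgm_t_def)

lemma slope_mono: "0 < s \<Longrightarrow> slope s k \<le> slope s (Suc k)"
  using slope_avg_nonneg[of s k] R'_nonneg[of "lookahead s k"] apgm_t_ge_1[of k] by (simp add: slope_Suc_t)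

text \<open>The average contains profiles of smaller slope, whose moments are larger.\<close>

lemma avg_ge_moment:
  assumes "0 < s"
  shows "moment (slope s k) \<le> avg s k"
proof (induction k)
  case (Suc k)
  note \<gamma> = apgm_gamma_bounds[of k]
  have "moment (slope s (Suc k)) \<le> moment (slope s k)"
    using slope_mono[OF assms] slope_avg_nonneg[OF assms] by (intro moment_antimono) auto
  then have "(1 - apgm_gamma k) * moment (slope s (Suc k)) \<le> (1 - apgm_gamma k) * avg s k"
    using Suc \<gamma> by (intro mult_left_mono) auto
  then show ?case by (simp add: avg_Suc algebra_simps)
qed (simp add: slope_0 avg_0)

lemma gap_avg:
  assumes "0 < s" "apgm \<tau> obj eta2 s (\<lambda>_. 1) f g h"
  shows "F_fun \<tau> obj (f k) - inf_F \<tau> obj = ereal (R (avg s k))"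
  using apgm_iterates[OF assms, of k] by (simp add: F_fun_obj inf_F_obj)

text \<open>Converts slow growth of the slope into slow decay of the moment, through
  \<open>moment_ge\<close>. As k powr e \<ge> 1 for k \<ge> 1, the 1 in 1 + T is absorbed into the
  constant 1 + B.\<close>

lemma avg_ge_of_slope_le:
  assumes s: "0 < s" and B: "0 < B" and e: "0 \<le> e" and le: "\<And>k. 1 \<le> k \<Longrightarrow> slope s k \<le> B * real k powr e"
  shows "\<exists>c>0. \<forall>k\<ge>1. c * real k powr - (\<kappa> * e) \<le> avg s k"
proof -
  obtain C where C: "C > 0" "\<And>T. 0 \<le> T \<Longrightarrow> C * (1 + T) powr - \<kappa> \<le> moment T" using moment_ge by auto
  have "C * (1 + B) powr - \<kappa> * real k powr - (\<kappa> * e) \<le> avg s k" if k: "1 \<le> k" for k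
  proof -
    have T: "0 \<le> slope s k" using slope_avg_nonneg[OF s] by auto
    have "1 \<le> real k powr e" using k e by (simp add: ge_one_powr_ge_zero)
    then have "1 + slope s k \<le> (1 + B) * real k powr e" using le[OF k] by (simp add: algebra_simps)
    then have "((1 + B) * real k powr e) powr - \<kappa> \<le> (1 + slope s k) powr - \<kappa>"
      using T \<kappa> by (intro powr_mono2') auto
    then have "C * ((1 + B) * real k powr e) powr - \<kappa> \<le> C * (1 + slope s k) powr - \<kappa>"
      using C(1) by (intro mult_left_mono) auto
    also have "\<dots> \<le> moment (slope s k)" by (rule C(2)[OF T])
    also have "\<dots> \<le> avg s k" by (rule avg_ge_moment[OF s])
    finally show ?thesis using B by (simp add: powr_mult powr_powr mult.commute mult.left_commute)
  qed
  moreover have "0 < C * (1 + B) powr - \<kappa>" using C B by simp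
  ultimately show ?thesis by blast
qed

text \<open>With derivative 1 the slope is s times the sum of the weights, which telescopes to a
  square of order k^2.\<close>

lemma slope_le_linear:
  assumes s: "0 < s" and R': "\<And>x. R' x = 1" and k: "1 \<le> k"
  shows "slope s k \<le> s * real k powr 2"
proof -
  have *: "slope s (Suc k) = s * (apgm_t k)\<^sup>2" for k
  proof (induction k)
    case 0
    show ?case by (simp add: slope_Suc_t R'[of "lookahead s 0"] slope_0)
  next
    case (Suc k)
    show ?case
      by (simp add: slope_Suc_t[of s "Suc k"] R'[of "lookahead s (Suc k)"] Suc apgm_t_Suc_sq algebra_simps)
  qed
  obtain j where j: "k = Suc j" using k by (cases k) auto
  have "(apgm_t j)\<^sup>2 \<le> (real j + 1)\<^sup>2" using apgm_t_le[of j] apgm_t_ge_1[of j] by (intro power_mono) auto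
  then show ?thesis using s by (simp add: j * add.commute)
qed

text \<open>The loop of \<open>averaged_growth\<close> closes with p = \<kappa>, the decay exponent
  of the moment: T powr (1 + \<kappa>) grows at most like the elapsed time, which is at most
  k^2.\<close>

lemma slope_le_quadratic:
  assumes s: "0 < s" and R': "\<And>x. R' x = x"
  shows "\<exists>B>0. \<forall>k\<ge>1. slope s k \<le> B * real k powr (2 / (1 + \<kappa>))"
proof -
  obtain C where C: "C > 0" "\<And>T. 0 \<le> T \<Longrightarrow> C * (1 + T) powr - \<kappa> \<le> moment T" using moment_ge by auto
  have "0 < C * (1 + 0) powr - \<kappa>" using C by simp
  then have m0: "0 < moment 0" using C(2)[of 0] by simp
  have "\<exists>D>0. \<forall>k. slope s (Suc k) powr (1 + \<kappa>) \<le> D * (apgm_t k)\<^sup>2"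
  proof (rule averaged_growth[where a = "avg s" and \<alpha> = "lookahead s" and m = "\<lambda>k. moment (slope s k)"
        and p = \<kappa> and s = s and C = "2 * c\<^sub>1 powr - \<kappa>"])
    show "moment (slope s (Suc k)) \<le> moment (slope s k)" for k
      using slope_mono[OF s] slope_avg_nonneg[OF s] by (intro moment_antimono) auto
    show "slope s (Suc k) = slope s k + s * apgm_t k * lookahead s k" for k
      by (simp only: slope_Suc_t R'[of "lookahead s k"])
    show "0 < moment (slope s 0)" using m0 by (simp only: slope_0)
  qed (use s \<kappa> pos slope_avg_nonneg[OF s] in
      \<open>auto simp: slope_0 avg_Suc lookahead_def intro: moment_nonneg moment_le\<close>)
  then obtain D where D: "D > 0" "\<And>k. slope s (Suc k) powr (1 + \<kappa>) \<le> D * (apgm_t k)\<^sup>2" by blast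
  have "slope s k \<le> D powr (1 / (1 + \<kappa>)) * real k powr (2 / (1 + \<kappa>))" if "1 \<le> k" for k
  proof -
    obtain j where j: "k = Suc j" using \<open>1 \<le> k\<close> by (cases k) auto
    have "(apgm_t j)\<^sup>2 \<le> (real k)\<^sup>2"
      using apgm_t_le[of j] apgm_t_ge_1[of j] by (intro power_mono) (auto simp: j)
    then have "D * (apgm_t j)\<^sup>2 \<le> D * (real k)\<^sup>2" using D by (intro mult_left_mono) auto
    then have "slope s k powr (1 + \<kappa>) \<le> D * real k powr 2" using D(2)[of j] j by simp
    then have "(slope s k powr (1 + \<kappa>)) powr (1 / (1 + \<kappa>)) \<le> (D * real k powr 2) powr (1 / (1 + \<kappa>))"
      using \<kappa> by (intro powr_mono2) auto
    then show ?thesis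
      using slope_avg_nonneg[OF s, of k] \<kappa> D(1) by (simp add: powr_powr powr_mult del: powr_numeral)
  qed
  moreover have "0 < D powr (1 / (1 + \<kappa>))" using D by simp
  ultimately show ?thesis by blast
qed

lemma gap_linear:
  assumes "0 < s" "\<And>x. R x = x" "\<And>x. R' x = 1"
  shows "\<exists>c>0. \<forall>f g h. apgm \<tau> obj eta2 s (\<lambda>_. 1) f g h \<longrightarrow>
    (\<forall>k\<ge>1. F_fun \<tau> obj (f k) - inf_F \<tau> obj \<ge> ereal (c * real k powr - (2 * \<kappa>)))"
proof -
  obtain c where "c > 0" "\<forall>k\<ge>1. c * real k powr - (\<kappa> * 2) \<le> avg s k"
    using avg_ge_of_slope_le[OF assms(1,1) _ slope_le_linear[OF assms(1,3)]] by auto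
  then show ?thesis by (intro exI[of _ c]) (auto simp: gap_avg[OF assms(1)] assms(2) mult.commute)
qed

lemma gap_quadratic:
  assumes "0 < s" "\<And>x. R x = x\<^sup>2 / 2" "\<And>x. R' x = x"
  shows "\<exists>c>0. \<forall>f g h. apgm \<tau> obj eta2 s (\<lambda>_. 1) f g h \<longrightarrow>
    (\<forall>k\<ge>1. F_fun \<tau> obj (f k) - inf_F \<tau> obj \<ge> ereal (c * real k powr - (4 * \<kappa> / (1 + \<kappa>))))"
proof -
  obtain B where B: "B > 0" "\<And>k. k \<ge> 1 \<Longrightarrow> slope s k \<le> B * real k powr (2 / (1 + \<kappa>))"
    using slope_le_quadratic[OF assms(1,3)] by auto
  have "0 \<le> 2 / (1 + \<kappa>)" using \<kappa> by simp
  then obtain c where c: "c > 0" "\<And>k. k \<ge> 1 \<Longrightarrow> c * real k powr - (\<kappa> * (2 / (1 + \<kappa>))) \<le> avg s k"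
    using avg_ge_of_slope_le[OF assms(1) B(1) _ B(2)] by auto
  have "c\<^sup>2 / 2 * real k powr - (4 * \<kappa> / (1 + \<kappa>)) \<le> (avg s k)\<^sup>2 / 2" if "k \<ge> 1" for k
  proof -
    have "(c * real k powr - (\<kappa> * (2 / (1 + \<kappa>))))\<^sup>2 \<le> (avg s k)\<^sup>2"
      using c(1) by (intro power_mono c(2)[OF that]) auto
    moreover have "(real k powr - (\<kappa> * (2 / (1 + \<kappa>))))\<^sup>2 = real k powr - (4 * \<kappa> / (1 + \<kappa>))"
      unfolding power2_eq_square powr_add[symmetric] by (simp add: field_simps)
    ultimately show ?thesis by (simp add: power_mult_distrib)
  qed
  then show ?thesis using c(1)
    by (intro exI[of _ "c\<^sup>2 / 2"]) (auto simp: gap_avg[OF assms(1)] assms(2))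
qed

end


section \<open>The flat torus\<close>

text \<open>Constancy is assumed only on the open set S because derivatives of chart changes are
  known only on the overlap. The induction passes to the derivative, which is constantly 0
  there.\<close>

lemma Ck_on_const_on:
  assumes "open S" "\<And>x. x \<in> S \<Longrightarrow> f x = c"
  shows "Ck_on k f S"
  using assms(2)
proof (induction k arbitrary: f c)
  case 0
  have "continuous_on S f \<longleftrightarrow> continuous_on S (\<lambda>_. c)" by (rule continuous_on_cong) (use 0 in auto)
  then show ?case by simp
next
  case (Suc k)
  have D: "(f has_derivative (\<lambda>_. 0)) (at x)" if "x \<in> S" for x
    by (rule has_derivative_transform_within_open[OF has_derivative_const[of c] assms(1) that]) (use Suc.prems in auto)
  have "Ck_on k (\<lambda>x. frechet_derivative f (at x) v) S" for v
    by (rule Suc.IH[of _ 0]) (simp flip: frechet_derivative_at[OF D])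
  moreover have "f differentiable_on S"
    using D by (auto simp: differentiable_on_def differentiable_def intro: has_derivative_at_withinI)
  ultimately show ?case by simp
qed

lemma smooth_on_const: "open S \<Longrightarrow> smooth_on (\<lambda>_. c) S"
  unfolding smooth_on_def by (auto intro: Ck_on_const_on)

lemma smooth_on_local_translation:
  assumes "open S" "\<And>x. x \<in> S \<Longrightarrow> (f has_derivative (\<lambda>v. v)) (at x)"
  shows "smooth_on f S"
  unfolding smooth_on_def
proof
  fix k show "Ck_on k f S"
  proof (cases k)
    case 0
    then show ?thesis
      using assms(2) by (auto intro!: continuous_at_imp_continuous_on dest: has_derivative_continuous)
  next
    case (Suc j)
    have "Ck_on j (\<lambda>x. frechet_derivative f (at x) v) S" for v
      by (rule Ck_on_const_on[OF assms(1), of _ v]) (simp flip: frechet_derivative_at[OF assms(2)])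
    moreover have "f differentiable_on S"
      using assms(2) by (auto simp: differentiable_on_def differentiable_def intro: has_derivative_at_withinI)
    ultimately show ?thesis using Suc by simp
  qed
qed

section \<open>Comparison of chords and arcs on the unit circle\<close>

lemma norm_cis_diff: "norm (cis x - cis y) = 2 * \<bar>sin ((x - y) / 2)\<bar>"
proof -
  have "cis x - cis y = cis y * (cis (x - y) - 1)" by (simp add: algebra_simps cis_mult)
  then have "norm (cis x - cis y) = norm (cis (x - y) - 1)" by (simp add: norm_mult)
  also have "(norm (cis (x - y) - 1))\<^sup>2 = (2 * \<bar>sin ((x - y) / 2)\<bar>)\<^sup>2"
  proof -
    have "(norm (cis u - 1))\<^sup>2 = (2 * \<bar>sin (u / 2)\<bar>)\<^sup>2" for u
    proof -
      have "(norm (cis u - 1))\<^sup>2 = (cos u - 1)\<^sup>2 + (sin u)\<^sup>2" by (simp add: cmod_power2)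
      also have "\<dots> = 2 - 2 * cos u" using sin_cos_squared_add[of u] by (simp add: power2_eq_square algebra_simps)
      also have "\<dots> = 4 * (sin (u / 2))\<^sup>2" using cos_double_sin[of "u / 2"] by simp
      finally show ?thesis by (simp add: power_mult_distrib)
    qed
    then show ?thesis .
  qed
  then have "norm (cis (x - y) - 1) = 2 * \<bar>sin ((x - y) / 2)\<bar>" by (rule power2_eq_imp_eq) auto
  finally show ?thesis .
qed

lemma norm_cis_diff_le: "norm (cis x - cis y) \<le> \<bar>x - y\<bar>"
  unfolding norm_cis_diff using abs_sin_x_le_abs_x[of "(x - y) / 2"] by simp

text \<open>The constant 1/3 comes from sin x \<ge> x - x^3 / 6 \<ge> x / 3 on [0, 2], an interval
  that contains half of any angle up to pi.\<close>

lemma norm_cis_minus_1_ge: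
  assumes "\<bar>y\<bar> \<le> pi"
  shows "\<bar>y\<bar> / 3 \<le> norm (cis y - 1)"
proof -
  have *: "x / 3 \<le> sin x" if x: "0 \<le> x" "x \<le> 2" for x :: real
  proof -
    have "\<bar>sin x - (\<Sum>m<3. sin_coeff m * x ^ m)\<bar> \<le> inverse (fact 3) * \<bar>x\<bar> ^ 3" by (rule Maclaurin_sin_bound)
    moreover have "(\<Sum>m<3. sin_coeff m * x ^ m) = x" by (simp add: sin_coeff_def eval_nat_numeral)
    ultimately have "\<bar>sin x - x\<bar> \<le> x ^ 3 / 6" using x by (simp add: fact_numeral)
    then have 1: "x - x ^ 3 / 6 \<le> sin x" by linarith
    have "x * x\<^sup>2 \<le> x * 2\<^sup>2" using x by (intro mult_left_mono power_mono) auto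
    then show ?thesis using 1 by (simp add: power3_eq_cube power2_eq_square)
  qed
  have "\<bar>y\<bar> / 2 \<le> 2" using assms pi_less_4 by simp
  then have "\<bar>y\<bar> / 2 / 3 \<le> sin (\<bar>y\<bar> / 2)" by (intro *) auto
  also have "\<dots> \<le> \<bar>sin (y / 2)\<bar>" by (simp add: abs_if)
  finally show ?thesis using norm_cis_diff[of y 0] by simp
qed

section \<open>The torus as a product of circles, with angular charts\<close>

definition torus :: "(complex ^ 'n::finite) set" where
  "torus = {z. \<forall>i. norm (z $ i) = 1}"

definition angle_map :: "real ^ 'n \<Rightarrow> complex ^ 'n::finite" where
  "angle_map y = (\<chi> i. cis (y $ i))"

definition angle_box :: "real ^ 'n \<Rightarrow> (real ^ 'n::finite) set" where
  "angle_box \<theta> = {y. \<forall>i. \<theta> $ i - pi < y $ i \<and> y $ i < \<theta> $ i + pi}"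

definition angle_coords :: "real ^ 'n \<Rightarrow> complex ^ 'n \<Rightarrow> real ^ 'n::finite" where
  "angle_coords \<theta> z = (\<chi> i. \<theta> $ i + Arg (z $ i * cis (- (\<theta> $ i))))"

text \<open>One chart for every centre \<theta>, omitting the points antipodal to the centre in some
  coordinate. This large family lets any two points share a chart.\<close>

definition torus_chart :: "real ^ 'n \<Rightarrow> (complex ^ 'n, 'n::finite) chart" where
  "torus_chart \<theta> = (angle_map ` angle_box \<theta>, angle_coords \<theta>)"

text \<open>The identity Gram matrix is consistent across charts because all chart changes are
  locally translations.\<close>

definition flat_torus :: "(complex ^ 'n, 'n::finite) riemannian" where
  "flat_torus = \<lparr>mtop = top_of_set torus, charts = range torus_chart, metric = (\<lambda>_ _. mat 1)\<rparr>"

lemma flat_torus_simps [simp]: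
  "mtop flat_torus = top_of_set torus" "charts flat_torus = range torus_chart" "metric flat_torus c y = mat 1"
  by (simp_all add: flat_torus_def)

lemma angle_map_in_torus [simp]: "angle_map y \<in> torus"
  by (simp add: angle_map_def torus_def)

lemma angle_coords_angle_map: "y \<in> angle_box \<theta> \<Longrightarrow> angle_coords \<theta> (angle_map y) = y"
  by (auto simp: angle_coords_def angle_map_def angle_box_def vec_eq_iff cis_mult Arg_cis diff_less_eq less_diff_eq add.commute less_imp_le)

lemma angle_coords_image: "angle_coords \<theta> ` angle_map ` angle_box \<theta> = angle_box \<theta>"
  unfolding image_image by (auto simp: angle_coords_angle_map)

lemma inv_into_angle_coords:
  assumes "y \<in> angle_box \<theta>"
  shows "inv_into (angle_map ` angle_box \<theta>) (angle_coords \<theta>) y = angle_map y"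
proof (rule inv_into_f_eq)
  show "inj_on (angle_coords \<theta>) (angle_map ` angle_box \<theta>)"
    by (rule inj_onI) (auto simp: angle_coords_angle_map)
qed (use assms angle_coords_angle_map in auto)

lemma open_angle_box: "open (angle_box \<theta>)"
proof -
  have "angle_box \<theta> = box (\<theta> - (\<chi> i. pi)) (\<theta> + (\<chi> i. pi))" by (auto simp: angle_box_def mem_box_cart)
  then show ?thesis by (simp only: open_box)
qed

lemma continuous_on_angle_map: "continuous_on S angle_map"
  unfolding angle_map_def by (intro continuous_on_vec_lambda continuous_on_cis continuous_on_component continuous_on_id)

text \<open>After rotation by -\<theta> the omitted points are those on the branch cut of
  \<open>Arg\<close>. This description yields openness of the domain and continuity of the
  coordinates.\<close>

lemma angle_map_image: "angle_map ` angle_box \<theta> = {z \<in> torus. \<forall>i. z $ i * cis (- (\<theta> $ i)) \<notin> \<real>\<^sub>\<le>\<^sub>0}"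
proof (intro equalityI subsetI)
  fix z assume "z \<in> angle_map ` angle_box \<theta>"
  then obtain y where y: "y \<in> angle_box \<theta>" "z = angle_map y" by auto
  have "cis (y $ i - \<theta> $ i) \<notin> \<real>\<^sub>\<le>\<^sub>0" for i
  proof
    assume "cis (y $ i - \<theta> $ i) \<in> \<real>\<^sub>\<le>\<^sub>0"
    then have *: "cos (y $ i - \<theta> $ i) \<le> 0" "sin (y $ i - \<theta> $ i) = 0" by (auto simp: complex_nonpos_Reals_iff)
    have "\<bar>y $ i - \<theta> $ i\<bar> < pi" using y(1) by (auto simp: angle_box_def abs_less_iff algebra_simps)
    then have "y $ i - \<theta> $ i = 0" using * sin_zero_pi_iff by blast
    with * show False by simp
  qed
  then show "z \<in> {z \<in> torus. \<forall>i. z $ i * cis (- (\<theta> $ i)) \<notin> \<real>\<^sub>\<le>\<^sub>0}"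
    using y by (simp add: cis_mult) (simp add: angle_map_def cis_mult)
next
  fix z assume z: "z \<in> {z \<in> torus. \<forall>i. z $ i * cis (- (\<theta> $ i)) \<notin> \<real>\<^sub>\<le>\<^sub>0}"
  define w where "w i = z $ i * cis (- (\<theta> $ i))" for i
  have w: "norm (w i) = 1" "w i \<notin> \<real>\<^sub>\<le>\<^sub>0" for i using z by (auto simp: w_def torus_def norm_mult)
  have "Arg (w i) < pi" for i
    using Arg_le_pi[of "w i"] Arg_eq_pi[of "w i"] w(2)[of i] by (auto simp: complex_nonpos_Reals_iff less_le)
  then have "angle_coords \<theta> z \<in> angle_box \<theta>" using mpi_less_Arg by (auto simp: angle_coords_def angle_box_def w_def)
  moreover have "angle_map (angle_coords \<theta> z) = z"
  proof -
    have "cis (\<theta> $ i + Arg (w i)) = z $ i" for i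
    proof -
      have "w i \<noteq> 0" using w(1)[of i] by auto
      then have "cis (Arg (w i)) = w i" using cis_Arg[of "w i"] w(1)[of i] by (simp add: sgn_div_norm)
      then have "cis (\<theta> $ i + Arg (w i)) = z $ i * (cis (- (\<theta> $ i)) * cis (\<theta> $ i))"
        by (simp add: cis_mult[symmetric] w_def mult_ac)
      then show ?thesis by (simp add: cis_mult)
    qed
    then show ?thesis by (simp add: angle_map_def angle_coords_def vec_eq_iff w_def)
  qed
  ultimately show "z \<in> angle_map ` angle_box \<theta>" by force
qed

lemma openin_angle_map_image: "openin (top_of_set torus) (angle_map ` angle_box \<theta>)"
proof -
  let ?f = "\<lambda>i z. z $ i * cis (- (\<theta> $ i))"
  have "open (\<Inter>i\<in>UNIV. ?f i -` (- \<real>\<^sub>\<le>\<^sub>0))"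
    by (intro open_INT open_vimage ballI) (auto intro!: continuous_intros)
  then have "openin (top_of_set torus) (torus \<inter> (\<Inter>i\<in>UNIV. ?f i -` (- \<real>\<^sub>\<le>\<^sub>0)))" by blast
  also have "torus \<inter> (\<Inter>i\<in>UNIV. ?f i -` (- \<real>\<^sub>\<le>\<^sub>0)) = angle_map ` angle_box \<theta>"
    unfolding angle_map_image by auto
  finally show ?thesis .
qed

lemma angle_map_image_subset: "angle_map ` angle_box \<theta> \<subseteq> torus" by auto

lemma homeomorphic_map_angle_coords:
  "homeomorphic_map (subtopology (top_of_set torus) (angle_map ` angle_box \<theta>)) (top_of_set (angle_box \<theta>)) (angle_coords \<theta>)"
proof -
  have *: "subtopology (top_of_set torus) (angle_map ` angle_box \<theta>) = top_of_set (angle_map ` angle_box \<theta>)"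
    by (simp add: subtopology_subtopology inf.absorb2[OF angle_map_image_subset])
  have "continuous_on (angle_map ` angle_box \<theta>) (angle_coords \<theta>)"
    unfolding angle_coords_def
  proof (intro continuous_on_vec_lambda continuous_on_add continuous_on_const)
    fix i
    show "continuous_on (angle_map ` angle_box \<theta>) (\<lambda>z. Arg (z $ i * cis (- \<theta> $ i)))"
    proof (rule continuous_on_compose2[of "- \<real>\<^sub>\<le>\<^sub>0" Arg])
      show "continuous_on (- \<real>\<^sub>\<le>\<^sub>0) Arg"
        by (auto simp: continuous_on_eq_continuous_within intro: continuous_within_Arg)
    qed (unfold angle_map_image, auto intro!: continuous_intros)
  qed
  then have "homeomorphic_maps (top_of_set (angle_map ` angle_box \<theta>)) (top_of_set (angle_box \<theta>)) (angle_coords \<theta>) angle_map"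
    by (auto simp: homeomorphic_maps_def angle_coords_angle_map continuous_on_angle_map)
  then show ?thesis unfolding * by (rule homeomorphic_maps_imp_map)
qed

text \<open>The chart is centred midway along the shorter arc in each coordinate: the angle
  differences d are at most pi in modulus, so both points lie within pi / 2 of the centre.\<close>

lemma ex_chart:
  fixes z :: "complex ^ 'n::finite"
  assumes "z \<in> torus" "w \<in> torus"
  shows "\<exists>\<theta>. z \<in> angle_map ` angle_box \<theta> \<and> w \<in> angle_map ` angle_box \<theta>"
proof -
  define a where "a = (\<chi> i. Arg (z $ i))"
  define d where "d = (\<chi> i. Arg (w $ i / z $ i))"
  have z1: "norm (z $ i) = 1" "norm (w $ i) = 1" for i using assms by (auto simp: torus_def)
  have z0: "z $ i \<noteq> 0" "w $ i \<noteq> 0" for i using z1[of i] by auto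
  have "angle_map a = z" using z1 z0 by (simp add: angle_map_def a_def vec_eq_iff cis_Arg sgn_div_norm)
  moreover have "angle_map (a + d) = w"
    using z1 z0 by (simp add: angle_map_def a_def d_def vec_eq_iff cis_mult[symmetric] cis_Arg sgn_div_norm norm_divide)
  moreover have "- pi < d $ i" "d $ i \<le> pi" for i using Arg_bounded[of "w $ i / z $ i"] by (auto simp: d_def)
  then have "a \<in> angle_box (a + d /\<^sub>R 2)" "a + d \<in> angle_box (a + d /\<^sub>R 2)"
    unfolding angle_box_def by (auto simp: field_simps) (smt (verit) pi_gt_zero)+
  ultimately show ?thesis by blast
qed

lemma torus_eq_image: "torus = angle_map ` (UNIV :: (real ^ 'n::finite) set)"
proof (intro equalityI subsetI)
  fix z :: "complex ^ 'n" assume "z \<in> torus"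
  from ex_chart[OF this this] show "z \<in> angle_map ` UNIV" by blast
qed auto

lemma angle_map_eq_iff: "angle_map y = angle_map y' \<longleftrightarrow> (\<exists>k :: int ^ 'n. y' = y + (\<chi> i. 2 * pi * of_int (k $ i)))"
  for y y' :: "real ^ 'n::finite"
proof
  assume eq: "angle_map y = angle_map y'"
  have "\<exists>n::int. y' $ i = y $ i + 2 * pi * of_int n" for i
  proof -
    have "cis (y $ i) = cis (y' $ i)" using eq by (simp add: angle_map_def vec_eq_iff)
    then have "cis (y' $ i - y $ i) = 1" by (simp add: cis_divide[symmetric])
    then have "cos (y' $ i - y $ i) = 1" by (metis cis.sel(1) one_complex.sel(1))
    then show ?thesis unfolding cos_one_2pi_int by (force simp: algebra_simps)
  qed
  then obtain k where "\<And>i. y' $ i = y $ i + 2 * pi * of_int (k i)" by metis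
  then show "\<exists>k :: int ^ 'n. y' = y + (\<chi> i. 2 * pi * of_int (k $ i))"
    by (intro exI[of _ "\<chi> i. k i"]) (simp add: vec_eq_iff)
qed (auto simp: angle_map_def vec_eq_iff cis_mult[symmetric] cis_multiple_2pi)

lemma has_derivative_transition:
  assumes "y \<in> angle_box \<theta>" "angle_map y \<in> angle_map ` angle_box \<theta>'"
  shows "(transition (torus_chart \<theta>) (torus_chart \<theta>') has_derivative (\<lambda>v. v)) (at y)"
proof -
  obtain y' where y': "y' \<in> angle_box \<theta>'" "angle_map y = angle_map y'" using assms(2) by auto
  then obtain k :: "int ^ 'a" where k: "y' = y + (\<chi> i. 2 * pi * of_int (k $ i))" using angle_map_eq_iff by blast
  define v where "v = (\<chi> i. 2 * pi * of_int (k $ i))"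
  \<comment> \<open>The overlap of two charts is in general disconnected, with different lattice
    shifts on different components; on this neighbourhood of y one shift serves throughout.\<close>
  define S where "S = angle_box \<theta> \<inter> (\<lambda>x. x + v) -` angle_box \<theta>'"
  have S: "open S" unfolding S_def by (intro open_Int open_vimage open_angle_box continuous_intros)
  have yS: "y \<in> S" using assms(1) y' k by (simp add: S_def v_def)
  have D: "((\<lambda>x. x + v) has_derivative (\<lambda>v. v)) (at y)" by (auto intro!: derivative_eq_intros)
  have "x + v = transition (torus_chart \<theta>) (torus_chart \<theta>') x" if "x \<in> S" for x
  proof -
    have "angle_map x = angle_map (x + v)" unfolding v_def angle_map_eq_iff by blast
    then show ?thesis using that
      by (simp add: S_def transition_def torus_chart_def inv_into_angle_coords angle_coords_angle_map)
  qed
  from has_derivative_transform_within_open[OF D S yS this] show ?thesis .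
qed

lemma chart_overlap:
  "angle_coords \<theta> ` (angle_map ` angle_box \<theta> \<inter> V) = {y \<in> angle_box \<theta>. angle_map y \<in> V}"
  by (force simp: angle_coords_angle_map image_iff)

lemma open_chart_overlap: "open {y \<in> angle_box \<theta>. angle_map y \<in> angle_map ` angle_box \<theta>'}"
proof -
  obtain W where W: "open W" "angle_map ` angle_box \<theta>' = torus \<inter> W"
    using openin_angle_map_image[of \<theta>'] by (auto simp: openin_open)
  then have "{y \<in> angle_box \<theta>. angle_map y \<in> angle_map ` angle_box \<theta>'} = angle_box \<theta> \<inter> angle_map -` W" by auto
  then show ?thesis using W(1) by (auto intro!: open_Int open_angle_box open_vimage continuous_on_angle_map)
qed

lemma compact_riemannian_flat_torus: "compact_riemannian_manifold (flat_torus :: (complex ^ 'n::finite, 'n) riemannian)"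
proof -
  let ?T = "flat_torus :: (complex ^ 'n, 'n) riemannian"
  have "(torus :: (complex ^ 'n) set) = angle_map ` cbox (\<chi> i. - pi) (\<chi> i. pi)"
  proof (intro equalityI subsetI)
    fix z :: "complex ^ 'n" assume "z \<in> torus"
    then have z: "norm (z $ i) = 1" for i by (simp add: torus_def)
    then have "z $ i \<noteq> 0" for i by (metis norm_zero zero_neq_one)
    then have "z = angle_map (\<chi> i. Arg (z $ i))" using z by (simp add: angle_map_def vec_eq_iff cis_Arg sgn_div_norm)
    moreover have "(\<chi> i. Arg (z $ i)) \<in> cbox (\<chi> i. - pi) (\<chi> i. pi)"
      using Arg_bounded by (auto simp: mem_box_cart less_imp_le)
    ultimately show "z \<in> angle_map ` cbox (\<chi> i. - pi) (\<chi> i. pi)" by blast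
  qed auto
  then have "compact (torus :: (complex ^ 'n) set)"
    using compact_continuous_image[OF continuous_on_angle_map compact_cbox] by metis
  then have "compact_space (top_of_set (torus :: (complex ^ 'n) set))"
    by (simp add: compact_space_subtopology)
  moreover have "connected (torus :: (complex ^ 'n) set)"
    unfolding torus_eq_image by (intro connected_continuous_image continuous_on_angle_map connected_UNIV)
  then have "connected_space (top_of_set (torus :: (complex ^ 'n) set))"
    by (simp add: connected_space_subtopology)
  moreover have "Hausdorff_space (top_of_set (torus :: (complex ^ 'n) set))"
    by (intro Hausdorff_space_subtopology Hausdorff_space_euclidean)
  moreover have "smooth_atlas ?T"
    unfolding smooth_atlas_def
  proof (intro conjI)
    show "(\<Union>(U, \<phi>)\<in>charts ?T. U) = points ?T"
      using ex_chart by (auto simp: torus_chart_def) blast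
    show "\<forall>(U, \<phi>)\<in>charts ?T. openin (mtop ?T) U \<and> open (\<phi> ` U) \<and>
       homeomorphic_map (subtopology (mtop ?T) U) (top_of_set (\<phi> ` U)) \<phi>"
      by (auto simp: torus_chart_def angle_coords_image openin_angle_map_image open_angle_box homeomorphic_map_angle_coords)
    show "\<forall>(U, \<phi>)\<in>charts ?T. \<forall>(V, \<psi>)\<in>charts ?T.
        smooth_on (transition (U, \<phi>) (V, \<psi>)) (\<phi> ` (U \<inter> V))"
    proof (clarsimp simp: torus_chart_def chart_overlap)
      fix \<theta> \<theta>' :: "real ^ 'n"
      show "smooth_on (transition (angle_map ` angle_box \<theta>, angle_coords \<theta>) (angle_map ` angle_box \<theta>', angle_coords \<theta>'))
         {y \<in> angle_box \<theta>. angle_map y \<in> angle_map ` angle_box \<theta>'}"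
        by (rule smooth_on_local_translation[OF open_chart_overlap])
          (use has_derivative_transition[of _ \<theta> \<theta>'] in \<open>auto simp: torus_chart_def\<close>)
    qed
  qed
  moreover have "smooth_metric ?T"
    unfolding smooth_metric_def
  proof (intro conjI)
    show "\<forall>(U, \<phi>)\<in>charts ?T. smooth_on (metric ?T (U, \<phi>)) (\<phi> ` U) \<and>
        (\<forall>y\<in>\<phi> ` U. transpose (metric ?T (U, \<phi>) y) = metric ?T (U, \<phi>) y \<and>
           (\<forall>v. v \<noteq> 0 \<longrightarrow> v \<bullet> (metric ?T (U, \<phi>) y *v v) > 0))"
      by (auto simp: torus_chart_def angle_coords_image flat_torus_def transpose_mat intro!: smooth_on_const open_angle_box)
    show "\<forall>(U, \<phi>)\<in>charts ?T. \<forall>(V, \<psi>)\<in>charts ?T. \<forall>y\<in>\<phi> ` (U \<inter> V). \<forall>v w.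
        v \<bullet> (metric ?T (U, \<phi>) y *v w) =
          frechet_derivative (transition (U, \<phi>) (V, \<psi>)) (at y) v \<bullet>
          (metric ?T (V, \<psi>) (transition (U, \<phi>) (V, \<psi>) y) *v
            frechet_derivative (transition (U, \<phi>) (V, \<psi>)) (at y) w)"
    proof -
      have key: "frechet_derivative (transition c c') (at y) = (\<lambda>v. v)"
        if c: "c \<in> charts ?T" "c' \<in> charts ?T" and y: "y \<in> snd c ` (fst c \<inter> fst c')" for c c' y
      proof -
        obtain \<theta> \<theta>' where \<theta>: "c = torus_chart \<theta>" "c' = torus_chart \<theta>'" using c by auto
        then have "y \<in> {y \<in> angle_box \<theta>. angle_map y \<in> angle_map ` angle_box \<theta>'}"
          using y unfolding chart_overlap[symmetric] by (simp add: torus_chart_def)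
        then show ?thesis
          unfolding \<theta> using frechet_derivative_at[OF has_derivative_transition, of y \<theta> \<theta>', symmetric] by blast
      qed
      show ?thesis
      proof (unfold case_prod_beta prod.collapse, intro ballI allI)
        fix c c' y v w
        assume "c \<in> charts ?T" "c' \<in> charts ?T" "y \<in> snd c ` (fst c \<inter> fst c')"
        from key[OF this] show "v \<bullet> (metric ?T c y *v w) = frechet_derivative (transition c c') (at y) v \<bullet>
          (metric ?T c' (transition c c' y) *v frechet_derivative (transition c c') (at y) w)"
          by simp
      qed
    qed
  qed
  moreover have "(torus :: (complex ^ 'n) set) \<noteq> {}" using angle_map_in_torus by blast
  ultimately show ?thesis by (simp add: compact_riemannian_manifold_def)
qed

section \<open>Borel sets, fundamental domains and the volume measure\<close>

lemma space_borel_of [simp]: "space (borel_of X) = topspace X"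
  unfolding borel_of_def by (rule space_measure_of) (auto dest: openin_subset)

lemma openin_in_sets_borel_of: "openin X U \<Longrightarrow> U \<in> sets (borel_of X)"
  unfolding borel_of_def by (subst sets_measure_of) (auto dest: openin_subset)

lemma borel_of_measurable_continuous_map:
  assumes "continuous_map X euclidean f"
  shows "f \<in> borel_measurable (borel_of X)"
proof (rule borel_measurableI)
  fix S :: "'b set" assume "open S"
  then have "openin X {x \<in> topspace X. f x \<in> S}" using assms by (intro openin_continuous_map_preimage) auto
  moreover have "{x \<in> topspace X. f x \<in> S} = f -` S \<inter> space (borel_of X)" by auto
  ultimately show "f -` S \<inter> space (borel_of X) \<in> sets (borel_of X)" by (metis openin_in_sets_borel_of)
qed

lemma angle_map_measurable [measurable]: "angle_map \<in> measurable borel (borel_of (top_of_set torus))"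
  unfolding borel_of_def
proof (rule measurable_measure_of)
  fix U assume "U \<in> {U. openin (top_of_set torus) U}"
  then obtain W where W: "open W" "U = torus \<inter> W" by (auto simp: openin_open)
  then have "angle_map -` U \<inter> space borel = angle_map -` W" by auto
  moreover have "open (angle_map -` W)" using W(1) by (intro open_vimage continuous_on_angle_map)
  ultimately show "angle_map -` U \<inter> space borel \<in> sets borel" by simp
qed (auto dest: openin_imp_subset)

text \<open>Half-open, unlike \<open>angle_box\<close>, so that each lattice orbit meets it exactly
  once.\<close>

definition angle_period :: "real ^ 'n \<Rightarrow> (real ^ 'n::finite) set" where
  "angle_period \<theta> = {y. \<forall>i. \<theta> $ i - pi < y $ i \<and> y $ i \<le> \<theta> $ i + pi}"

lemma angle_period_measurable [measurable]: "angle_period \<theta> \<in> sets borel"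
proof -
  have [measurable]: "(\<lambda>y :: real ^ 'n. y $ i) \<in> borel_measurable borel" for i
    by (intro borel_measurable_continuous_onI continuous_intros)
  have "{y \<in> space borel. \<forall>i. \<theta> $ i - pi < y $ i \<and> y $ i \<le> \<theta> $ i + pi} \<in> sets borel" by measurable
  then show ?thesis by (simp add: angle_period_def)
qed

definition lattice_shift :: "int ^ 'n \<Rightarrow> real ^ 'n::finite" where
  "lattice_shift k = (\<chi> i. 2 * pi * of_int (k $ i))"

lemma ex1_lattice_shift: "\<exists>!k. y + lattice_shift k \<in> angle_period \<theta>"
proof -
  have iff: "\<theta> $ i - pi < y $ i + 2 * pi * of_int m \<and> y $ i + 2 * pi * of_int m \<le> \<theta> $ i + pi \<longleftrightarrow>
    m = \<lfloor>(\<theta> $ i + pi - y $ i) / (2 * pi)\<rfloor>" for i m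
  proof -
    have "m = \<lfloor>(\<theta> $ i + pi - y $ i) / (2 * pi)\<rfloor> \<longleftrightarrow>
      of_int m \<le> (\<theta> $ i + pi - y $ i) / (2 * pi) \<and> (\<theta> $ i + pi - y $ i) / (2 * pi) < of_int m + 1"
      by (auto simp: eq_commute[of m] floor_eq_iff)
    also have "\<dots> \<longleftrightarrow> of_int m * (2 * pi) \<le> \<theta> $ i + pi - y $ i \<and> \<theta> $ i + pi - y $ i < (of_int m + 1) * (2 * pi)"
      by (simp only: pos_le_divide_eq pos_divide_less_eq pi_gt_zero mult_pos_pos zero_less_numeral)
    finally show ?thesis by (auto simp: algebra_simps)
  qed
  have "y + lattice_shift k \<in> angle_period \<theta> \<longleftrightarrow> k = (\<chi> i. \<lfloor>(\<theta> $ i + pi - y $ i) / (2 * pi)\<rfloor>)" for k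
    using iff by (auto simp: angle_period_def lattice_shift_def vec_eq_iff)
  then show ?thesis by simp
qed

lemma lattice_shift_unique:
  "y + lattice_shift k \<in> angle_period \<theta> \<Longrightarrow> y + lattice_shift k' \<in> angle_period \<theta> \<Longrightarrow> k = k'"
  using ex1_lattice_shift[of y \<theta>] by blast

lemma lattice_shift_uminus: "lattice_shift (- k) = - lattice_shift k"
  by (simp add: lattice_shift_def vec_eq_iff)

text \<open>Cutting one fundamental domain along the translates of the other and moving the countably many
  pieces back by the lattice turns one into the other.\<close>
lemma emeasure_angle_period:
  fixes B :: "(real ^ 'n::finite) set"
  assumes [measurable]: "B \<in> sets borel" and B: "\<And>y k. y + lattice_shift k \<in> B \<longleftrightarrow> y \<in> B"
  shows "emeasure lborel (B \<inter> angle_period \<theta>) = emeasure lborel (B \<inter> angle_period \<theta>')"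
proof -
  define X where "X k = B \<inter> angle_period \<theta> \<inter> (\<lambda>y. lattice_shift k + y) -` angle_period \<theta>'" for k
  define Y where "Y k = B \<inter> angle_period \<theta>' \<inter> (\<lambda>y. - lattice_shift k + y) -` angle_period \<theta>" for k
  have vm: "(\<lambda>y. c + y) -` S \<in> sets borel" if "S \<in> sets borel" for c :: "real ^ 'n" and S
    using measurable_sets_borel[of "\<lambda>y. c + y" borel S] that by simp
  have X [measurable]: "X k \<in> sets borel" and Y [measurable]: "Y k \<in> sets borel" for k
    unfolding X_def Y_def by (intro sets.Int vm; measurable)+
  have X_eq: "X k = (\<lambda>y. lattice_shift k + y) -` Y k" for k
    using B[of _ k] by (auto simp: X_def Y_def add.commute)
  have XY: "emeasure lborel (X k) = emeasure lborel (Y k)" for k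
  proof -
    have "emeasure lborel (Y k) = emeasure (distr lborel borel ((+) (lattice_shift k))) (Y k)"
      by (simp add: lborel_distr_plus)
    also have "\<dots> = emeasure lborel ((+) (lattice_shift k) -` Y k \<inter> space lborel)"
      by (rule emeasure_distr) auto
    finally show ?thesis by (simp add: X_eq)
  qed
  have "disjoint_family X"
    unfolding disjoint_family_on_def X_def by (auto simp: add.commute dest: lattice_shift_unique)
  moreover have "disjoint_family Y"
    unfolding disjoint_family_on_def Y_def lattice_shift_uminus[symmetric]
    by (auto simp: add.commute) (metis lattice_shift_unique neg_equal_iff_equal)
  moreover have "B \<inter> angle_period \<theta> = (\<Union>k. X k)"
    unfolding X_def using ex1_lattice_shift[of _ \<theta>'] by (auto simp: add.commute) blast
  moreover have "B \<inter> angle_period \<theta>' = (\<Union>k. Y k)"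
    unfolding Y_def lattice_shift_uminus[symmetric] using ex1_lattice_shift[of _ \<theta>]
    by (auto simp: add.commute) (metis minus_minus)
  ultimately show ?thesis
    using emeasure_UN_countable[of UNIV X lborel] emeasure_UN_countable[of UNIV Y lborel] by (simp add: XY)
qed

text \<open>Pushes Lebesgue measure forward from one fixed fundamental domain; agreement with charts
  centred elsewhere then rests on the invariance under change of domain.\<close>

definition torus_volume :: "(complex ^ 'n::finite) measure" where
  "torus_volume = distr (restrict_space lborel (angle_period 0)) (borel_of (top_of_set torus)) angle_map"

lemma sets_torus_volume [simp, measurable_cong]: "sets torus_volume = sets (borel_of (top_of_set torus))"
  and space_torus_volume [simp]: "space torus_volume = torus"
  by (simp_all add: torus_volume_def)

lemma emeasure_torus_volume:
  assumes "A \<in> sets (borel_of (top_of_set torus))"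
  shows "emeasure torus_volume A = emeasure lborel (angle_map -` A \<inter> angle_period 0)"
proof -
  have "angle_map \<in> measurable (restrict_space lborel (angle_period 0)) (borel_of (top_of_set torus))"
    by (intro measurable_restrict_space1) simp
  then have "emeasure torus_volume A = emeasure (restrict_space lborel (angle_period 0)) (angle_map -` A \<inter> angle_period 0)"
    unfolding torus_volume_def by (subst emeasure_distr) (use assms in \<open>auto simp: space_restrict_space\<close>)
  then show ?thesis by (simp add: emeasure_restrict_space)
qed

lemma volume_measure_flat_torus: "volume_measure (flat_torus :: (complex ^ 'n::finite, 'n) riemannian) torus_volume"
proof -
  have "emeasure torus_volume A =
      (\<integral>\<^sup>+y\<in>angle_coords \<theta> ` A. ennreal (sqrt (det (mat 1 :: real ^ 'n ^ 'n))) \<partial>lborel)"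
    if A: "A \<in> sets (borel_of (top_of_set torus))" "A \<subseteq> angle_map ` angle_box \<theta>" for \<theta> and A :: "(complex ^ 'n) set"
  proof -
    have [measurable]: "angle_map -` A \<in> sets borel"
      using measurable_sets[OF angle_map_measurable A(1)] by simp
    \<comment> \<open>The boundary points of the half-open period do not map into A: a point of A
      has a representative in the open box, and representatives in the period are unique.\<close>
    have eq: "angle_coords \<theta> ` A = angle_map -` A \<inter> angle_period \<theta>"
    proof (intro equalityI subsetI)
      fix y assume "y \<in> angle_coords \<theta> ` A"
      then show "y \<in> angle_map -` A \<inter> angle_period \<theta>"
        using A(2) by (auto simp: angle_coords_angle_map angle_box_def angle_period_def subset_iff image_iff less_imp_le)
    next
      fix y assume y: "y \<in> angle_map -` A \<inter> angle_period \<theta>"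
      then obtain y' where y': "y' \<in> angle_box \<theta>" "angle_map y = angle_map y'" using A(2) by blast
      then obtain k where "y' = y + lattice_shift k" unfolding angle_map_eq_iff lattice_shift_def by blast
      moreover have "y' \<in> angle_period \<theta>" using y' by (auto simp: angle_box_def angle_period_def less_imp_le)
      moreover have "lattice_shift 0 = (0 :: real ^ 'n)" by (simp add: lattice_shift_def vec_eq_iff)
      ultimately have "y' = y" using ex1_lattice_shift[of y \<theta>] y by (metis IntE add.right_neutral)
      then show "y \<in> angle_coords \<theta> ` A" using y y' by (force simp: angle_coords_angle_map)
    qed
    have "emeasure torus_volume A = emeasure lborel (angle_map -` A \<inter> angle_period 0)"
      by (rule emeasure_torus_volume[OF A(1)])
    also have "\<dots> = emeasure lborel (angle_map -` A \<inter> angle_period \<theta>)"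
    proof (rule emeasure_angle_period)
      fix y :: "real ^ 'n" and k
      have "angle_map (y + lattice_shift k) = angle_map y" unfolding lattice_shift_def using angle_map_eq_iff by metis
      then show "y + lattice_shift k \<in> angle_map -` A \<longleftrightarrow> y \<in> angle_map -` A" by simp
    qed simp
    finally show ?thesis unfolding eq by (simp add: det_I)
  qed
  then show ?thesis by (auto simp: volume_measure_def torus_chart_def)
qed

section \<open>The normalized volume and the size of angular cubes\<close>

abbreviation torus_prob :: "(complex ^ 'n::finite) measure" where
  "torus_prob \<equiv> uniform_measure torus_volume torus"

lemma measure_cube:
  assumes "0 \<le> \<delta>"
  shows "measure lborel (cbox (\<chi> i. - \<delta>) (\<chi> i. \<delta>) :: (real ^ 'n::finite) set) = (2 * \<delta>) ^ CARD('n)"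
proof -
  have "(\<chi> i. 0) \<in> cbox (\<chi> i. - \<delta>) (\<chi> i. \<delta>)" using assms by (auto simp: mem_box_cart)
  then have "cbox (\<chi> i. - \<delta>) (\<chi> i. \<delta>) \<noteq> ({} :: (real ^ 'n) set)" by blast
  then show ?thesis by (simp add: content_cbox_cart)
qed

lemma angle_period_fmeasurable: "angle_period (0 :: real ^ 'n::finite) \<in> fmeasurable lborel"
  by (rule fmeasurableI2[of "cbox (\<chi> i. - pi) (\<chi> i. pi)"])
    (auto simp: angle_period_def mem_box_cart less_imp_le intro!: fmeasurable_cbox simp del: measurable_lborel2)

lemma measure_angle_period_pos: "0 < measure lborel (angle_period (0 :: real ^ 'n::finite))"
proof -
  have "0 < measure lborel (cbox (\<chi> i. - 1) (\<chi> i. 1) :: (real ^ 'n) set)" by (simp add: measure_cube)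
  also have "\<dots> \<le> measure lborel (angle_period (0 :: real ^ 'n))"
  proof (rule measure_mono_fmeasurable[OF _ _ angle_period_fmeasurable])
    have "- pi < u \<and> u \<le> pi" if "- 1 \<le> u" "u \<le> 1" for u :: real using that pi_gt3 by linarith
    then show "cbox (\<chi> i. - 1) (\<chi> i. 1) \<subseteq> angle_period (0 :: real ^ 'n)"
      by (auto simp: angle_period_def mem_box_cart)
  qed simp
  finally show ?thesis .
qed

lemma emeasure_torus:
  "emeasure torus_volume (torus :: (complex ^ 'n::finite) set) = ennreal (measure lborel (angle_period (0 :: real ^ 'n)))"
proof -
  have "torus \<in> sets (borel_of (top_of_set (torus :: (complex ^ 'n) set)))" by (intro openin_in_sets_borel_of) auto
  then have "emeasure torus_volume (torus :: (complex ^ 'n) set) = emeasure lborel (angle_period (0 :: real ^ 'n))"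
    by (subst emeasure_torus_volume) (auto intro!: arg_cong[where f = "emeasure lborel"])
  then show ?thesis using angle_period_fmeasurable[where 'n = 'n] by (simp add: emeasure_eq_measure2)
qed

lemma prob_space_torus_prob: "prob_space (torus_prob :: (complex ^ 'n::finite) measure)"
  using measure_angle_period_pos[where 'n = 'n] by (intro prob_space_uniform_measure) (simp_all add: emeasure_torus)

lemma measure_torus_prob:
  fixes A :: "(complex ^ 'n::finite) set"
  assumes A: "A \<in> sets (borel_of (top_of_set torus))"
  shows "measure torus_prob A = measure lborel (angle_map -` A \<inter> angle_period 0) / measure lborel (angle_period (0 :: real ^ 'n))"
proof -
  have "A \<subseteq> torus" using sets.sets_into_space[OF A] by simp
  then have "measure torus_prob A = measure torus_volume A / measure torus_volume (torus :: (complex ^ 'n) set)"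
    using measure_angle_period_pos[where 'n = 'n] A
    by (subst measure_uniform_measure) (auto simp: emeasure_torus inf.absorb2)
  then show ?thesis
    using measure_angle_period_pos[where 'n = 'n] by (simp add: measure_def emeasure_torus_volume[OF A] emeasure_torus)
qed

text \<open>Chords rather than arcs: for p = 2 the sum is that of 2 - 2 cos, smooth on the whole
  torus, whereas the squared geodesic distance has a kink at the cut locus. For p = 1 chords are
  still Lipschitz and comparable to arcs.\<close>

definition torus_potential :: "nat \<Rightarrow> complex ^ 'n::finite \<Rightarrow> real" where
  "torus_potential p z = (\<Sum>i\<in>UNIV. norm (z $ i - 1) ^ p)"

lemma continuous_on_torus_potential: "continuous_on S (torus_potential p)"
  unfolding torus_potential_def by (intro continuous_intros)

text \<open>Each sublevel set at r is sandwiched between angular cubes with half-sides (r / n) powr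
  (1 / p) and 3 * r powr (1 / p), so its volume is of order r powr (n / p).\<close>

lemma potential_well_torus:
  assumes p: "0 < p"
  defines "n \<equiv> real CARD('n::finite)"
  shows "\<exists>M c\<^sub>1 c\<^sub>2. potential_well (torus_prob :: (complex ^ 'n) measure) (torus_potential p) M (n / real p) c\<^sub>1 c\<^sub>2"
proof -
  let ?\<phi> = "torus_potential p :: complex ^ 'n \<Rightarrow> real"
  let ?V = "measure lborel (angle_period (0 :: real ^ 'n))"
  interpret prob_space "torus_prob :: (complex ^ 'n) measure" by (rule prob_space_torus_prob)
  have V: "?V > 0" by (rule measure_angle_period_pos)
  have n: "n > 0" by (simp add: n_def)
  \<comment> \<open>Normalized volume of the inner cube, divided by r powr (n / p); the next
    constant does the same for the outer cube, the 6 being twice the arc-chord factor 3.\<close>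
  define c\<^sub>1 where "c\<^sub>1 = 2 ^ CARD('n) / (n powr (n / real p) * ?V)"
  define c\<^sub>2 where "c\<^sub>2 = 6 ^ CARD('n) / ?V"
  have meas: "?\<phi> \<in> borel_measurable (borel_of (top_of_set torus))"
    by (rule borel_of_measurable_continuous_map) (simp add: continuous_on_torus_potential)
  then have sub: "{z \<in> torus. ?\<phi> z \<le> r} \<in> sets (borel_of (top_of_set torus))" for r
    using measurable_sets[OF meas, of "{..r}"] by (simp add: vimage_def Int_def conj_commute)
  have prob: "prob {z \<in> torus. ?\<phi> z \<le> r} = measure lborel ({y. ?\<phi> (angle_map y) \<le> r} \<inter> angle_period 0) / ?V" for r
    unfolding measure_torus_prob[OF sub] by (simp add: vimage_def)
  have subm: "{y. ?\<phi> (angle_map y) \<le> r} \<inter> angle_period 0 \<in> sets lborel" for r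
    using measurable_sets[OF angle_map_measurable sub[of r]] by (simp add: vimage_def)
  have \<phi>_angle: "?\<phi> (angle_map y) = (\<Sum>i\<in>UNIV. norm (cis (y $ i) - 1) ^ p)" for y
    by (simp add: torus_potential_def angle_map_def)
  have root: "(r powr (1 / real p)) ^ p = r" if "0 < r" for r
    using that p by (simp add: powr_realpow[symmetric] powr_powr)
  have pow: "(u * r powr (1 / real p)) ^ CARD('n) = u ^ CARD('n) * r powr (n / real p)" if "0 < r" for r u
  proof -
    have "(r powr (1 / real p)) ^ CARD('n) = r powr (n / real p)"
      using that by (simp add: powr_realpow[symmetric] powr_powr n_def)
    then show ?thesis by (simp add: power_mult_distrib)
  qed
  have "potential_well (torus_prob :: (complex ^ 'n) measure) ?\<phi> (n * 2 ^ p) (n / real p) c\<^sub>1 c\<^sub>2"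
  proof
    show "?\<phi> \<in> borel_measurable torus_prob"
      using meas by (simp add: measurable_def)
    show "0 \<le> ?\<phi> x" for x by (simp add: torus_potential_def sum_nonneg)
    show "?\<phi> x \<le> n * 2 ^ p" if "x \<in> space torus_prob" for x
    proof -
      have "norm (x $ i - 1) \<le> 2" for i
        using that norm_triangle_ineq4[of "x $ i" 1] by (simp add: torus_def)
      then have "norm (x $ i - 1) ^ p \<le> 2 ^ p" for i by (intro power_mono) auto
      then have "?\<phi> x \<le> (\<Sum>i\<in>(UNIV :: 'n set). 2 ^ p)" unfolding torus_potential_def by (intro sum_mono)
      then show ?thesis by (simp add: n_def)
    qed
    show "0 < n * 2 ^ p" "0 < n / real p" "0 < c\<^sub>1" "0 < c\<^sub>2" using n p V by (auto simp: c\<^sub>1_def c\<^sub>2_def)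
    show "c\<^sub>1 * r powr (n / real p) \<le> prob {x \<in> space torus_prob. ?\<phi> x \<le> r}" if r: "0 < r" "r \<le> n * 2 ^ p" for r
    proof -
      define \<delta> where "\<delta> = (r / n) powr (1 / real p)"
      have rn: "0 < r / n" "r / n \<le> 2 ^ p" using r n by (auto simp: field_simps)
      have \<delta>: "0 \<le> \<delta>" "\<delta> ^ p = r / n" using root[OF rn(1)] by (auto simp: \<delta>_def)
      then have "\<delta> ^ p \<le> 2 ^ p" using rn by simp
      then have "\<delta> \<le> 2" using p by (subst (asm) power_mono_iff) (use \<delta> in auto)
      \<comment> \<open>The restriction r \<le> n * 2 ^ p is used here: it keeps the inner cube
        within one period.\<close>
      then have \<delta>pi: "\<delta> < pi" using pi_gt3 by linarith
      have "cbox (\<chi> i. - \<delta>) (\<chi> i. \<delta>) \<subseteq> {y. ?\<phi> (angle_map y) \<le> r} \<inter> angle_period (0 :: real ^ 'n)"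
      proof
        fix y :: "real ^ 'n" assume "y \<in> cbox (\<chi> i. - \<delta>) (\<chi> i. \<delta>)"
        then have y: "\<bar>y $ i\<bar> \<le> \<delta>" for i by (simp add: mem_box_cart abs_le_iff) (metis minus_le_iff)
        have "norm (cis (y $ i) - 1) ^ p \<le> \<delta> ^ p" for i
          using norm_cis_diff_le[of "y $ i" 0] y[of i] by (intro power_mono) auto
        then have "?\<phi> (angle_map y) \<le> (\<Sum>i\<in>(UNIV :: 'n set). \<delta> ^ p)" unfolding \<phi>_angle by (intro sum_mono)
        also have "\<dots> = r" using n \<delta> by (simp add: n_def)
        finally have "?\<phi> (angle_map y) \<le> r" .
        moreover have "- pi < y $ i \<and> y $ i \<le> pi" for i using y[of i] \<delta>pi by linarith
        ultimately show "y \<in> {y. ?\<phi> (angle_map y) \<le> r} \<inter> angle_period 0" by (simp add: angle_period_def)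
      qed
      then have "measure lborel (cbox (\<chi> i. - \<delta>) (\<chi> i. \<delta>) :: (real ^ 'n) set) \<le>
        measure lborel ({y. ?\<phi> (angle_map y) \<le> r} \<inter> angle_period (0 :: real ^ 'n))"
        by (rule measure_mono_fmeasurable)
          (use subm fmeasurableI2[OF angle_period_fmeasurable[where 'n = 'n], of "{y. ?\<phi> (angle_map y) \<le> r} \<inter> angle_period 0"] in auto)
      then have "(2 * \<delta>) ^ CARD('n) / ?V \<le> prob {z \<in> torus. ?\<phi> z \<le> r}"
        unfolding prob measure_cube[OF \<delta>(1)] using V by (simp add: divide_right_mono)
      also have "(2 * \<delta>) ^ CARD('n) / ?V = c\<^sub>1 * r powr (n / real p)"
        unfolding \<delta>_def pow[OF rn(1)] c\<^sub>1_def using r n by (simp add: powr_divide)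
      finally show ?thesis by simp
    qed
    show "prob {x \<in> space torus_prob. ?\<phi> x \<le> r} \<le> c\<^sub>2 * r powr (n / real p)" if r: "0 < r" for r
    proof -
      define \<delta> where "\<delta> = 3 * r powr (1 / real p)"
      have \<delta>: "0 \<le> \<delta>" by (simp add: \<delta>_def)
      have "{y. ?\<phi> (angle_map y) \<le> r} \<inter> angle_period (0 :: real ^ 'n) \<subseteq> cbox (\<chi> i. - \<delta>) (\<chi> i. \<delta>)"
      proof
        fix y :: "real ^ 'n" assume y: "y \<in> {y. ?\<phi> (angle_map y) \<le> r} \<inter> angle_period 0"
        have "\<bar>y $ i\<bar> \<le> \<delta>" for i
        proof -
          have "- pi < y $ i" "y $ i \<le> pi" using y by (auto simp: angle_period_def)
          then have "\<bar>y $ i\<bar> \<le> pi" by linarith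
          then have 1: "\<bar>y $ i\<bar> / 3 \<le> norm (cis (y $ i) - 1)" by (rule norm_cis_minus_1_ge)
          have "norm (cis (y $ i) - 1) ^ p \<le> ?\<phi> (angle_map y)"
            unfolding \<phi>_angle by (rule member_le_sum) auto
          also have "\<dots> \<le> (r powr (1 / real p)) ^ p" using y root[OF r] by simp
          finally have "norm (cis (y $ i) - 1) \<le> r powr (1 / real p)"
            using p by (subst (asm) power_mono_iff) auto
          with 1 show ?thesis by (simp add: \<delta>_def)
        qed
        then show "y \<in> cbox (\<chi> i. - \<delta>) (\<chi> i. \<delta>)" by (simp add: mem_box_cart abs_le_iff) (metis minus_le_iff)
      qed
      then have "measure lborel ({y. ?\<phi> (angle_map y) \<le> r} \<inter> angle_period (0 :: real ^ 'n)) \<le>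
        measure lborel (cbox (\<chi> i. - \<delta>) (\<chi> i. \<delta>) :: (real ^ 'n) set)"
        by (rule measure_mono_fmeasurable[OF _ subm fmeasurable_cbox])
      then have "prob {z \<in> torus. ?\<phi> z \<le> r} \<le> (2 * \<delta>) ^ CARD('n) / ?V"
        unfolding prob measure_cube[OF \<delta>(1)] using V by (simp add: divide_right_mono)
      also have "2 * \<delta> = 6 * r powr (1 / real p)" by (simp add: \<delta>_def)
      finally show ?thesis unfolding pow[OF r] by (simp add: c\<^sub>2_def)
    qed
  qed
  then show ?thesis by blast
qed

section \<open>Regularity of the potential on the torus\<close>

lemma convex_angle_box: "convex (angle_box \<theta>)"
proof -
  have "angle_box \<theta> = box (\<theta> - (\<chi> i. pi)) (\<theta> + (\<chi> i. pi))" by (auto simp: angle_box_def mem_box_cart)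
  then show ?thesis by (simp only: convex_box)
qed

text \<open>A straight segment in a common chart. It makes the set of lengths nonempty, so that its
  infimum can be bounded from below.\<close>

lemma flat_torus_curve:
  fixes z :: "complex ^ 'n::finite"
  assumes "z \<in> torus" "w \<in> torus"
  shows "\<exists>l. curve_length flat_torus z w l"
proof -
  obtain \<theta> a b where \<theta>: "a \<in> angle_box \<theta>" "b \<in> angle_box \<theta>" "z = angle_map a" "w = angle_map b"
    using ex_chart[OF assms] by auto
  define c where "c t = a + t *\<^sub>R (b - a)" for t
  have in_box: "c ` {0..1} \<subseteq> angle_box \<theta>"
  proof safe
    fix t :: real assume "t \<in> {0..1}"
    then have "(1 - t) *\<^sub>R a + t *\<^sub>R b \<in> angle_box \<theta>"
      using convex_angle_box[of \<theta>] \<theta>(1,2) by (auto simp: convex_alt)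
    then show "c t \<in> angle_box \<theta>" by (simp add: c_def algebra_simps)
  qed
  have C1: "c C1_differentiable_on {0..1}"
    unfolding C1_differentiable_on_def
    by (rule exI[of _ "\<lambda>_. b - a"])
      (auto simp: c_def[abs_def] has_vector_derivative_def intro!: derivative_eq_intros)
  have chart: "(angle_map ` angle_box \<theta>, angle_coords \<theta>) \<in> charts flat_torus" by (auto simp: torus_chart_def)
  from curve_length.piece[OF chart zero_less_one C1] show ?thesis
    using in_box \<theta> by (auto simp: angle_coords_image c_def inv_into_angle_coords)
qed

lemma potential_1_angle_lipschitz:
  fixes u v :: "real ^ 'n::finite"
  shows "\<bar>torus_potential 1 (angle_map u) - torus_potential 1 (angle_map v)\<bar> \<le> real CARD('n) * norm (u - v)"
proof -
  have "\<bar>norm (cis (u $ i) - 1) - norm (cis (v $ i) - 1)\<bar> \<le> norm (u - v)" for i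
  proof -
    have "\<bar>norm (cis (u $ i) - 1) - norm (cis (v $ i) - 1)\<bar> \<le> norm (cis (u $ i) - cis (v $ i))"
      using norm_triangle_ineq3[of "cis (u $ i) - 1" "cis (v $ i) - 1"] by simp
    also have "\<dots> \<le> \<bar>(u - v) $ i\<bar>" using norm_cis_diff_le by simp
    also have "\<dots> \<le> norm (u - v)" by (rule component_le_norm_cart)
    finally show ?thesis .
  qed
  then have "(\<Sum>i\<in>(UNIV :: 'n set). \<bar>norm (cis (u $ i) - 1) - norm (cis (v $ i) - 1)\<bar>) \<le> (\<Sum>i\<in>(UNIV :: 'n set). norm (u - v))"
    by (intro sum_mono)
  then show ?thesis
    using sum_abs[of "\<lambda>i. norm (cis (u $ i) - 1) - norm (cis (v $ i) - 1)" UNIV]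
    by (simp add: torus_potential_def angle_map_def sum_subtractf)
qed

text \<open>With the identity metric, a piece has as length the integral of the coordinate speed,
  which dominates the coordinate displacement. Pieces are joined by the triangle inequality, so no
  global lift of the curve to angles is required.\<close>

lemma potential_1_curve:
  fixes x :: "complex ^ 'n::finite"
  assumes "curve_length flat_torus x y l"
  shows "\<bar>torus_potential 1 x - torus_potential 1 y\<bar> \<le> real CARD('n) * l"
  using assms
proof induction
  case (piece U \<phi> a b c)
  then obtain \<theta> where U: "U = angle_map ` angle_box \<theta>" and \<phi>: "\<phi> = angle_coords \<theta>"
    by (auto simp: torus_chart_def)
  have box: "c t \<in> angle_box \<theta>" if "t \<in> {a..b}" for t
    using piece(4) that unfolding U \<phi> angle_coords_image by blast
  have diff: "\<forall>t\<in>{a..b}. c differentiable at t" and cont: "continuous_on {a..b} (\<lambda>t. vector_derivative c (at t))"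
    using piece(3) by (auto simp: C1_differentiable_on_eq)
  have "((\<lambda>t. vector_derivative c (at t)) has_integral (c b - c a)) {a..b}"
    using diff piece(2)
    by (intro fundamental_theorem_of_calculus) (auto simp: vector_derivative_works intro: has_vector_derivative_at_within)
  then have "norm (c b - c a) = norm (integral {a..b} (\<lambda>t. vector_derivative c (at t)))"
    by (simp add: integral_unique)
  also have "\<dots> \<le> integral {a..b} (\<lambda>t. norm (vector_derivative c (at t)))"
    by (rule Henstock_Kurzweil_Integration.integral_norm_bound_integral)
      (auto intro!: integrable_continuous_real cont continuous_on_norm)
  finally have 1: "norm (c b - c a) \<le> integral {a..b} (\<lambda>t. norm (vector_derivative c (at t)))" .
  have "\<bar>torus_potential 1 (angle_map (c a)) - torus_potential 1 (angle_map (c b))\<bar> \<le> real CARD('n) * norm (c a - c b)"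
    by (rule potential_1_angle_lipschitz)
  also have "\<dots> \<le> real CARD('n) * integral {a..b} (\<lambda>t. norm (vector_derivative c (at t)))"
    using 1 by (intro mult_left_mono) (auto simp: norm_minus_commute)
  finally show ?case
    using box[of a] box[of b] piece(2) by (simp add: U \<phi> inv_into_angle_coords norm_eq_sqrt_inner)
next
  case (join x y l z l')
  then show ?case by (simp add: algebra_simps)
qed

lemma lipschitz_manifold_torus:
  "lipschitz_manifold (flat_torus :: (complex ^ 'n::finite, 'n) riemannian) (\<lambda>z. torus_potential 1 z *\<^sub>R e0)"
  unfolding lipschitz_manifold_def
proof (intro exI ballI)
  fix x y :: "complex ^ 'n"
  assume "x \<in> points (flat_torus :: (complex ^ 'n, 'n) riemannian)" "y \<in> points (flat_torus :: (complex ^ 'n, 'n) riemannian)"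
  then have ne: "{l. curve_length flat_torus x y l} \<noteq> {}" using flat_torus_curve[of x y] by simp
  have "\<bar>torus_potential 1 x - torus_potential 1 y\<bar> / real CARD('n) \<le> geodesic_dist flat_torus x y"
    unfolding geodesic_dist_def
    by (rule cInf_greatest[OF ne]) (use potential_1_curve in \<open>auto simp: field_simps\<close>)
  then have "\<bar>torus_potential 1 x - torus_potential 1 y\<bar> \<le> real CARD('n) * geodesic_dist flat_torus x y"
    by (simp add: field_simps)
  then show "norm (torus_potential 1 x *\<^sub>R e0 - torus_potential 1 y *\<^sub>R e0) \<le> real CARD('n) * geodesic_dist flat_torus x y"
    by (simp flip: scaleR_left_diff_distrib)
qed

lemma potential_2_angle_map: "torus_potential 2 (angle_map y) = (\<Sum>i\<in>UNIV. 2 - 2 * cos (y $ i))"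
proof -
  have "(norm (cis u - 1))\<^sup>2 = 2 - 2 * cos u" for u
    using sin_cos_squared_add[of u] by (simp add: cmod_power2) (simp add: power2_eq_square algebra_simps)
  then show ?thesis by (simp add: torus_potential_def angle_map_def)
qed

text \<open>The derivative is a combination of fixed coordinate functionals with coefficients 2 sin,
  which are Lipschitz in the angles. One formula and one constant therefore work in every
  chart.\<close>

lemma lipschitz_derivative_manifold_torus:
  "lipschitz_derivative_manifold (flat_torus :: (complex ^ 'n::finite, 'n) riemannian) (\<lambda>z. torus_potential 2 z *\<^sub>R e0)"
proof -
  define B :: "'n \<Rightarrow> (real ^ 'n) \<Rightarrow>\<^sub>L ell2" where "B i = Blinfun (\<lambda>v. v $ i *\<^sub>R e0)" for i
  have B: "blinfun_apply (B i) v = v $ i *\<^sub>R e0" for i v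
    unfolding B_def by (subst bounded_linear_Blinfun_apply)
      (auto intro: bounded_linear_compose[OF bounded_linear_scaleR_left bounded_linear_vec_nth])
  define D where "D y = (\<Sum>i\<in>UNIV. (2 * sin (y $ i)) *\<^sub>R B i)" for y :: "real ^ 'n"
  define L where "L = (\<Sum>i\<in>UNIV. 2 * norm (B i))"
  have lip: "L-lipschitz_on S D" for S
  proof (rule lipschitz_onI)
    show "0 \<le> L" by (simp add: L_def sum_nonneg)
    fix y y' :: "real ^ 'n"
    have "dist (D y) (D y') = norm (\<Sum>i\<in>UNIV. (2 * (sin (y $ i) - sin (y' $ i))) *\<^sub>R B i)"
      by (simp add: dist_norm D_def algebra_simps flip: sum_subtractf)
    also have "\<dots> \<le> (\<Sum>i\<in>UNIV. 2 * norm (B i) * dist y y')"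
    proof (rule order.trans[OF norm_sum sum_mono])
      fix i
      have "\<bar>sin (y $ i) - sin (y' $ i)\<bar> \<le> norm (cis (y $ i) - cis (y' $ i))"
        using abs_Im_le_cmod[of "cis (y $ i) - cis (y' $ i)"] by simp
      also have "\<dots> \<le> \<bar>(y - y') $ i\<bar>" using norm_cis_diff_le by simp
      also have "\<dots> \<le> dist y y'" unfolding dist_norm by (rule component_le_norm_cart)
      finally have "\<bar>sin (y $ i) - sin (y' $ i)\<bar> * (2 * norm (B i)) \<le> dist y y' * (2 * norm (B i))"
        by (intro mult_right_mono) auto
      then show "norm ((2 * (sin (y $ i) - sin (y' $ i))) *\<^sub>R B i) \<le> 2 * norm (B i) * dist y y'"
        by (simp add: abs_mult mult_ac del: right_diff_distrib_numeral)
    qed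
    finally show "dist (D y) (D y') \<le> L * dist y y'" by (simp add: L_def sum_distrib_right)
  qed
  have der: "(((\<lambda>z. torus_potential 2 z *\<^sub>R e0) \<circ> inv_into (angle_map ` angle_box \<theta>) (angle_coords \<theta>))
      has_derivative blinfun_apply (D y)) (at y)" if y: "y \<in> angle_box \<theta>" for \<theta> y
  proof -
    have D_apply: "blinfun_apply (D y) = (\<lambda>v. (\<Sum>i\<in>UNIV. 2 * sin (y $ i) * v $ i) *\<^sub>R e0)"
      by (rule ext) (simp add: D_def blinfun.sum_left blinfun.scaleR_left B scaleR_sum_left)
    have nth: "((\<lambda>x. x $ i) has_derivative (\<lambda>v. v $ i)) (at y)" for i
      by (rule bounded_linear_imp_has_derivative[OF bounded_linear_vec_nth])
    have "((\<lambda>x. 2 - 2 * cos (x $ i)) has_derivative (\<lambda>v. 2 * sin (y $ i) * v $ i)) (at y)" for i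
      by (auto intro!: derivative_eq_intros nth)
    then have "((\<lambda>x. (\<Sum>i\<in>UNIV. 2 - 2 * cos (x $ i)) *\<^sub>R e0) has_derivative
      (\<lambda>v. (\<Sum>i\<in>UNIV. 2 * sin (y $ i) * v $ i) *\<^sub>R e0)) (at y)"
      by (intro has_derivative_scaleR_left has_derivative_sum)
    then show ?thesis unfolding D_apply
      by (rule has_derivative_transform_within_open[OF _ open_angle_box y])
        (simp add: inv_into_angle_coords potential_2_angle_map)
  qed
  have main: "\<exists>D. (\<forall>y\<in>angle_box \<theta>.
        ((\<lambda>z. torus_potential 2 z *\<^sub>R e0) \<circ> inv_into (angle_map ` angle_box \<theta>) (angle_coords \<theta>)
          has_derivative blinfun_apply (D y)) (at y)) \<and>
        (\<forall>y\<in>angle_box \<theta>. \<exists>e>0. \<exists>L. L-lipschitz_on (ball y e \<inter> angle_box \<theta>) D)" for \<theta> :: "real ^ 'n"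
    using der lip by (intro exI[of _ D] conjI ballI exI[of _ "1 :: real"] exI[of _ L]) auto
  show ?thesis
    unfolding lipschitz_derivative_manifold_def flat_torus_simps torus_chart_def
    by (simp only: ball_simps prod.case angle_coords_image) (use main in \<open>simp add: angle_coords_angle_map cong: ball_cong\<close>)
qed

lemma convex_on_half_square: "convex_on UNIV (\<lambda>x :: real. x\<^sup>2 / 2)"
proof (rule convex_onI)
  fix t x y :: real assume t: "0 < t" "t < 1"
  have "(1 - t) * (x\<^sup>2 / 2) + t * (y\<^sup>2 / 2) - ((1 - t) *\<^sub>R x + t *\<^sub>R y)\<^sup>2 / 2 = t * (1 - t) * (x - y)\<^sup>2 / 2"
    by (simp add: power2_eq_square field_simps)
  moreover have "0 \<le> t * (1 - t) * (x - y)\<^sup>2 / 2" using t by simp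
  ultimately show "((1 - t) *\<^sub>R x + t *\<^sub>R y)\<^sup>2 / 2 \<le> (1 - t) * (x\<^sup>2 / 2) + t * (y\<^sup>2 / 2)" by linarith
qed simp

text \<open>All four settings at once: \<open>p\<close> is fixed by the smoothness of the feature
  and \<open>star\<close> selects the loss. Squaring the moment doubles the effective power, which
  is why q is p or 2 * p.\<close>

lemma torus_apgm_lower_bound:
  fixes p :: nat and star :: bool
  assumes p: "0 < p"
    and S: "star \<longleftrightarrow> S \<in> {S_I_star, S_II_star}"
      "S \<in> {S_I, S_I_star} \<Longrightarrow> lipschitz_manifold flat_torus (\<lambda>z :: complex ^ 'n. torus_potential p z *\<^sub>R e0)"
      "S \<notin> {S_I, S_I_star} \<Longrightarrow> lipschitz_derivative_manifold flat_torus (\<lambda>z :: complex ^ 'n. torus_potential p z *\<^sub>R e0)"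
      "exponent_q S = (if star then 2 * p else p)"
  shows "\<exists>(M :: (complex ^ 'n, 'n::finite) riemannian) \<nu> \<tau> (P :: (complex ^ 'n, ell2) objective).
    compact_riemannian_manifold M \<and> volume_measure M \<nu> \<and> \<tau> = uniform_measure \<nu> (points M) \<and>
    assumption_A1 (mtop M) P \<and> in_setting S M \<tau> P \<and>
    (\<forall>s>0. (\<exists>f g h. apgm \<tau> P eta2 s (\<lambda>_. 1) f g h) \<and>
      (\<exists>c>0. \<forall>f g h. apgm \<tau> P eta2 s (\<lambda>_. 1) f g h \<longrightarrow>
        (\<forall>k\<ge>1. F_fun \<tau> P (f k) - inf_F \<tau> P \<ge>
          ereal (c * real k powr - (2 * real (exponent_q S) / (real CARD('n) + real (exponent_q S)))))))"
proof -
  let ?\<tau> = "torus_prob :: (complex ^ 'n) measure"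
  let ?\<phi> = "torus_potential p :: complex ^ 'n \<Rightarrow> real"
  let ?n = "real CARD('n)"
  define R R' :: "real \<Rightarrow> real" where "R = (if star then (\<lambda>x. x\<^sup>2 / 2) else (\<lambda>x. x))" and "R' = (if star then (\<lambda>x. x) else (\<lambda>_. 1))"
  obtain M c\<^sub>1 c\<^sub>2 where "potential_well ?\<tau> ?\<phi> M (?n / real p) c\<^sub>1 c\<^sub>2"
    using potential_well_torus[OF p] by blast
  then interpret potential_well ?\<tau> ?\<phi> M "?n / real p" c\<^sub>1 c\<^sub>2 .
  have R_deriv: "(R has_real_derivative R' x) (at x)" for x
    by (cases star) (auto simp: R_def R'_def intro!: derivative_eq_intros)
  interpret ray_problem ?\<tau> ?\<phi> M "?n / real p" c\<^sub>1 c\<^sub>2 R R'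
    by unfold_locales (use R_deriv in \<open>auto simp: R_def R'_def\<close>)
  have np: "0 < ?n" "0 < real p" using p by auto
  \<comment> \<open>Here \<beta> = d / p. The exponent 2 * \<kappa> of the linear loss is 2 p / (d +
    p), and 4 * \<kappa> / (1 + \<kappa>) of the quadratic loss is 4 p / (d + 2 p); both have the
    form 2 q / (d + q).\<close>
  have \<kappa>_eq: "\<kappa> = real p / (?n + real p)" using np by (simp add: \<kappa>_def field_simps)
  have \<kappa>2: "4 * \<kappa> / (1 + \<kappa>) = 2 * real (2 * p) / (?n + real (2 * p))"
    using np by (simp add: \<kappa>_eq divide_simps)
  have "convex_on UNIV R" using convex_on_half_square by (cases star) (auto simp: R_def convex_on_def)
  moreover have "1-lipschitz_on UNIV R'"
    by (cases star) (auto simp: R'_def intro!: lipschitz_onI)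
  ultimately have A1: "assumption_A1 (top_of_set torus) (ray_objective ?\<phi> R)"
    using R_deriv by (intro assumption_A1_ray) (auto simp: continuous_on_torus_potential)
  have "angle_map 0 \<in> space ?\<tau>" "?\<phi> (angle_map 0) = 0"
    using p by (simp, simp add: torus_potential_def angle_map_def)
  from ex_minimizer[OF this] obtain \<mu> where \<mu>: "signed_measure ?\<tau> \<mu>" "F_bar ?\<tau> obj \<mu> = inf_F ?\<tau> obj"
    "\<And>\<theta>. dG_bar ?\<tau> obj \<mu> \<theta> = R' 0 * ?\<phi> \<theta>" by blast
  have setting: "in_setting S flat_torus ?\<tau> obj"
    unfolding in_setting_def using S \<mu> by (auto simp: ray_objective_def R'_def)
  have gap: "\<exists>c>0. \<forall>f g h. apgm ?\<tau> obj eta2 s (\<lambda>_. 1) f g h \<longrightarrow> (\<forall>k\<ge>1. F_fun ?\<tau> obj (f k) - inf_F ?\<tau> obj \<ge>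
      ereal (c * real k powr - (2 * real (exponent_q S) / (?n + real (exponent_q S)))))" if s: "0 < s" for s
  proof (cases star)
    case True
    then have "\<And>x. R x = x\<^sup>2 / 2" "\<And>x. R' x = x" by (simp_all add: R_def R'_def)
    from gap_quadratic[OF s this] show ?thesis unfolding \<kappa>2 S(4) using True by simp
  next
    case False
    then have "\<And>x. R x = x" "\<And>x. R' x = 1" by (simp_all add: R_def R'_def)
    from gap_linear[OF s this] show ?thesis unfolding \<kappa>_eq S(4) using False by simp
  qed
  show ?thesis
    by (rule exI[of _ flat_torus], rule exI[of _ torus_volume], rule exI[of _ ?\<tau>], rule exI[of _ obj])
      (use compact_riemannian_flat_torus volume_measure_flat_torus A1 setting gap apgm_exists in auto)
qed

theorem proposition5p4:
  fixes S :: setting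
  shows "\<exists>(M :: (complex ^ 'n, 'n::finite) riemannian) \<nu> \<tau> (P :: (complex ^ 'n, ell2) objective).
    compact_riemannian_manifold M \<and> volume_measure M \<nu> \<and> \<tau> = uniform_measure \<nu> (points M) \<and>
    assumption_A1 (mtop M) P \<and> in_setting S M \<tau> P \<and>
    (\<forall>s>0. (\<exists>f g h. apgm \<tau> P eta2 s (\<lambda>_. 1) f g h) \<and>
      (\<exists>c>0. \<forall>f g h. apgm \<tau> P eta2 s (\<lambda>_. 1) f g h \<longrightarrow>
        (\<forall>k\<ge>1. F_fun \<tau> P (f k) - inf_F \<tau> P \<ge>
          ereal (c * real k powr - (2 * real (exponent_q S) / (real CARD('n) + real (exponent_q S)))))))"
proof (cases S)
  case S_I
  then show ?thesis by (intro torus_apgm_lower_bound[of 1 False]) (auto simp: lipschitz_manifold_torus simp del: One_nat_def)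
next
  case S_I_star
  then show ?thesis by (intro torus_apgm_lower_bound[of 1 True]) (auto simp: lipschitz_manifold_torus simp del: One_nat_def)
next
  case S_II
  then show ?thesis by (intro torus_apgm_lower_bound[of 2 False]) (auto simp: lipschitz_derivative_manifold_torus)
next
  case S_II_star
  then show ?thesis by (intro torus_apgm_lower_bound[of 2 True]) (auto simp: lipschitz_derivative_manifold_torus)
qed

end
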